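(* Consider the stochastic decentralized min-max problem and the algorithm DADAM$^3$ described in the context, run with $M$ nodes, mini-batch size $m_k$ at iteration $k$, $N$ iterations and $t$ mixing rounds per iteration. Suppose Assumptions 1, 2, 3, 4 of the context hold and the parameters satisfy the parameter conditions listed in the context. If $$t\ \ge\ \log_{1/\rho}(1+C),\qquad N\sim\tilde{\mathcal O}(\epsilon^{-2}),$$ then in each of the following three settings there exists an iterate $\bar{\mathbf z}_k$, $k\in\{1,\dots,N\}$, of the algorithm that is an $\epsilon$-stochastic first-order Nash equilibrium of the problem, i.e. $\mathbb E\|\nabla F(\bar{\mathbf z}_k)\|^2\le\epsilon^2$: 1. $m_k=\mathcal O(\epsilon^{-2})$, $M=\mathcal O(1)$, $C=\mathcal O(\epsilon^{-2})$; 2. $m_k=k+1$, $M=\mathcal O(1)$, $C=\mathcal O(\epsilon^{-2})$; 3. $m_k=\mathcal O(1)$, $M=\mathcal O(\epsilon^{-2})$, $C=\mathcal O(\epsilon^{-4})$. (The $\mathcal O$ and $\tilde{\mathcal O}$ expressions state the orders of magnitude, in $\epsilon$, with which $N$, $m_k$, $M$ and $C$ are to be chosen; $\tilde{\mathcal O}$ hides logarithmic factors.)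
   Context: **Problem.** Let $d=p_1+p_2$ and write $\mathbf y=(\boldsymbol\theta,\boldsymbol\alpha)\in\mathbb R^{p_1}\times\mathbb R^{p_2}=\mathbb R^d$. The problem is $\min_{\boldsymbol\theta}\max_{\boldsymbol\alpha}F(\boldsymbol\theta,\boldsymbol\alpha)$ with $F(\mathbf y)=\frac1M\sum_{i=1}^M F_i(\mathbf y)$, where all $M$ nodes share the same distribution: $F_i(\mathbf y)=\mathbb E_{\xi\sim\mathcal D}[f(\mathbf y;\xi)]$ for every $i$. Throughout, $\nabla$ denotes the signed gradient $\nabla F(\mathbf y)=[\nabla_{\boldsymbol\theta}F,-\nabla_{\boldsymbol\alpha}F]\in\mathbb R^d$ and $\nabla f(\mathbf y;\xi)=[\nabla_{\boldsymbol\theta}f,-\nabla_{\boldsymbol\alpha}f]\in\mathbb R^d$. $\|\cdot\|$ is the Euclidean norm and $\|\cdot\|_\infty$ the maximum norm. A random point $\mathbf y^*$ is an $\epsilon$-stochastic first-order Nash equilibrium ($\epsilon$-SFNE) if $\mathbb E\|\nabla F(\mathbf y^* )\|^2\le\epsilon^2$. **Algorithm DADAM$^3$.** All matrices are $d\times M$, and column $i$ belongs to node $i$: $\mathbf X_k=[\mathbf x_{1,k},\dots,\mathbf x_{M,k}]$, $\mathbf Z_k=[\mathbf z_{1,k},\dots,\mathbf z_{M,k}]$, $\mathbf M_k$, $\mathbf V_k$, $\boldsymbol\Lambda_k=[\tilde{\mathbf v}_{1,k},\dots,\tilde{\mathbf v}_{M,k}]$, $\mathbf D_k$, $\widehat{\mathbf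 G}_k=[\widehat{\mathbf g}_{1,k},\dots,\widehat{\mathbf g}_{M,k}]$. Initialize $\mathbf Z_0=\mathbf X_0=\mathbf M_0=\mathbf V_0=\mathbf D_0=0$, with $\boldsymbol\Lambda_0$ given. $\mathbf W$ is the $M\times M$ mixing matrix, $\mathbf W^t$ its $t$-th power, and $\eta>0$ the step-size. For $k=1,\dots,N$: - $\mathbf Z_k=(\mathbf X_{k-1}-\eta\mathbf D_{k-1})\mathbf W^t$; - each node $i$ draws a mini-batch of samples $\xi_{k,i}^1,\dots,\xi_{k,i}^{m_k}$ from $\mathcal D$ and sets $\widehat{\mathbf g}_{i,k}=\frac1{m_k}\sum_{j=1}^{m_k}\nabla f(\mathbf z_{i,k};\xi_{k,i}^j)$; - $\mathbf M_k=\beta_{1,k}\mathbf M_{k-1}+(1-\beta_{1,k})\widehat{\mathbf G}_k$; - $\mathbf V_k=\beta_2\mathbf V_{k-1}+(1-\beta_2)\widehat{\mathbf G}_k\odot\widehat{\mathbf G}_k$; - $\boldsymbol\Lambda_k=\beta_3\boldsymbol\Lambda_{k-1}+(1-\beta_3)\max(\boldsymbol\Lambda_{k-1},\mathbf V_k)$; - $\mathbf D_k=\boldsymbol\Lambda_k^{-1/2}\odot\mathbf M_k$; - $\mathbf X_k=(\mathbf X_{k-1}-\eta\mathbf D_k)\mathbf W^t$. Here $\odot$ is the entrywise product, and the power and max are entrywise. Expectations are over all samples drawn by the algorithm, and $\bar{\mathbf z}_k=\frac1M\sum_{i=1}^M\mathbf z_{i,k}$. **Assumption 1.** For all $\mathbf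 x,\mathbf y\in\mathbb R^d$: (1) $\mathbb E_{\xi\sim\mathcal D}[\nabla f(\mathbf x,\xi)]=\nabla F(\mathbf x)$; (2) $\|\nabla f(\mathbf x,\xi)\|_\infty\le G_\infty<\infty$ for all $\xi\sim\mathcal D$; (3) bounded variance: $\mathbb E_{\xi\sim\mathcal D}[\|\nabla f(\mathbf x,\xi)-\nabla F(\mathbf x)\|^2]=\sigma^2<\infty$; (4) $\|\nabla F(\mathbf x)-\nabla F(\mathbf y)\|\le L\|\mathbf x-\mathbf y\|$ with $0\le L<\infty$. **Assumption 2 (Minty VI condition).** There is $\mathbf x_*\in\mathbb R^d$ with $\langle\mathbf x-\mathbf x_*,\nabla F(\mathbf x)\rangle\ge0$ for all $\mathbf x\in\mathbb R^d$. **Assumption 3.** For the point $\mathbf x_*$ of Assumption 2 and the points $\mathbf z_{i,k}$ generated by the algorithm: $\|\mathbf x_*\|\le D/2$ and $\|\mathbf z_{i,k}\|\le D/2$ for all $i,k$, where $D$ is a constant. **Assumption 4.** The communication graph on the nodes $\{1,\dots,M\}$ is fixed and undirected; its associated mixing matrix $\mathbf W$ (with $[\mathbf W]_{ij}=0$ when nodes $i,j$ are disconnected, $[\mathbf W]_{ij}>0$ when $j$ is a neighbor of $i$) is doubly stochastic, and $\rho:=\max\{|\sigma_2(\mathbf W)|,|\sigma_M(\mathbf W)|\}<1$, where $\sigma_j(\mathbf W)$ denotes the $j$-th largest eigenvalue of $\mathbf W$. **Parameter conditions.** $\beta_{1,k}=\beta_{1,1}\lambda^{k-1}$ with $\lambda\in(0,1)$;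 $\beta_{1,1},\beta_2,\beta_3\in[0,1)$; $\beta_{1,1}\le\frac{1}{1+\sqrt{108G_\infty/(MG_0^3)}}$; $\eta\le\sqrt{G_0^3/(72L^2G_\infty)}$; and $G_0^2\le\|\tilde{\mathbf v}_{i,0}\|_\infty\le G_\infty^2$ for $i=1,\dots,M$, where $G_0$ is a positive constant.
   Formalization: The lower bound G_0^2 on the initial vectors ṽ_{i,0} is required of every coordinate rather than only of the maximum norm (with the latter the claim is false); W is taken symmetric, as the undirected graph and ordered real eigenvalues suggest. *)

theory Defs
  imports
    "HOL-Probability.Probability"
    "HOL-Library.Landau_Symbols"
    "Jordan_Normal_Form.Char_Poly"
begin

no_notation vec_index (infixl \<open>$\<close> 100)

text \<open>
  A point \<open>y = (\<theta>, \<alpha>)\<close> of the min-max problem is a vector indexed by the sum type \<open>'p1 + 'p2\<close>: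
  the coordinates \<open>Inl _\<close> form \<open>\<theta>\<close> and the coordinates \<open>Inr _\<close> form \<open>\<alpha>\<close>.  The signed gradient
  is \<open>[\<nabla>\<^sub>\<theta> h, - \<nabla>\<^sub>\<alpha> h]\<close>.
\<close>

definition signed_grad ::
  "(real ^ ('p1::finite + 'p2::finite) \<Rightarrow> real) \<Rightarrow> real ^ ('p1 + 'p2) \<Rightarrow> real ^ ('p1 + 'p2)" where
  "signed_grad h y = (\<chi> s. case s of
      Inl _ \<Rightarrow> frechet_derivative h (at y) (axis s 1)
    | Inr _ \<Rightarrow> - frechet_derivative h (at y) (axis s 1))"

definition node_objective :: "'s measure \<Rightarrow> ('v \<Rightarrow> 's \<Rightarrow> real) \<Rightarrow> 'v \<Rightarrow> real" where
  "node_objective \<D> f y = (LINT \<xi>|\<D>. f y \<xi>)"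

text \<open>All \<open>M\<close> nodes share the distribution \<open>\<D>\<close>, so the summands below do not depend on \<open>i\<close>.\<close>

definition global_objective :: "'s measure \<Rightarrow> ('v \<Rightarrow> 's \<Rightarrow> real) \<Rightarrow> nat \<Rightarrow> 'v \<Rightarrow> real" where
  "global_objective \<D> f M y = (1 / real M) * (\<Sum>i<M. node_objective \<D> f y)"

definition SFNE ::
  "'w measure \<Rightarrow> (real ^ ('p1::finite + 'p2::finite) \<Rightarrow> real) \<Rightarrow> real \<Rightarrow>
    ('w \<Rightarrow> real ^ ('p1 + 'p2)) \<Rightarrow> bool" where
  "SFNE P F \<epsilon> y \<longleftrightarrow>
     integrable P (\<lambda>\<omega>. (norm (signed_grad F (y \<omega>)))\<^sup>2) \<and>
     (LINT \<omega>|P. (norm (signed_grad F (y \<omega>)))\<^sup>2) \<le> \<epsilon>\<^sup>2"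

text \<open>
  The \<open>j\<close>-th largest real eigenvalue, \<open>j = 1, 2, \<dots>\<close>, counted with multiplicity.  For a \<open>1 \<times> 1\<close>
  stochastic matrix \<^term>\<open>mixing_rate W\<close> below is at least 1, whatever the value of the
  nonexistent second eigenvalue.
\<close>

definition nth_eigenvalue :: "real mat \<Rightarrow> nat \<Rightarrow> real" where
  "nth_eigenvalue W j = rev (sorted_list_of_multiset (proots (char_poly W))) ! (j - 1)"

definition mixing_rate :: "real mat \<Rightarrow> real" where
  "mixing_rate W = max \<bar>nth_eigenvalue W 2\<bar> \<bar>nth_eigenvalue W (dim_row W)\<bar>"

definition doubly_stochastic :: "real mat \<Rightarrow> bool" where
  "doubly_stochastic W \<longleftrightarrow> W \<in> carrier_mat (dim_row W) (dim_row W) \<and>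
     (\<forall>i<dim_row W. \<forall>j<dim_row W. 0 \<le> W $$ (i, j)) \<and>
     (\<forall>i<dim_row W. (\<Sum>j<dim_row W. W $$ (i, j)) = 1) \<and>
     (\<forall>j<dim_row W. (\<Sum>i<dim_row W. W $$ (i, j)) = 1)"

text \<open>
  A \<open>d \<times> M\<close> matrix is represented by its columns, one for each node \<open>j < M\<close>;
  \<open>mix A Y\<close> is the product \<open>Y A\<close>.
\<close>

definition mix :: "real mat \<Rightarrow> (nat \<Rightarrow> real ^ 'd) \<Rightarrow> nat \<Rightarrow> real ^ 'd" where
  "mix A Y i = (\<Sum>j<dim_row A. A $$ (j, i) *\<^sub>R Y j)"

text \<open>
  The random sequences produced by a run: each field maps an iteration \<open>k\<close>, a node \<open>i\<close> and an
  outcome to the \<open>i\<close>-th column of the matrix of iteration \<open>k\<close>.  The fields \<open>mom\<close>, \<open>sqr\<close>, \<open>lam\<close>,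
  \<open>dir\<close> and \<open>ghat\<close> stand for the matrices \<open>M\<^sub>k\<close>, \<open>V\<^sub>k\<close>, \<open>\<Lambda>\<^sub>k\<close>, \<open>D\<^sub>k\<close> and the gradient estimates.
\<close>

record ('v, 'w) trace =
  xpt  :: "nat \<Rightarrow> nat \<Rightarrow> 'w \<Rightarrow> 'v"
  zpt  :: "nat \<Rightarrow> nat \<Rightarrow> 'w \<Rightarrow> 'v"
  ghat :: "nat \<Rightarrow> nat \<Rightarrow> 'w \<Rightarrow> 'v"
  mom  :: "nat \<Rightarrow> nat \<Rightarrow> 'w \<Rightarrow> 'v"
  sqr  :: "nat \<Rightarrow> nat \<Rightarrow> 'w \<Rightarrow> 'v"
  lam  :: "nat \<Rightarrow> nat \<Rightarrow> 'w \<Rightarrow> 'v"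
  dir  :: "nat \<Rightarrow> nat \<Rightarrow> 'w \<Rightarrow> 'v"

definition zbar :: "nat \<Rightarrow> ('v::real_vector, 'w) trace \<Rightarrow> nat \<Rightarrow> 'w \<Rightarrow> 'v" where
  "zbar M T k \<omega> = (1 / real M) *\<^sub>R (\<Sum>i<M. zpt T k i \<omega>)"

locale dadam3 =
  fixes G_inf G\<^sub>0 \<sigma> L diam \<beta>\<^sub>1\<^sub>1 \<beta>\<^sub>2 \<beta>\<^sub>3 decay \<eta> :: real
    and \<D> :: "'s measure"
    and f :: "real ^ ('p1::finite + 'p2::finite) \<Rightarrow> 's \<Rightarrow> real"
    and xs :: "real ^ ('p1 + 'p2)"
    and M :: nat
    and E :: "(nat \<times> nat) set"
    and W :: "real mat"
    and v0 :: "nat \<Rightarrow> real ^ ('p1 + 'p2)"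
    and N t :: nat
    and m :: "nat \<Rightarrow> nat"
    and P :: "'w measure"
    and \<xi> :: "nat \<Rightarrow> nat \<Rightarrow> nat \<Rightarrow> 'w \<Rightarrow> 's"
    and T :: "(real ^ ('p1 + 'p2), 'w) trace"
  \<comment> \<open>the problem is well posed: the objectives and their gradients exist\<close>
  assumes prob_D: "prob_space \<D>"
    and f_measurable: "(\<lambda>(y, s). f y s) \<in> borel_measurable (borel \<Otimes>\<^sub>M \<D>)"
    and f_integrable: "\<And>y. integrable \<D> (f y)"
    and f_differentiable: "\<And>y s. s \<in> space \<D> \<Longrightarrow> (\<lambda>x. f x s) differentiable (at y)"
    and F_differentiable: "\<And>y. global_objective \<D> f M differentiable (at y)"
  \<comment> \<open>Assumption 1\<close>
    and unbiased: "\<And>y. integrable \<D> (\<lambda>s. signed_grad (\<lambda>x. f x s) y)"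
      "\<And>y. (LINT s|\<D>. signed_grad (\<lambda>x. f x s) y) = signed_grad (global_objective \<D> f M) y"
    and bounded_grad: "\<And>y. AE s in \<D>. infnorm (signed_grad (\<lambda>x. f x s) y) \<le> G_inf"
    and variance: "\<And>y. (LINT s|\<D>. (norm (signed_grad (\<lambda>x. f x s) y
                                     - signed_grad (global_objective \<D> f M) y))\<^sup>2) = \<sigma>\<^sup>2"
    and L_nonneg: "0 \<le> L"
    and lipschitz: "\<And>x y. norm (signed_grad (global_objective \<D> f M) x
                            - signed_grad (global_objective \<D> f M) y) \<le> L * norm (x - y)"
  \<comment> \<open>Assumption 2\<close>
    and minty: "\<And>x. 0 \<le> (x - xs) \<bullet> signed_grad (global_objective \<D> f M) x"
  \<comment> \<open>Assumption 3\<close>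
    and xs_bounded: "norm xs \<le> diam / 2"
    and z_bounded: "AE \<omega> in P. \<forall>k\<in>{1..N}. \<forall>i<M. norm (zpt T k i \<omega>) \<le> diam / 2"
  \<comment> \<open>Assumption 4; \<open>E\<close> is the adjacency relation of the undirected communication graph\<close>
    and M_pos: "1 \<le> M"
    and graph: "E \<subseteq> {..<M} \<times> {..<M}" "sym E" "irrefl E"
    and W_dim: "W \<in> carrier_mat M M"
    and W_nonadjacent: "\<And>i j. i < M \<Longrightarrow> j < M \<Longrightarrow> i \<noteq> j \<Longrightarrow> (i, j) \<notin> E \<Longrightarrow> W $$ (i, j) = 0"
    and W_adjacent: "\<And>i j. (i, j) \<in> E \<Longrightarrow> 0 < W $$ (i, j)"
    and W_symmetric: "transpose_mat W = W"
    and W_doubly_stochastic: "doubly_stochastic W"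
    and W_rate: "mixing_rate W < 1"
  \<comment> \<open>parameter conditions; the bound on \<open>\<eta>\<close> is void for \<open>L = 0\<close>, where the formula divides by 0\<close>
    and decay: "0 < decay" "decay < 1"
    and betas: "0 \<le> \<beta>\<^sub>1\<^sub>1" "\<beta>\<^sub>1\<^sub>1 < 1" "0 \<le> \<beta>\<^sub>2" "\<beta>\<^sub>2 < 1" "0 \<le> \<beta>\<^sub>3" "\<beta>\<^sub>3 < 1"
    and beta1_bound: "\<beta>\<^sub>1\<^sub>1 \<le> 1 / (1 + sqrt (108 * G_inf / (real M * G\<^sub>0 ^ 3)))"
    and eta_pos: "0 < \<eta>"
    and eta_bound: "L = 0 \<or> \<eta> \<le> sqrt (G\<^sub>0 ^ 3 / (72 * L\<^sup>2 * G_inf))"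
    and G0_pos: "0 < G\<^sub>0"
  \<comment> \<open>the lower bound is needed in every coordinate: with it on \<open>infnorm (v0 i)\<close> only,
      \<open>\<Lambda>\<^sub>k\<^sup>-\<^sup>1\<^sup>/\<^sup>2\<close> need not be defined, or may be arbitrarily large\<close>
    and v0_lower: "\<And>i s. i < M \<Longrightarrow> G\<^sub>0\<^sup>2 \<le> v0 i $ s"
    and v0_upper: "\<And>i. i < M \<Longrightarrow> infnorm (v0 i) \<le> G_inf\<^sup>2"
  \<comment> \<open>sampling: all drawn samples are independent with distribution \<open>\<D>\<close>\<close>
    and batch_pos: "\<And>k. k \<in> {1..N} \<Longrightarrow> 1 \<le> m k"
    and rounds_pos: "1 \<le> t" \<comment> \<open>implied by \<open>t \<ge> log\<^bsub>1/\<rho>\<^esub> (1 + C)\<close> unless \<open>\<rho> = 0\<close>, where that bound is void\<close>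
    and prob_P: "prob_space P"
    and samples_indep: "prob_space.indep_vars P (\<lambda>_. \<D>) (\<lambda>(k, i, j). \<xi> k i j)
                          {(k, i, j). k \<in> {1..N} \<and> i < M \<and> j < m k}"
    and samples_distr: "\<And>k i j. k \<in> {1..N} \<Longrightarrow> i < M \<Longrightarrow> j < m k \<Longrightarrow> distr P \<D> (\<xi> k i j) = \<D>"
  \<comment> \<open>the algorithm\<close>
    and init: "\<And>i \<omega>. i < M \<Longrightarrow> \<omega> \<in> space P \<Longrightarrow>
        zpt T 0 i \<omega> = 0 \<and> xpt T 0 i \<omega> = 0 \<and> mom T 0 i \<omega> = 0 \<and> sqr T 0 i \<omega> = 0 \<and>
        dir T 0 i \<omega> = 0 \<and> lam T 0 i \<omega> = v0 i"
    and z_step: "\<And>k i \<omega>. k \<in> {1..N} \<Longrightarrow> i < M \<Longrightarrow> \<omega> \<in> space P \<Longrightarrow>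
        zpt T k i \<omega> = mix (W ^\<^sub>m t) (\<lambda>j. xpt T (k - 1) j \<omega> - \<eta> *\<^sub>R dir T (k - 1) j \<omega>) i"
    and g_step: "\<And>k i \<omega>. k \<in> {1..N} \<Longrightarrow> i < M \<Longrightarrow> \<omega> \<in> space P \<Longrightarrow>
        ghat T k i \<omega> =
          (1 / real (m k)) *\<^sub>R (\<Sum>j<m k. signed_grad (\<lambda>x. f x (\<xi> k i j \<omega>)) (zpt T k i \<omega>))"
    and mom_step: "\<And>k i \<omega>. k \<in> {1..N} \<Longrightarrow> i < M \<Longrightarrow> \<omega> \<in> space P \<Longrightarrow>
        mom T k i \<omega> = (\<beta>\<^sub>1\<^sub>1 * decay ^ (k - 1)) *\<^sub>R mom T (k - 1) i \<omega>
                      + (1 - \<beta>\<^sub>1\<^sub>1 * decay ^ (k - 1)) *\<^sub>R ghat T k i \<omega>"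
    and sqr_step: "\<And>k i \<omega>. k \<in> {1..N} \<Longrightarrow> i < M \<Longrightarrow> \<omega> \<in> space P \<Longrightarrow>
        sqr T k i \<omega> = \<beta>\<^sub>2 *\<^sub>R sqr T (k - 1) i \<omega>
                      + (1 - \<beta>\<^sub>2) *\<^sub>R (\<chi> s. ghat T k i \<omega> $ s * ghat T k i \<omega> $ s)"
    and lam_step: "\<And>k i \<omega>. k \<in> {1..N} \<Longrightarrow> i < M \<Longrightarrow> \<omega> \<in> space P \<Longrightarrow>
        lam T k i \<omega> = \<beta>\<^sub>3 *\<^sub>R lam T (k - 1) i \<omega>
                      + (1 - \<beta>\<^sub>3) *\<^sub>R (\<chi> s. max (lam T (k - 1) i \<omega> $ s) (sqr T k i \<omega> $ s))"
    and dir_step: "\<And>k i \<omega>. k \<in> {1..N} \<Longrightarrow> i < M \<Longrightarrow> \<omega> \<in> space P \<Longrightarrow>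
        dir T k i \<omega> = (\<chi> s. (lam T k i \<omega> $ s) powr (- 1 / 2) * mom T k i \<omega> $ s)"
    and x_step: "\<And>k i \<omega>. k \<in> {1..N} \<Longrightarrow> i < M \<Longrightarrow> \<omega> \<in> space P \<Longrightarrow>
        xpt T k i \<omega> = mix (W ^\<^sub>m t) (\<lambda>j. xpt T (k - 1) j \<omega> - \<eta> *\<^sub>R dir T k j \<omega>) i"

text \<open>\<open>O\<close> up to polylogarithmic factors.\<close>

definition soft_bigo :: "'x filter \<Rightarrow> ('x \<Rightarrow> real) \<Rightarrow> ('x \<Rightarrow> real) set" where
  "soft_bigo Fl g = {h. \<exists>p::nat. h \<in> O[Fl](\<lambda>x. g x * \<bar>ln (g x)\<bar> ^ p)}"

end

theory Submission
  imports
    Defs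
    "Jordan_Normal_Form.Schur_Decomposition"
begin

text \<open>
  Averaged over the nodes the algorithm is an optimistic gradient method
  \<open>z\<^sub>k = x\<^bsub>k-1\<^esub> - \<eta> D\<^bsub>k-1\<^esub>\<close>, \<open>x\<^sub>k = x\<^bsub>k-1\<^esub> - \<eta> D\<^sub>k\<close> with \<open>D\<^sub>k = A\<^bsub>k-1\<^esub> \<nabla>F(z\<^sub>k) + n\<^sub>k + p\<^sub>k\<close>, where the diagonal
  matrix \<open>A\<^sub>k\<close> is the node average of \<open>\<Lambda>\<^sub>k\<^sup>-\<^sup>1\<^sup>/\<^sup>2\<close>, \<open>n\<^sub>k\<close> is a martingale difference of variance
  \<open>O(1 / (M m\<^sub>k))\<close>, and the perturbation \<open>p\<^sub>k\<close> is small in the sum over \<open>k\<close>: its part from replacing \<open>A\<^sub>k\<close> by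
  the predictable \<open>A\<^bsub>k-1\<^esub>\<close> telescopes because \<open>A\<^sub>k\<close> decreases, its momentum part is summable because
  \<open>\<beta>\<^bsub>1,k\<^esub>\<close> decays geometrically, and its consensus part is \<open>O(\<rho>\<^sup>t)\<close> by the spectral gap of \<open>W\<close>.
  The distance \<open>\<parallel>x\<^sub>k - x\<^sub>*\<parallel>\<^sup>2\<close> in the norm weighted by \<open>A\<^sub>k\<^sup>-\<^sup>1\<close> is a Lyapunov function: the Minty
  condition removes the inner product, and the step-size bound lets \<open>- \<parallel>D\<^bsub>k-1\<^esub>\<parallel>\<^sup>2\<close> absorb
  \<open>\<parallel>D\<^sub>k - D\<^bsub>k-1\<^esub>\<parallel>\<^sup>2\<close>.  Hence \<open>\<Sum>\<^sub>k E\<parallel>\<nabla>F(z\<^sub>k)\<parallel>\<^sup>2 \<le> K\<^sub>1 + K\<^sub>2 \<Sum>\<^sub>k 1 / (M m\<^sub>k) + K\<^sub>3 N / C\<close>.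
\<close>

section \<open>Spectral contraction of the mixing matrix\<close>

text \<open>The scaling of step k contains the fresh samples of step k, so noise scaled by it need
  not have mean zero; freezing the scaling at step k - 1 restores this and dictates the
  decomposition. Weighting distances by the inverse of the same frozen average cancels the scaling
  in front of the gradient, so that the unweighted Minty inequality applies. The price is a weight
  that varies with k; as it only grows, stays below \<open>G_inf\<close> and acts on bounded
  distances, all its changes together cost a constant. The analysis of a path is deterministic and
  keeps the noise cross term with its sign; probability enters only when the final inequality is
  integrated. Only the sum of the norms of the perturbations is controlled, so their squares are
  reduced to first powers by a uniform bound. The resulting constants depend on the numerical
  parameters and the dimension alone, not on M, N, W or the sample space, which allows the
  thresholds in \<epsilon> to be fixed before the instance. Each of the three terms of the bound
  then receives one third of N \<epsilon>^2, and some iterate is no worse than the average.\<close>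

text \<open>The Hermitian form \<open>S\<close> of an eigenvector equals its own conjugate because
  the matrix is real and symmetric, and it also equals the eigenvalue times the positive number
  \<open>q\<close>.\<close>

lemma symmetric_eigenvalue_real:
  fixes A :: "real mat"
  assumes A: "A \<in> carrier_mat n n" and sym: "transpose_mat A = A"
    and ev: "eigenvalue (map_mat complex_of_real A) a"
  shows "a \<in> \<real>"
proof -
  let ?C = "map_mat complex_of_real A"
  obtain v where v: "v \<in> carrier_vec n" "v \<noteq> 0\<^sub>v n" "?C *\<^sub>v v = a \<cdot>\<^sub>v v"
    using ev A unfolding eigenvalue_def eigenvector_def by auto
  define x where "x = vec_index v"
  have comp: "(\<Sum>j<n. of_real (A $$ (i,j)) * x j) = a * x i" if "i < n" for i
  proof -
    have "vec_index (?C *\<^sub>v v) i = (\<Sum>j<n. of_real (A $$ (i,j)) * x j)"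
      using that A v(1) by (simp add: scalar_prod_def x_def atLeast0LessThan)
    then show ?thesis using v that by (simp add: x_def)
  qed
  have symA: "A $$ (i,j) = A $$ (j,i)" if "i < n" "j < n" for i j
    using sym that A by (metis carrier_matD index_transpose_mat(1))
  define S where "S = (\<Sum>i<n. \<Sum>j<n. cnj (x i) * of_real (A $$ (i,j)) * x j)"
  have "cnj S = (\<Sum>i<n. \<Sum>j<n. x i * of_real (A $$ (i,j)) * cnj (x j))"
    by (simp add: S_def)
  also have "\<dots> = (\<Sum>j<n. \<Sum>i<n. x i * of_real (A $$ (i,j)) * cnj (x j))"
    by (rule sum.swap)
  also have "\<dots> = S" unfolding S_def
    by (intro sum.cong refl) (simp add: symA mult_ac)
  finally have SR: "S \<in> \<real>" by (simp add: Reals_cnj_iff)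
  define q where "q = (\<Sum>i<n. (cmod (x i))\<^sup>2)"
  have "S = (\<Sum>i<n. cnj (x i) * (\<Sum>j<n. of_real (A $$ (i,j)) * x j))"
    by (simp add: S_def sum_distrib_left mult_ac)
  also have "\<dots> = (\<Sum>i<n. a * (x i * cnj (x i)))"
  proof (intro sum.cong refl)
    fix i assume "i \<in> {..<n}"
    then have "(\<Sum>j<n. of_real (A $$ (i,j)) * x j) = a * x i" by (simp add: comp)
    then show "cnj (x i) * (\<Sum>j<n. of_real (A $$ (i,j)) * x j) = a * (x i * cnj (x i))"
      by (simp only: mult_ac)
  qed
  also have "\<dots> = a * of_real q"
    unfolding sum_distrib_left[symmetric] q_def of_real_sum
    by (simp add: complex_norm_square del: of_real_power)
  finally have S: "S = a * of_real q" .
  have "\<exists>i<n. x i \<noteq> 0"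
  proof (rule ccontr)
    assume "\<not> ?thesis"
    then have "v = 0\<^sub>v n" using v(1) by (intro eq_vecI) (auto simp: x_def)
    then show False using v(2) by simp
  qed
  then obtain i where "i < n" "x i \<noteq> 0" by auto
  then have "q > 0" unfolding q_def
    by (intro sum_pos2[of _ i]) auto
  then have "a = S / of_real q" using S by simp
  then show ?thesis using SR by simp
qed

text \<open>The complex characteristic polynomial splits. All its roots are real, so the product of
  the real linear factors has the same image under the injective embedding of coefficients.\<close>

lemma symmetric_char_poly_splits:
  fixes A :: "real mat"
  assumes A: "A \<in> carrier_mat n n" and sym: "transpose_mat A = A"
  obtains es where "char_poly A = (\<Prod>e\<leftarrow>es. [:- e, 1:])" "length es = n"
proof -
  let ?C = "map_mat complex_of_real A"
  have C: "?C \<in> carrier_mat n n" using A by simp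
  obtain as where as: "char_poly ?C = (\<Prod>a\<leftarrow>as. [:- a, 1:])" "length as = n"
    using char_poly_factorized[OF C] by blast
  have re: "a \<in> \<real>" if "a \<in> set as" for a
  proof (rule symmetric_eigenvalue_real[OF A sym])
    show "eigenvalue ?C a"
      unfolding eigenvalue_root_char_poly[OF C] as(1)
      using that by (induct as) auto
  qed
  interpret map_poly_hom: map_poly_inj_comm_ring_hom complex_of_real ..
  have "map_poly complex_of_real (\<Prod>e\<leftarrow>map Re as. [:- e, 1:]) = (\<Prod>a\<leftarrow>as. [:- a, 1:])"
    using re
  proof (induct as)
    case (Cons a as)
    then have "complex_of_real (Re a) = a" by simp
    then show ?case using Cons
      by (simp add: map_poly_hom.hom_mult del: mult_pCons_left)
  qed simp
  then have "map_poly complex_of_real (char_poly A) = map_poly complex_of_real (\<Prod>e\<leftarrow>map Re as. [:- e, 1:])"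
    using as of_real_hom.char_poly_hom[OF A, where ?'a = complex] by simp
  then have "char_poly A = (\<Prod>e\<leftarrow>map Re as. [:- e, 1:])"
    by (simp add: map_poly_hom.eq_iff)
  then show thesis using that[of "map Re as"] as(2) by simp
qed

lemma proots_prod_linear: "proots (\<Prod>e\<leftarrow>es. [:- e, 1:]) = mset (es :: real list)"
proof (induct es)
  case (Cons e es)
  have "(\<Prod>e\<leftarrow>es. [:- e, 1:]) \<noteq> 0" by (auto simp: prod_list_zero_iff)
  then show ?case using Cons proots_linear_factor[of "-e"]
    by (simp add: proots_mult del: mult_pCons_left)
qed simp

text \<open>Back substitution from the last row upwards: once all later entries vanish, row i reads
  w_i = B_ii w_i. Hence the fixed vectors of \<open>B\<close> form at most a line, which is how a
  simple diagonal entry 1 limits the eigenspace.\<close>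

lemma upper_triangular_simple_fixed_vector:
  fixes B :: "real mat"
  assumes B: "B \<in> carrier_mat n n" "upper_triangular B"
    and diag: "\<And>i. 1 \<le> i \<Longrightarrow> i < n \<Longrightarrow> B $$ (i,i) \<noteq> 1"
    and w: "w \<in> carrier_vec n" "B *\<^sub>v w = w" and i: "1 \<le> i" "i < n"
  shows "vec_index w i = 0"
  using i
proof (induct "n - i" arbitrary: i rule: less_induct)
  case less
  have "vec_index w i = (\<Sum>j<n. B $$ (i,j) * vec_index w j)"
  proof -
    have "vec_index (B *\<^sub>v w) i = (\<Sum>j<n. B $$ (i,j) * vec_index w j)"
      using less B w(1) by (simp add: scalar_prod_def atLeast0LessThan)
    then show ?thesis using w(2) by simp
  qed
  also have "\<dots> = (\<Sum>j<n. if j = i then B $$ (i,i) * vec_index w i else 0)"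
  proof (intro sum.cong refl)
    fix j assume j: "j \<in> {..<n}"
    show "B $$ (i,j) * vec_index w j = (if j = i then B $$ (i,i) * vec_index w i else 0)"
    proof (cases j i rule: linorder_cases)
      case less
      then show ?thesis using upper_triangularD[OF B(2), of j i] \<open>i < n\<close> B(1) by simp
    next
      case greater
      then show ?thesis using less.hyps[of j] less.prems j by auto
    qed simp
  qed
  also have "\<dots> = B $$ (i,i) * vec_index w i" using less by simp
  finally show ?case using diag[OF less.prems] by simp
qed

section \<open>The action of a matrix on functions of the nodes\<close>

text \<open>One coordinate of \<open>mix\<close>. Vectors are functions on all naturals of which
  only the values below the dimension count, so vectors need no carrier conditions.\<close>

definition apply_mat :: "real mat \<Rightarrow> (nat \<Rightarrow> real) \<Rightarrow> nat \<Rightarrow> real" where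
  "apply_mat A y i = (\<Sum>j<dim_row A. A $$ (j, i) * y j)"

lemma symmetric_entries:
  assumes "A \<in> carrier_mat n n" "transpose_mat A = A" "i < n" "j < n"
  shows "A $$ (i, j) = A $$ (j, i)"
  using assms by (metis carrier_matD index_transpose_mat(1))

lemma apply_mat_self_adjoint:
  assumes "A \<in> carrier_mat n n" "transpose_mat A = A"
  shows "(\<Sum>i<n. apply_mat A x i * y i) = (\<Sum>i<n. x i * apply_mat A y i)"
proof -
  have "(\<Sum>i<n. apply_mat A x i * y i) = (\<Sum>i<n. \<Sum>j<n. A $$ (j,i) * x j * y i)"
    using assms by (simp add: apply_mat_def sum_distrib_right)
  also have "\<dots> = (\<Sum>j<n. \<Sum>i<n. A $$ (j,i) * x j * y i)" by (rule sum.swap)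
  also have "\<dots> = (\<Sum>j<n. x j * apply_mat A y j)"
    unfolding apply_mat_def sum_distrib_left using assms
    by (intro sum.cong) (auto simp: symmetric_entries[of A n] mult_ac)
  finally show ?thesis .
qed

lemma apply_mat_add: "apply_mat A (\<lambda>i. x i + y i) k = apply_mat A x k + apply_mat A y k"
  by (simp add: apply_mat_def distrib_left sum.distrib)

lemma apply_mat_diff: "apply_mat A (\<lambda>i. x i - y i) k = apply_mat A x k - apply_mat A y k"
  by (simp add: apply_mat_def right_diff_distrib sum_subtractf)

lemma apply_mat_scale: "apply_mat A (\<lambda>i. c * x i) k = c * apply_mat A x k"
  by (simp add: apply_mat_def sum_distrib_left mult_ac)

lemma apply_mat_cong:
  "A \<in> carrier_mat n n \<Longrightarrow> (\<And>i. i < n \<Longrightarrow> x i = y i) \<Longrightarrow> apply_mat A x = apply_mat A y"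
  by (auto simp: apply_mat_def fun_eq_iff intro!: sum.cong)

lemma sum_apply_mat:
  assumes "A \<in> carrier_mat n n" "\<And>i. i < n \<Longrightarrow> (\<Sum>j<n. A $$ (i,j)) = 1"
  shows "(\<Sum>i<n. apply_mat A y i) = (\<Sum>i<n. y i)"
proof -
  have "(\<Sum>i<n. apply_mat A y i) = (\<Sum>j<n. \<Sum>i<n. A $$ (j,i) * y j)"
    using assms(1) by (simp add: apply_mat_def) (rule sum.swap)
  also have "\<dots> = (\<Sum>j<n. y j)"
    using assms(2) by (simp add: sum_distrib_right[symmetric])
  finally show ?thesis .
qed

text \<open>The maximiser of \<open>\<parallel>A y\<parallel>\<close> on the unit sphere of \<open>\<one>\<^sup>\<bottom>\<close> is an eigenvector of \<open>A\<^sup>2\<close>;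
  factoring \<open>A\<^sup>2 - s\<^sup>2 = (A - s) (A + s)\<close> gives one of \<open>A\<close>.\<close>

lemma symmetric_max_eigenvector:
  fixes A :: "real mat" and y0 :: "nat \<Rightarrow> real"
  assumes A: "A \<in> carrier_mat n n" and sym: "transpose_mat A = A"
    and stoch: "\<And>i. i < n \<Longrightarrow> (\<Sum>j<n. A $$ (i,j)) = 1"
    and y0: "(\<Sum>i<n. y0 i) = 0" "\<exists>i<n. y0 i \<noteq> 0"
  obtains u \<theta> where "(\<Sum>i<n. u i) = 0" "\<exists>i<n. u i \<noteq> 0"
    "\<And>i. i < n \<Longrightarrow> apply_mat A u i = \<theta> * u i"
    "\<And>y. (\<Sum>i<n. y i) = 0 \<Longrightarrow> (\<Sum>i<n. (apply_mat A y i)\<^sup>2) \<le> \<theta>\<^sup>2 * (\<Sum>i<n. (y i)\<^sup>2)"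
proof -
  define nn :: "(nat \<Rightarrow> real) \<Rightarrow> real" where "nn y = (\<Sum>i<n. (y i)\<^sup>2)" for y
  define Q where "Q y = (\<Sum>i<n. (apply_mat A y i)\<^sup>2)" for y
  define S :: "nat \<Rightarrow> real set" where "S i = (if i < n then {-1..1} else {0})" for i
  define K where "K = Pi\<^sub>E UNIV S \<inter> {y. nn y = 1 \<and> (\<Sum>i<n. y i) = 0}"
  have cont: "continuous_on UNIV nn" "continuous_on UNIV (\<lambda>y. \<Sum>i<n. y i :: real)" "continuous_on UNIV Q"
    unfolding nn_def Q_def apply_mat_def
    by (intro continuous_intros continuous_on_product_coordinates)+
  have "compactin (product_topology (\<lambda>i. euclidean) UNIV) (Pi\<^sub>E UNIV S)"
    by (simp add: compactin_PiE S_def)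
  then have "compact (Pi\<^sub>E UNIV S)" by (simp add: euclidean_product_topology)
  moreover have "closed {y. nn y = 1 \<and> (\<Sum>i<n. y i) = 0}"
    by (intro closed_Collect_conj closed_Collect_eq cont continuous_on_const)
  ultimately have compact: "compact K" unfolding K_def by (rule compact_Int_closed)
  have scale_nn: "nn (\<lambda>i. c * y i) = c\<^sup>2 * nn y" for c y
    by (simp add: nn_def power_mult_distrib sum_distrib_left)
  have scale_Q: "Q (\<lambda>i. c * y i) = c\<^sup>2 * Q y" for c y
    by (simp add: Q_def apply_mat_scale power_mult_distrib sum_distrib_left)
  have nn_pos: "nn y > 0" if ne: "\<exists>i<n. y i \<noteq> 0" for y
  proof -
    from ne obtain i where "i < n" "y i \<noteq> 0" by blast
    then show ?thesis unfolding nn_def by (intro sum_pos2[of _ i]) auto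
  qed
  have normalise: "\<exists>z\<in>K. Q y = nn y * Q z" if "(\<Sum>i<n. y i) = 0" "\<exists>i<n. y i \<noteq> 0" for y
  proof -
    define c where "c = 1 / sqrt (nn y)"
    define z where "z i = (if i < n then c * y i else 0)" for i
    have c2: "c\<^sup>2 * nn y = 1" using nn_pos[OF that(2)] by (simp add: c_def power_divide)
    have "nn z = nn (\<lambda>i. c * y i)" by (simp add: nn_def z_def)
    then have nz: "nn z = 1" using c2 by (simp add: scale_nn)
    have le: "\<bar>z i\<bar> \<le> 1" if "i < n" for i
    proof -
      have "(z i)\<^sup>2 \<le> nn z" unfolding nn_def using that by (intro member_le_sum) auto
      then show ?thesis using nz by (simp add: abs_square_le_1)
    qed
    have "(\<Sum>i<n. z i) = c * (\<Sum>i<n. y i)" by (simp add: z_def sum_distrib_left)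
    then have "(\<Sum>i<n. z i) = 0" using that by simp
    moreover have "z \<in> Pi\<^sub>E UNIV S"
    proof (rule PiE_I)
      fix i show "z i \<in> S i"
        using le[of i] by (cases "i < n") (simp_all add: S_def z_def abs_le_iff)
    qed simp
    ultimately have "z \<in> K" using nz by (simp add: K_def)
    have "Q z = c\<^sup>2 * Q y"
    proof -
      have "apply_mat A z = apply_mat A (\<lambda>i. c * y i)"
        by (rule apply_mat_cong[OF A]) (simp add: z_def)
      then show ?thesis using scale_Q[of c y] by (simp add: Q_def)
    qed
    moreover have "nn y * (c\<^sup>2 * Q y) = (c\<^sup>2 * nn y) * Q y" by simp
    ultimately have "Q y = nn y * Q z" using c2 by simp
    with \<open>z \<in> K\<close> show ?thesis by blast
  qed
  have "K \<noteq> {}" using normalise[OF y0] by auto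
  then have "\<exists>u\<in>K. \<forall>z\<in>K. Q z \<le> Q u"
    using continuous_on_subset[OF cont(3) subset_UNIV] by (rule continuous_attains_sup[OF compact])
  then obtain u0 where u0: "u0 \<in> K" "\<And>z. z \<in> K \<Longrightarrow> Q z \<le> Q u0"
    by blast
  define \<mu> where "\<mu> = Q u0"
  have \<mu>0: "\<mu> \<ge> 0" by (simp add: \<mu>_def Q_def sum_nonneg)
  have nu0: "nn u0 = 1" and su0: "(\<Sum>i<n. u0 i) = 0" using u0 by (auto simp: K_def)
  have max: "Q y \<le> \<mu> * nn y" if s: "(\<Sum>i<n. y i) = 0" for y
  proof (cases "\<exists>i<n. y i \<noteq> 0")
    case True
    then obtain z where z: "z \<in> K" "Q y = nn y * Q z" using normalise s by blast
    then show ?thesis using u0(2)[OF z(1)] nn_pos[OF True] by (simp add: \<mu>_def mult.commute)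
  next
    case False
    then show ?thesis by (simp add: Q_def nn_def apply_mat_def carrier_matD[OF A])
  qed
  \<comment> \<open>Half the gradient of \<open>Q y - \<mu> * nn y\<close> at \<open>u0\<close>. It
    has zero sum again, so maximality may be tested in the direction \<open>h\<close>.\<close>
  define h where "h i = apply_mat A (apply_mat A u0) i - \<mu> * u0 i" for i
  have sum_ap: "(\<Sum>i<n. apply_mat A y i) = (\<Sum>i<n. y i)" for y
    by (rule sum_apply_mat[OF A stoch])
  have sh: "(\<Sum>i<n. h i) = 0"
    by (simp add: h_def sum_subtractf sum_ap su0 sum_distrib_left[symmetric])
  \<comment> \<open>Maximality at the point u0 + e h: the constant terms cancel, and
    self-adjointness turns the linear ones into 2 e \<open>nn h\<close>.\<close>
  have key: "2 * e * nn h \<le> e\<^sup>2 * (\<mu> * nn h - Q h)" for e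
  proof -
    define y where "y i = u0 i + e * h i" for i
    define a b where "a = (\<Sum>i<n. u0 i * h i)" and "b = (\<Sum>i<n. apply_mat A u0 i * apply_mat A h i)"
    have "(\<Sum>i<n. y i) = 0" by (simp add: y_def sum.distrib su0 sh sum_distrib_left[symmetric])
    then have le: "Q y \<le> \<mu> * nn y" by (rule max)
    have ny: "nn y = 1 + 2 * e * a + e\<^sup>2 * nn h"
    proof -
      have "(y i)\<^sup>2 = (u0 i)\<^sup>2 + 2 * e * (u0 i * h i) + e\<^sup>2 * (h i)\<^sup>2" for i
        by (simp add: y_def power2_eq_square algebra_simps)
      then show ?thesis unfolding nu0[symmetric]
        by (simp add: nn_def a_def sum.distrib sum_distrib_left[symmetric])
    qed
    have Qy: "Q y = \<mu> + 2 * e * b + e\<^sup>2 * Q h"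
    proof -
      have "apply_mat A y i = apply_mat A u0 i + e * apply_mat A h i" for i
        unfolding y_def by (simp add: apply_mat_add apply_mat_scale)
      then have "(apply_mat A y i)\<^sup>2 = (apply_mat A u0 i)\<^sup>2
          + 2 * e * (apply_mat A u0 i * apply_mat A h i) + e\<^sup>2 * (apply_mat A h i)\<^sup>2" for i
        by (simp add: power2_eq_square algebra_simps)
      then show ?thesis
        by (simp add: Q_def \<mu>_def b_def sum.distrib sum_distrib_left[symmetric])
    qed
    have "b = (\<Sum>i<n. apply_mat A (apply_mat A u0) i * h i)"
      unfolding b_def by (rule apply_mat_self_adjoint[OF A sym, symmetric])
    then have "b - \<mu> * a = (\<Sum>i<n. apply_mat A (apply_mat A u0) i * h i - \<mu> * (u0 i * h i))"
      by (simp add: a_def sum_distrib_left sum_subtractf)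
    also have "\<dots> = nn h"
      unfolding nn_def h_def by (intro sum.cong refl) (simp add: power2_eq_square algebra_simps)
    finally have "2 * e * nn h = 2 * e * b - \<mu> * (2 * e * a)" by (metis (no_types, opaque_lifting) mult.assoc mult.left_commute right_diff_distrib)
    then show ?thesis using le unfolding ny Qy by (simp add: distrib_left right_diff_distrib mult.left_commute)
  qed
  have nnh: "nn h = 0"
  proof (rule ccontr)
    assume "nn h \<noteq> 0"
    moreover have "nn h \<ge> 0" by (simp add: nn_def sum_nonneg)
    ultimately have pos: "nn h > 0" by simp
    define c where "c = \<mu> * nn h - Q h"
    have c0: "c \<ge> 0" using max[OF sh] by (simp add: c_def)
    \<comment> \<open>So small that the quadratic term cannot make up for the linear one: e c stays
      below \<open>nn h\<close>.\<close>
    define e where "e = nn h / (c + 1)"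
    have e: "e > 0" using pos c0 by (simp add: e_def)
    have "2 * nn h \<le> e * c" using key[of e] e unfolding c_def[symmetric] by (simp add: power2_eq_square)
    also have "\<dots> \<le> nn h" using pos c0 by (simp add: e_def field_simps)
    finally show False using pos by simp
  qed
  have AA: "apply_mat A (apply_mat A u0) i = \<mu> * u0 i" if "i < n" for i
  proof -
    have "(h i)\<^sup>2 \<le> nn h" unfolding nn_def using that by (intro member_le_sum) auto
    then show ?thesis using nnh by (simp add: h_def)
  qed
  define s where "s = sqrt \<mu>"
  have s2: "s * s = \<mu>" using \<mu>0 by (simp add: s_def)
  \<comment> \<open>Since (A - s) w = A^2 u0 - s^2 u0 = 0, either \<open>w\<close> is an eigenvector
    for s, or \<open>w\<close> = 0 and \<open>u0\<close> is one for -s; both have square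
    \<mu>.\<close>
  define w where "w i = apply_mat A u0 i + s * u0 i" for i
  have max': "(\<Sum>i<n. (apply_mat A y i)\<^sup>2) \<le> \<theta>\<^sup>2 * (\<Sum>i<n. (y i)\<^sup>2)"
    if "(\<Sum>i<n. y i) = 0" "\<theta>\<^sup>2 = \<mu>" for y \<theta>
    using max[OF that(1)] that(2) by (simp add: Q_def nn_def)
  show thesis
  proof (cases "\<exists>i<n. w i \<noteq> 0")
    case True
    show thesis
    proof (rule that[of w s])
      show "(\<Sum>i<n. w i) = 0"
        by (simp add: w_def sum.distrib sum_ap su0 sum_distrib_left[symmetric])
      show "apply_mat A w i = s * w i" if "i < n" for i
      proof -
        have "apply_mat A w i = apply_mat A (apply_mat A u0) i + s * apply_mat A u0 i"
          unfolding w_def by (simp add: apply_mat_add apply_mat_scale)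
        then show ?thesis using AA[OF that] s2 by (simp add: w_def algebra_simps)
      qed
    qed (use True max' s2 in \<open>auto simp: power2_eq_square\<close>)
  next
    case False
    show thesis
    proof (rule that[of u0 "- s"])
      show "\<exists>i<n. u0 i \<noteq> 0" using nu0 by (auto simp: nn_def intro: ccontr)
      show "apply_mat A u0 i = - s * u0 i" if "i < n" for i
        using False that by (auto simp: w_def add_eq_0_iff)
    qed (use su0 max' s2 in \<open>auto simp: power2_eq_square\<close>)
  qed
qed

section \<open>Sorted eigenvalues and the spectral gap\<close>

definition spectrum_list :: "real mat \<Rightarrow> real list" where
  "spectrum_list W = rev (sorted_list_of_multiset (proots (char_poly W)))"

text \<open>As no root is lost over the reals, the list has full length n; lookups at positions
  below n therefore return genuine eigenvalues.\<close>

lemma symmetric_spectrum_list: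
  fixes W :: "real mat"
  assumes "W \<in> carrier_mat n n" "transpose_mat W = W"
  shows "char_poly W = (\<Prod>e\<leftarrow>spectrum_list W. [:- e, 1:])" "length (spectrum_list W) = n"
proof -
  obtain es where es: "char_poly W = (\<Prod>e\<leftarrow>es. [:- e, 1:])" "length es = n"
    using symmetric_char_poly_splits[OF assms] by blast
  have ms: "mset (spectrum_list W) = mset es"
    by (simp add: spectrum_list_def es(1) proots_prod_linear)
  then show "length (spectrum_list W) = n" using es(2) mset_eq_length by metis
  have "mset (map (\<lambda>e. [:- e, 1:]) (spectrum_list W)) = mset (map (\<lambda>e. [:- e, 1:]) es)"
    using ms by simp
  then show "char_poly W = (\<Prod>e\<leftarrow>spectrum_list W. [:- e, 1:])"
    unfolding es(1) by (metis prod_mset_prod_list)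
qed

lemma spectrum_list_antimono:
  assumes "i \<le> j" "j < length (spectrum_list W)"
  shows "spectrum_list W ! j \<le> spectrum_list W ! i"
proof -
  have "sorted_wrt (\<ge>) (spectrum_list W)"
    by (simp add: spectrum_list_def sorted_wrt_rev)
  then show ?thesis using assms sorted_wrt_nth_less[of "(\<ge>)" "spectrum_list W" i j]
    by (cases "i = j") auto
qed

lemma eigenvalue_in_spectrum_list:
  fixes W :: "real mat"
  assumes W: "W \<in> carrier_mat n n" "transpose_mat W = W"
    and u: "\<exists>i<n. u i \<noteq> 0" "\<And>i. i < n \<Longrightarrow> apply_mat W u i = \<theta> * u i"
  shows "\<theta> \<in> set (spectrum_list W)"
    and "W *\<^sub>v Matrix.vec n u = \<theta> \<cdot>\<^sub>v Matrix.vec n u"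
proof -
  show eq: "W *\<^sub>v Matrix.vec n u = \<theta> \<cdot>\<^sub>v Matrix.vec n u"
  proof (rule eq_vecI)
    fix i assume "i < dim_vec (\<theta> \<cdot>\<^sub>v Matrix.vec n u)"
    then have i: "i < n" by simp
    have "vec_index (W *\<^sub>v Matrix.vec n u) i = (\<Sum>j<n. W $$ (i,j) * u j)"
      using W i by (simp add: scalar_prod_def atLeast0LessThan)
    also have "\<dots> = apply_mat W u i"
      unfolding apply_mat_def using W i
      by (intro sum.cong) (auto simp: symmetric_entries[OF W])
    finally show "vec_index (W *\<^sub>v Matrix.vec n u) i = vec_index (\<theta> \<cdot>\<^sub>v Matrix.vec n u) i"
      using u(2)[OF i] i by simp
  qed (use W in auto)
  have "Matrix.vec n u \<noteq> 0\<^sub>v n"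
  proof
    assume z: "Matrix.vec n u = 0\<^sub>v n"
    obtain i where "i < n" "u i \<noteq> 0" using u(1) by auto
    then show False using arg_cong[OF z, of "\<lambda>v. vec_index v i"] by simp
  qed
  then have "eigenvector W (Matrix.vec n u) \<theta>" using eq W(1) by (simp add: eigenvector_def)
  then have "eigenvalue W \<theta>" unfolding eigenvalue_def by blast
  then have "poly (char_poly W) \<theta> = 0" using eigenvalue_root_char_poly[OF W(1)] by simp
  then show "\<theta> \<in> set (spectrum_list W)"
    unfolding symmetric_spectrum_list(1)[OF W] poly_prod_list
    by (auto simp: prod_list_zero_iff)
qed

text \<open>On zero-sum vectors the best contraction factor is |\<theta>| for an eigenvalue \<theta>
  with a zero-sum eigenvector. What must be excluded is that \<theta> is the top entry 1 of the
  sorted list. The rate condition lets 1 occur there only once, and a Schur form shows that then the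
  constants are the only fixed vectors. All other entries lie between the second and the last
  one.\<close>

lemma mixing_contraction:
  fixes W :: "real mat"
  assumes W: "W \<in> carrier_mat n n" "transpose_mat W = W"
    and ds: "doubly_stochastic W" and rate: "mixing_rate W < 1" and y: "(\<Sum>i<n. y i) = 0"
  shows "(\<Sum>i<n. (apply_mat W y i)\<^sup>2) \<le> (mixing_rate W)\<^sup>2 * (\<Sum>i<n. (y i)\<^sup>2)"
proof (cases "\<exists>i<n. y i \<noteq> 0")
  case False
  then show ?thesis using W by (simp add: apply_mat_def)
next
  case True
  then have n: "n > 0" by auto
  have rows: "(\<Sum>j<n. W $$ (i,j)) = 1" if "i < n" for i
    using ds that W by (simp add: doubly_stochastic_def)
  have cols: "(\<Sum>j<n. W $$ (j,i)) = 1" if "i < n" for i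
    using ds that W by (simp add: doubly_stochastic_def)
  let ?es = "spectrum_list W"
  note len = symmetric_spectrum_list(2)[OF W]
  have nth: "nth_eigenvalue W j = ?es ! (j - 1)" for j
    by (simp add: nth_eigenvalue_def spectrum_list_def)
  have one: "apply_mat W (\<lambda>_. 1) i = 1 * 1" if "i < n" for i
    using cols[OF that] W by (simp add: apply_mat_def)
  have one_in: "1 \<in> set ?es" and one_vec: "W *\<^sub>v Matrix.vec n (\<lambda>_. 1) = 1 \<cdot>\<^sub>v Matrix.vec n (\<lambda>_. 1)"
    using eigenvalue_in_spectrum_list[OF W _ one] n by auto
  have second: "?es ! 1 < 1" and "\<bar>?es ! (n - 1)\<bar> < 1"
    using rate W unfolding mixing_rate_def nth by auto
  obtain j where j: "j < n" "?es ! j = 1" using one_in len by (auto simp: in_set_conv_nth)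
  have less1: "?es ! i < 1" if "1 \<le> i" "i < n" for i
    using spectrum_list_antimono[of 1 i W] that len second by simp
  have "j = 0" using less1[of j] j by (cases "j = 0") auto
  then have es0: "?es ! 0 = 1" using j by simp
  have bound: "\<bar>?es ! i\<bar> \<le> mixing_rate W" if "1 \<le> i" "i < n" for i
  proof -
    have "?es ! i \<le> ?es ! 1" "?es ! (n - 1) \<le> ?es ! i"
      using spectrum_list_antimono[of 1 i W] spectrum_list_antimono[of i "n - 1" W] that len by simp_all
    moreover have "mixing_rate W = max \<bar>?es ! 1\<bar> \<bar>?es ! (n - 1)\<bar>"
      using W by (simp add: mixing_rate_def nth)
    ultimately show ?thesis by linarith
  qed
  obtain u \<theta> where u: "(\<Sum>i<n. u i) = 0" "\<exists>i<n. u i \<noteq> 0"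
    "\<And>i. i < n \<Longrightarrow> apply_mat W u i = \<theta> * u i"
    "\<And>y. (\<Sum>i<n. y i) = 0 \<Longrightarrow> (\<Sum>i<n. (apply_mat W y i)\<^sup>2) \<le> \<theta>\<^sup>2 * (\<Sum>i<n. (y i)\<^sup>2)"
    using symmetric_max_eigenvector[OF W rows y True] by blast
  have \<theta>: "\<theta> \<in> set ?es" and u_vec: "W *\<^sub>v Matrix.vec n u = \<theta> \<cdot>\<^sub>v Matrix.vec n u"
    using eigenvalue_in_spectrum_list[OF W u(2,3)] by auto
  have "\<theta> \<noteq> 1"
  proof
    assume "\<theta> = 1"
    \<comment> \<open>The Schur form carries the sorted list on its diagonal in this order, so that
      its first diagonal entry alone is 1.\<close>
    obtain B P Q where sd: "schur_decomposition W ?es = (B, P, Q)" by (cases "schur_decomposition W ?es") auto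
    from schur_decomposition[OF W(1) symmetric_spectrum_list(1)[OF W] sd]
    have sim: "similar_mat_wit W B P Q" and ut: "upper_triangular B" and dg: "diag_mat B = ?es" by auto
    have carr: "B \<in> carrier_mat n n" "P \<in> carrier_mat n n" "Q \<in> carrier_mat n n"
      and PQ: "P * Q = 1\<^sub>m n" "Q * P = 1\<^sub>m n" and WB: "W = P * B * Q"
      using similar_mat_witD2[OF W(1) sim] by auto
    have diag: "B $$ (i,i) \<noteq> 1" if "1 \<le> i" "i < n" for i
    proof -
      have "?es ! i = B $$ (i,i)" using dg[symmetric] that carr(1) by (simp add: diag_mat_def)
      then show ?thesis using less1[OF that] by simp
    qed
    have fixed: "vec_index (Q *\<^sub>v v) i = 0"
      if v: "v \<in> carrier_vec n" "W *\<^sub>v v = v" and i: "1 \<le> i" "i < n" for v i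
    proof (rule upper_triangular_simple_fixed_vector[OF carr(1) ut diag _ _ i])
      show "Q *\<^sub>v v \<in> carrier_vec n" using carr v by simp
      have "Q *\<^sub>v v = Q *\<^sub>v (P * B * Q *\<^sub>v v)" using v(2) WB by simp
      also have "\<dots> = (Q * (P * B * Q)) *\<^sub>v v" using carr v(1) by (intro assoc_mult_mat_vec[symmetric]) auto
      also have "Q * (P * B * Q) = Q * P * (B * Q)"
        using carr by (simp add: assoc_mult_mat[of _ n n _ n _ n])
      also have "\<dots> = B * Q" using PQ carr by simp
      also have "(B * Q) *\<^sub>v v = B *\<^sub>v (Q *\<^sub>v v)" using carr v(1) by (intro assoc_mult_mat_vec) auto
      finally show "B *\<^sub>v (Q *\<^sub>v v) = Q *\<^sub>v v" by simp
    qed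
    let ?u = "Matrix.vec n u" and ?o = "Matrix.vec n (\<lambda>_. 1::real)"
    \<comment> \<open>In Schur coordinates both fixed vectors vanish outside coordinate 0 and hence
      are proportional: b u = a 1. Summing over the nodes gives a = 0, then b = 0, and the constant
      vector would have to vanish.\<close>
    define a b where "a = vec_index (Q *\<^sub>v ?u) 0" and "b = vec_index (Q *\<^sub>v ?o) 0"
    have proportional: "b \<cdot>\<^sub>v (Q *\<^sub>v ?u) = a \<cdot>\<^sub>v (Q *\<^sub>v ?o)"
    proof (rule eq_vecI)
      fix i assume "i < dim_vec (a \<cdot>\<^sub>v (Q *\<^sub>v ?o))"
      then have i: "i < n" using carr by simp
      show "vec_index (b \<cdot>\<^sub>v (Q *\<^sub>v ?u)) i = vec_index (a \<cdot>\<^sub>v (Q *\<^sub>v ?o)) i"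
      proof (cases "i = 0")
        case True
        then show ?thesis using i carr by (simp add: a_def b_def)
      next
        case False
        then have "vec_index (Q *\<^sub>v ?u) i = 0" "vec_index (Q *\<^sub>v ?o) i = 0"
          using fixed[of ?u i] fixed[of ?o i] u_vec one_vec \<open>\<theta> = 1\<close> i by auto
        then show ?thesis using i carr by (simp del: index_mult_mat_vec)
      qed
    qed (use carr in auto)
    have PQ_scale: "P *\<^sub>v (c \<cdot>\<^sub>v (Q *\<^sub>v v)) = c \<cdot>\<^sub>v v" if "v \<in> carrier_vec n" for c v
    proof -
      have "P *\<^sub>v (c \<cdot>\<^sub>v (Q *\<^sub>v v)) = c \<cdot>\<^sub>v (P *\<^sub>v (Q *\<^sub>v v))"
        using carr that by (intro mult_mat_vec) auto
      also have "P *\<^sub>v (Q *\<^sub>v v) = (P * Q) *\<^sub>v v"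
        using carr that by (intro assoc_mult_mat_vec[symmetric]) auto
      finally show ?thesis using PQ that by simp
    qed
    have ab: "b \<cdot>\<^sub>v ?u = a \<cdot>\<^sub>v ?o" using arg_cong[OF proportional, of "\<lambda>v. P *\<^sub>v v"] PQ_scale by simp
    have bu: "b * u i = a" if "i < n" for i
      using arg_cong[OF ab, of "\<lambda>v. vec_index v i"] that by simp
    have "real n * a = (\<Sum>i<n. b * u i)" using bu by simp
    also have "\<dots> = 0" using u(1) by (simp add: sum_distrib_left[symmetric])
    finally have "a = 0" using n by simp
    then have "b = 0" using bu u(2) by auto
    have "P *\<^sub>v (Q *\<^sub>v ?o) = 0\<^sub>v n"
    proof -
      have "Q *\<^sub>v ?o = 0\<^sub>v n"
      proof (rule eq_vecI)
        fix i assume "i < dim_vec (0\<^sub>v n :: real Matrix.vec)"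
        then show "vec_index (Q *\<^sub>v ?o) i = vec_index (0\<^sub>v n) i"
          using fixed[of ?o i] one_vec \<open>b = 0\<close> by (cases "i = 0") (auto simp: b_def simp del: index_mult_mat_vec)
      qed (use carr in auto)
      then show ?thesis using carr by auto
    qed
    then have "?o = 0\<^sub>v n" using PQ_scale[of ?o 1] by simp
    then have "vec_index ?o 0 = vec_index (0\<^sub>v n) 0" by simp
    then show False using n by simp
  qed
  moreover obtain i where "i < n" "?es ! i = \<theta>" using \<theta> len by (auto simp: in_set_conv_nth)
  ultimately have "\<bar>\<theta>\<bar> \<le> mixing_rate W" using bound[of i] es0 by (cases "i = 0") auto
  then have "\<theta>\<^sup>2 \<le> (mixing_rate W)\<^sup>2" by (metis abs_ge_zero power2_abs power_mono)
  then have "\<theta>\<^sup>2 * (\<Sum>i<n. (y i)\<^sup>2) \<le> (mixing_rate W)\<^sup>2 * (\<Sum>i<n. (y i)\<^sup>2)"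
    by (intro mult_right_mono sum_nonneg) auto
  then show ?thesis using u(4)[OF y] by simp
qed

section \<open>Powers of the mixing matrix\<close>

text \<open>The factors act in the order in which they are written because \<open>apply_mat\<close>
  multiplies a row vector from the right.\<close>

lemma apply_mat_mult:
  assumes "A \<in> carrier_mat n n" "B \<in> carrier_mat n n" "i < n"
  shows "apply_mat (A * B) y i = apply_mat B (apply_mat A y) i"
proof -
  have "apply_mat (A * B) y i = (\<Sum>j<n. \<Sum>l<n. A $$ (j,l) * B $$ (l,i) * y j)"
    using assms by (simp add: apply_mat_def scalar_prod_def sum_distrib_right atLeast0LessThan)
  also have "\<dots> = (\<Sum>l<n. \<Sum>j<n. A $$ (j,l) * B $$ (l,i) * y j)" by (rule sum.swap)
  finally show ?thesis using assms by (simp add: apply_mat_def sum_distrib_left mult_ac)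
qed

text \<open>Row sums preserve totals and column sums preserve constants. The first fact keeps every
  iterate in the zero-sum hyperplane, so that the one-step contraction can be repeated.\<close>

lemma mixing_power:
  fixes W :: "real mat"
  assumes W: "W \<in> carrier_mat n n" "transpose_mat W = W"
    and ds: "doubly_stochastic W" and rate: "mixing_rate W < 1"
  shows mixing_power_sum: "(\<Sum>i<n. apply_mat (W ^\<^sub>m t) y i) = (\<Sum>i<n. y i)"
    and mixing_power_const: "i < n \<Longrightarrow> apply_mat (W ^\<^sub>m t) (\<lambda>_. c) i = c"
    and mixing_power_contraction: "(\<Sum>i<n. y i) = 0 \<Longrightarrow>
      (\<Sum>i<n. (apply_mat (W ^\<^sub>m t) y i)\<^sup>2) \<le> (mixing_rate W ^ t)\<^sup>2 * (\<Sum>i<n. (y i)\<^sup>2)"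
proof -
  have rows: "(\<Sum>j<n. W $$ (i,j)) = 1" if "i < n" for i
    using ds that W by (simp add: doubly_stochastic_def)
  have cols: "(\<Sum>j<n. W $$ (j,i)) = 1" if "i < n" for i
    using ds that W by (simp add: doubly_stochastic_def)
  note Wt = pow_carrier_mat[OF W(1)]
  have id: "apply_mat (1\<^sub>m n) y i = y i" if "i < n" for y i
  proof -
    have "apply_mat (1\<^sub>m n) y i = (\<Sum>j<n. if j = i then y j else 0)"
      unfolding apply_mat_def using that by (intro sum.cong) auto
    then show ?thesis using that by simp
  qed
  have step: "apply_mat (W ^\<^sub>m Suc t) y i = apply_mat W (apply_mat (W ^\<^sub>m t) y) i" if "i < n" for t y i
    using apply_mat_mult[OF Wt W(1) that] by simp
  show sum: "(\<Sum>i<n. apply_mat (W ^\<^sub>m t) y i) = (\<Sum>i<n. y i)" for t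
    using W(1) by (induct t) (simp_all add: id step sum_apply_mat[OF W(1) rows] del: pow_mat.simps(2))
  show "apply_mat (W ^\<^sub>m t) (\<lambda>_. c) i = c" if "i < n"
    using that
  proof (induct t arbitrary: i)
    case 0
    then show ?case using W by (simp add: id)
  next
    case (Suc t)
    have "apply_mat W (apply_mat (W ^\<^sub>m t) (\<lambda>_. c)) = apply_mat W (\<lambda>_. c)"
      using Suc.hyps by (intro apply_mat_cong[OF W(1)])
    then show ?case using W cols[OF Suc.prems] unfolding step[OF Suc.prems]
      by (simp add: apply_mat_def sum_distrib_right[symmetric])
  qed
  show "(\<Sum>i<n. (apply_mat (W ^\<^sub>m t) y i)\<^sup>2) \<le> (mixing_rate W ^ t)\<^sup>2 * (\<Sum>i<n. (y i)\<^sup>2)"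
    if y: "(\<Sum>i<n. y i) = 0"
  proof (induct t)
    case 0
    then show ?case using W by (simp add: id)
  next
    case (Suc t)
    have "(\<Sum>i<n. (apply_mat (W ^\<^sub>m Suc t) y i)\<^sup>2) = (\<Sum>i<n. (apply_mat W (apply_mat (W ^\<^sub>m t) y) i)\<^sup>2)"
      using step by simp
    also have "\<dots> \<le> (mixing_rate W)\<^sup>2 * (\<Sum>i<n. (apply_mat (W ^\<^sub>m t) y i)\<^sup>2)"
      using sum y by (intro mixing_contraction[OF W ds rate]) simp
    also have "\<dots> \<le> (mixing_rate W)\<^sup>2 * ((mixing_rate W ^ t)\<^sup>2 * (\<Sum>i<n. (y i)\<^sup>2))"
      using Suc by (intro mult_left_mono) auto
    finally show ?case by (simp add: power_mult_distrib)
  qed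
qed

lemma mix_nth: "mix A Y i $ s = apply_mat A (\<lambda>j. Y j $ s) i"
  by (simp add: mix_def apply_mat_def)

definition node_avg :: "nat \<Rightarrow> (nat \<Rightarrow> 'v::real_vector) \<Rightarrow> 'v" where
  "node_avg n Y = (1 / real n) *\<^sub>R (\<Sum>i<n. Y i)"

text \<open>Constants are fixed by mixing, so subtracting the average before or after it is the
  same; each coordinate then is a zero-sum vector.\<close>

lemma mix_power_consensus:
  fixes W :: "real mat" and Y :: "nat \<Rightarrow> real ^ 'd"
  assumes W: "W \<in> carrier_mat n n" "transpose_mat W = W"
    and ds: "doubly_stochastic W" and rate: "mixing_rate W < 1" and n: "1 \<le> n"
  shows "node_avg n (mix (W ^\<^sub>m t) Y) = node_avg n Y"
    and "(\<Sum>i<n. (norm (mix (W ^\<^sub>m t) Y i - node_avg n Y))\<^sup>2)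
      \<le> (mixing_rate W ^ t)\<^sup>2 * (\<Sum>i<n. (norm (Y i - node_avg n Y))\<^sup>2)"
proof -
  note mp = mixing_power[OF W ds rate]
  show "node_avg n (mix (W ^\<^sub>m t) Y) = node_avg n Y"
  proof -
    have "sum (mix (W ^\<^sub>m t) Y) {..<n} = sum Y {..<n}"
      unfolding Finite_Cartesian_Product.vec_eq_iff by (simp add: mix_nth mp(1))
    then show ?thesis by (simp add: node_avg_def)
  qed
  define c where "c = node_avg n Y"
  have sq: "(norm v)\<^sup>2 = (\<Sum>s\<in>UNIV. (v $ s)\<^sup>2)" for v :: "real ^ 'd"
    by (simp add: norm_vec_def L2_set_def sum_nonneg)
  have "(\<Sum>i<n. (norm (mix (W ^\<^sub>m t) Y i - c))\<^sup>2) = (\<Sum>s\<in>UNIV. \<Sum>i<n. (mix (W ^\<^sub>m t) Y i $ s - c $ s)\<^sup>2)"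
    unfolding sq by (subst sum.swap) simp
  also have "\<dots> \<le> (\<Sum>s\<in>UNIV. (mixing_rate W ^ t)\<^sup>2 * (\<Sum>i<n. (Y i $ s - c $ s)\<^sup>2))"
  proof (rule sum_mono)
    fix s
    have "mix (W ^\<^sub>m t) Y i $ s - c $ s = apply_mat (W ^\<^sub>m t) (\<lambda>i. Y i $ s - c $ s) i" if "i < n" for i
      using mp(2)[OF that, of t "c $ s"] by (simp add: mix_nth apply_mat_diff)
    then have "(\<Sum>i<n. (mix (W ^\<^sub>m t) Y i $ s - c $ s)\<^sup>2)
        = (\<Sum>i<n. (apply_mat (W ^\<^sub>m t) (\<lambda>i. Y i $ s - c $ s) i)\<^sup>2)" by simp
    also have "\<dots> \<le> (mixing_rate W ^ t)\<^sup>2 * (\<Sum>i<n. (Y i $ s - c $ s)\<^sup>2)"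
      by (rule mp(3)) (use n in \<open>simp add: c_def node_avg_def sum_subtractf\<close>)
    finally show "(\<Sum>i<n. (mix (W ^\<^sub>m t) Y i $ s - c $ s)\<^sup>2)
      \<le> (mixing_rate W ^ t)\<^sup>2 * (\<Sum>i<n. (Y i $ s - c $ s)\<^sup>2)" .
  qed
  also have "\<dots> = (mixing_rate W ^ t)\<^sup>2 * (\<Sum>i<n. (norm (Y i - c))\<^sup>2)"
    unfolding sq sum_distrib_left by (subst sum.swap) simp
  finally show "(\<Sum>i<n. (norm (mix (W ^\<^sub>m t) Y i - node_avg n Y))\<^sup>2)
      \<le> (mixing_rate W ^ t)\<^sup>2 * (\<Sum>i<n. (norm (Y i - node_avg n Y))\<^sup>2)"
    unfolding c_def .
qed

section \<open>Perturbed optimistic gradient iterations\<close>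

lemma norm_square_vec: "(norm v)\<^sup>2 = (\<Sum>s\<in>UNIV. (v $ s)\<^sup>2)" for v :: "real ^ 'd"
  by (simp add: norm_vec_def L2_set_def sum_nonneg)

lemma sum_atLeast2_shift:
  fixes a :: "nat \<Rightarrow> real"
  shows "(\<Sum>k\<in>{2..N}. a (k - 1)) = (\<Sum>k\<in>{1..<N}. a k)"
  by (rule sum.reindex_bij_witness[of _ Suc "\<lambda>k. k - 1"]) auto

lemma sum_combination:
  fixes a b e n q :: "'i \<Rightarrow> real"
  shows "(\<Sum>k\<in>K. a k - b k + c * e k - f * n k + h * q k)
    = - (\<Sum>k\<in>K. b k - a k) + c * (\<Sum>k\<in>K. e k) - f * (\<Sum>k\<in>K. n k) + h * (\<Sum>k\<in>K. q k)"
  by (simp add: sum.distrib sum_subtractf sum_distrib_left)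

lemma sum_combination2:
  fixes b e q u v :: "'i \<Rightarrow> real"
  shows "(\<Sum>k\<in>K. a * b k + e k / r + c * (h * q k + u k + v k))
    = a * (\<Sum>k\<in>K. b k) + (\<Sum>k\<in>K. e k) / r
      + c * (h * (\<Sum>k\<in>K. q k) + (\<Sum>k\<in>K. u k) + (\<Sum>k\<in>K. v k))"
  by (simp add: sum.distrib sum_divide_distrib flip: sum_distrib_left)

lemma square_sum_le: "(a + b)\<^sup>2 \<le> 2 * a\<^sup>2 + 2 * b\<^sup>2" for a b :: real
  using zero_le_power2[of "a - b"] by (simp add: power2_eq_square algebra_simps)

section \<open>The deterministic recursion on one path\<close>

text \<open>The averaged algorithm on a single sample path. No probabilistic property of
  \<open>n\<close> is assumed; \<open>n\<close> and \<open>p\<close> are separated because later the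
  one is controlled in mean and the other in norm. The scaling in \<open>D_eq\<close> has index k -
  1, so that in the application it is independent of the samples of step k. \<open>R\<close>,
  \<open>Dm\<close>, \<open>Gg\<close> and \<open>pm\<close> are a priori bounds that end up in the
  coefficients.\<close>

locale optimistic_iteration =
  fixes G0 Gi \<eta> L R Dm Gg pm :: real
    and x z D n p A :: "nat \<Rightarrow> real ^ 'd"
    and g :: "real ^ 'd \<Rightarrow> real ^ 'd"
    and xs :: "real ^ 'd"
    and N :: nat
  assumes N: "1 \<le> N"
    and pos: "0 < G0" "G0 \<le> Gi" "0 < \<eta>" "0 \<le> L"
    and step_size: "L\<^sup>2 * \<eta>\<^sup>2 \<le> G0 ^ 3 / (72 * Gi)"
    and D_0: "D 0 = 0"
    and z_eq: "\<And>k. k \<in> {1..N} \<Longrightarrow> z k = x (k - 1) - \<eta> *\<^sub>R D (k - 1)"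
    and x_eq: "\<And>k. k \<in> {1..N} \<Longrightarrow> x k = x (k - 1) - \<eta> *\<^sub>R D k"
    and D_eq: "\<And>k s. k \<in> {1..N} \<Longrightarrow> D k $ s = A (k - 1) $ s * g (z k) $ s + n k $ s + p k $ s"
    and A_decreasing: "\<And>k s. k \<in> {1..N} \<Longrightarrow> A k $ s \<le> A (k - 1) $ s"
    and A_lower: "\<And>k s. k \<le> N \<Longrightarrow> 1 / Gi \<le> A k $ s"
    and A_upper: "\<And>k s. k \<le> N \<Longrightarrow> A k $ s \<le> 1 / G0"
    and minty: "\<And>k. k \<in> {1..N} \<Longrightarrow> 0 \<le> (z k - xs) \<bullet> g (z k)"
    and lipschitz: "\<And>u v. norm (g u - g v) \<le> L * norm (u - v)"
    and z_bound: "\<And>k. k \<in> {1..N} \<Longrightarrow> norm (z k - xs) \<le> R"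
    and D_bound: "\<And>k. k \<in> {1..N} \<Longrightarrow> norm (D k) \<le> Dm"
    and g_bound: "\<And>k. k \<in> {1..N} \<Longrightarrow> norm (g (z k)) \<le> Gg"
    and p_bound: "\<And>k. k \<in> {1..N} \<Longrightarrow> norm (p k) \<le> pm"
begin

definition wt :: "nat \<Rightarrow> 'd \<Rightarrow> real" where "wt k s = 1 / A k $ s"

definition wsq :: "nat \<Rightarrow> real ^ 'd \<Rightarrow> real" where
  "wsq k v = (\<Sum>s\<in>UNIV. wt k s * (v $ s)\<^sup>2)"

text \<open>Kept with its sign throughout: its expectation vanishes, whereas its absolute value is
  too large to be summed.\<close>

definition noise :: "nat \<Rightarrow> real" where
  "noise k = (\<Sum>s\<in>UNIV. wt (k - 1) s * (z k - xs) $ s * n k $ s)"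

definition gap :: "nat \<Rightarrow> real" where "gap k = wsq (k - 1) (D k - D (k - 1))"

lemma Gi_pos: "0 < Gi" using pos by simp

lemma A_pos: "k \<le> N \<Longrightarrow> 0 < A k $ s"
  using A_lower[of k s] Gi_pos less_le_trans[of 0 "1 / Gi" "A k $ s"] by simp

lemma wt_bounds: assumes "k \<le> N" shows "G0 \<le> wt k s" "wt k s \<le> Gi" "0 < wt k s"
proof -
  show "0 < wt k s" using A_pos[OF assms] by (simp add: wt_def)
  show "G0 \<le> wt k s" using A_upper[OF assms, of s] A_pos[OF assms, of s] pos
    by (simp add: wt_def field_simps)
  show "wt k s \<le> Gi" using A_lower[OF assms, of s] A_pos[OF assms, of s] Gi_pos
    by (simp add: wt_def field_simps)
qed

lemma wt_mult: "k \<le> N \<Longrightarrow> wt k s * A k $ s = 1"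
  using A_pos[of k s] by (simp add: wt_def)

lemma wt_increasing: "k \<in> {1..N} \<Longrightarrow> wt (k - 1) s \<le> wt k s"
  using A_decreasing[of k s] A_pos[of k s] by (auto simp: wt_def intro!: divide_left_mono mult_pos_pos A_pos)

lemma wsq_lower: "k \<le> N \<Longrightarrow> G0 * (norm v)\<^sup>2 \<le> wsq k v"
  unfolding wsq_def norm_square_vec sum_distrib_left
  by (intro sum_mono mult_right_mono wt_bounds) auto

lemma wsq_upper: "k \<le> N \<Longrightarrow> wsq k v \<le> Gi * (norm v)\<^sup>2"
  unfolding wsq_def norm_square_vec sum_distrib_left
  by (intro sum_mono mult_right_mono wt_bounds) auto

lemma wsq_nonneg: "k \<le> N \<Longrightarrow> 0 \<le> wsq k v"
  unfolding wsq_def using wt_bounds by (intro sum_nonneg mult_nonneg_nonneg) (auto simp: less_imp_le)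

lemma gap_nonneg: "k \<in> {1..N} \<Longrightarrow> 0 \<le> gap k"
  unfolding gap_def by (rule wsq_nonneg) auto

lemma bounds_nonneg: "0 \<le> R" "0 \<le> Dm" "0 \<le> Gg" "0 \<le> pm"
  using z_bound[of 1] D_bound[of 1] g_bound[of 1] p_bound[of 1] N
  by (auto intro: order_trans[OF norm_ge_zero])

text \<open>The identity \<open>(w + \<eta>(a - b))\<^sup>2 = (w + \<eta>a)\<^sup>2 - 2\<eta>wb + \<eta>\<^sup>2(b - a)\<^sup>2 - \<eta>\<^sup>2a\<^sup>2\<close> with \<open>a = D\<^bsub>k-1\<^esub>\<close>, \<open>b = D\<^sub>k\<close>
  in every coordinate: the negative term is what the optimistic step gains.\<close>

lemma descent_step:
  assumes k: "k \<in> {1..N}"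
  shows "\<eta>\<^sup>2 * (G0 * (norm (D (k - 1)))\<^sup>2 - gap k)
    \<le> wsq (k - 1) (x (k - 1) - xs) - wsq k (x k - xs)
      + (R + 2 * \<eta> * Dm)\<^sup>2 * (\<Sum>s\<in>UNIV. wt k s - wt (k - 1) s)
      - 2 * \<eta> * noise k + 2 * \<eta> * Gi * R * norm (p k)"
proof -
  have k1: "k - 1 \<le> N" and kN: "k \<le> N" using k by auto
  define b where "b s = wt (k - 1) s" for s
  let ?D = "\<Sum>s\<in>UNIV. b s * (z k - xs) $ s * D k $ s" and ?p = "\<Sum>s\<in>UNIV. b s * (z k - xs) $ s * p k $ s"
  have "wsq (k - 1) (x k - xs) = (\<Sum>s\<in>UNIV. b s * ((x (k - 1) - xs) $ s)\<^sup>2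
      - 2 * \<eta> * (b s * (z k - xs) $ s * D k $ s)
      + \<eta>\<^sup>2 * (b s * ((D k - D (k - 1)) $ s)\<^sup>2) - \<eta>\<^sup>2 * (b s * (D (k - 1) $ s)\<^sup>2))"
    unfolding wsq_def b_def
  proof (intro sum.cong refl)
    fix s
    have "(x k - xs) $ s = (z k - xs) $ s + \<eta> * D (k - 1) $ s - \<eta> * D k $ s"
      and "(x (k - 1) - xs) $ s = (z k - xs) $ s + \<eta> * D (k - 1) $ s"
      by (simp_all add: x_eq[OF k] z_eq[OF k])
    moreover have "b * (w + \<eta> * a - \<eta> * c)\<^sup>2 = b * (w + \<eta> * a)\<^sup>2 - 2 * \<eta> * (b * w * c)
      + \<eta>\<^sup>2 * (b * (c - a)\<^sup>2) - \<eta>\<^sup>2 * (b * a\<^sup>2)" for a b c w :: real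
      by (simp add: power2_eq_square algebra_simps)
    ultimately show "wt (k - 1) s * ((x k - xs) $ s)\<^sup>2 = wt (k - 1) s * ((x (k - 1) - xs) $ s)\<^sup>2
      - 2 * \<eta> * (wt (k - 1) s * (z k - xs) $ s * D k $ s)
      + \<eta>\<^sup>2 * (wt (k - 1) s * ((D k - D (k - 1)) $ s)\<^sup>2) - \<eta>\<^sup>2 * (wt (k - 1) s * (D (k - 1) $ s)\<^sup>2)"
      by (simp only: vector_minus_component)
  qed
  also have "\<dots> = wsq (k - 1) (x (k - 1) - xs) - 2 * \<eta> * ?D
      + \<eta>\<^sup>2 * gap k - \<eta>\<^sup>2 * wsq (k - 1) (D (k - 1))"
    unfolding wsq_def gap_def b_def by (simp only: sum.distrib sum_subtractf sum_distrib_left)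
  finally have main: "wsq (k - 1) (x k - xs) = wsq (k - 1) (x (k - 1) - xs)
      - 2 * \<eta> * ?D
      + \<eta>\<^sup>2 * gap k - \<eta>\<^sup>2 * wsq (k - 1) (D (k - 1))" .
  \<comment> \<open>The weight \<open>b\<close> cancels the scaling \<open>A (k - 1)\<close>, which
    leaves the plain inner product of the Minty condition.\<close>
  have "?D
      = (\<Sum>s\<in>UNIV. (z k - xs) $ s * g (z k) $ s + b s * (z k - xs) $ s * n k $ s + b s * (z k - xs) $ s * p k $ s)"
  proof (intro sum.cong refl)
    fix s
    have "b s * (z k - xs) $ s * (A (k - 1) $ s * g (z k) $ s) = (b s * A (k - 1) $ s) * ((z k - xs) $ s * g (z k) $ s)"
      by (simp only: mult_ac)
    then show "b s * (z k - xs) $ s * D k $ s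
      = (z k - xs) $ s * g (z k) $ s + b s * (z k - xs) $ s * n k $ s + b s * (z k - xs) $ s * p k $ s"
      unfolding D_eq[OF k] using wt_mult[OF k1, of s] by (simp add: b_def distrib_left)
  qed
  also have "\<dots> = (z k - xs) \<bullet> g (z k) + noise k + ?p"
    by (simp add: sum.distrib inner_vec_def noise_def b_def)
  finally have cross: "?D
     = (z k - xs) \<bullet> g (z k) + noise k + ?p" .
  have "- ?p = (\<chi> s. b s * (z k - xs) $ s) \<bullet> (- p k)"
    by (simp add: inner_vec_def sum_negf)
  also have "\<dots> \<le> norm (\<chi> s. b s * (z k - xs) $ s) * norm (p k)"
    using norm_cauchy_schwarz[of "\<chi> s. b s * (z k - xs) $ s" "- p k"] by simp
  also have "\<dots> \<le> (Gi * R) * norm (p k)"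
  proof (intro mult_right_mono)
    have "(norm (\<chi> s. b s * (z k - xs) $ s))\<^sup>2 \<le> Gi\<^sup>2 * (norm (z k - xs))\<^sup>2"
      unfolding norm_square_vec sum_distrib_left
    proof (rule sum_mono)
      fix s
      have "(b s)\<^sup>2 \<le> Gi\<^sup>2" using wt_bounds[OF k1, of s] by (intro power_mono) (simp_all add: b_def)
      then have "(b s)\<^sup>2 * ((z k - xs) $ s)\<^sup>2 \<le> Gi\<^sup>2 * ((z k - xs) $ s)\<^sup>2"
        by (rule mult_right_mono) simp
      then show "((\<chi> s. b s * (z k - xs) $ s) $ s)\<^sup>2 \<le> Gi\<^sup>2 * ((z k - xs) $ s)\<^sup>2"
        by (simp only: vec_lambda_beta power_mult_distrib)
    qed
    then have "(norm (\<chi> s. b s * (z k - xs) $ s))\<^sup>2 \<le> (Gi * norm (z k - xs))\<^sup>2"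
      by (simp only: power_mult_distrib)
    then have "norm (\<chi> s. b s * (z k - xs) $ s) \<le> Gi * norm (z k - xs)"
      by (rule power2_le_imp_le) (use Gi_pos in simp)
    also have "\<dots> \<le> Gi * R" using z_bound[OF k] Gi_pos by (intro mult_left_mono) auto
    finally show "norm (\<chi> s. b s * (z k - xs) $ s) \<le> Gi * R" .
  qed simp
  finally have pert: "- ?p \<le> Gi * R * norm (p k)" .
  \<comment> \<open>\<open>x k\<close> differs from \<open>z k\<close> by two steps only, so the
    bound on \<open>z\<close> also confines \<open>x\<close>.\<close>
  have xk_eq: "x k - xs = (z k - xs) + \<eta> *\<^sub>R D (k - 1) - \<eta> *\<^sub>R D k"
    by (simp add: x_eq[OF k] z_eq[OF k])
  have "norm (x k - xs) \<le> norm (z k - xs) + norm (\<eta> *\<^sub>R D (k - 1)) + norm (\<eta> *\<^sub>R D k)"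
    unfolding xk_eq using norm_triangle_ineq[of "z k - xs" "\<eta> *\<^sub>R D (k - 1)"]
      norm_triangle_ineq4[of "z k - xs + \<eta> *\<^sub>R D (k - 1)" "\<eta> *\<^sub>R D k"] by linarith
  also have "\<dots> \<le> R + \<eta> * Dm + \<eta> * Dm"
  proof (intro add_mono z_bound[OF k])
    have "k - 1 = 0 \<or> k - 1 \<in> {1..N}" using k by auto
    then have "norm (D (k - 1)) \<le> Dm" using D_bound[of "k - 1"] D_0 bounds_nonneg by auto
    then show "norm (\<eta> *\<^sub>R D (k - 1)) \<le> \<eta> * Dm" using pos by simp
    show "norm (\<eta> *\<^sub>R D k) \<le> \<eta> * Dm" using D_bound[OF k] pos by simp
  qed
  finally have xk: "norm (x k - xs) \<le> R + 2 * \<eta> * Dm" by (simp add: mult.commute)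
  \<comment> \<open>Passing from weight k - 1 to weight k costs the increment of the weight times a
    squared radius; the increments telescope in the sum.\<close>
  have "wsq k (x k - xs) - wsq (k - 1) (x k - xs) = (\<Sum>s\<in>UNIV. (wt k s - wt (k - 1) s) * ((x k - xs) $ s)\<^sup>2)"
    by (simp add: wsq_def sum_subtractf left_diff_distrib)
  also have "\<dots> \<le> (\<Sum>s\<in>UNIV. (wt k s - wt (k - 1) s) * (R + 2 * \<eta> * Dm)\<^sup>2)"
  proof (intro sum_mono mult_left_mono)
    fix s
    have "\<bar>(x k - xs) $ s\<bar> \<le> R + 2 * \<eta> * Dm" using component_le_norm_cart[of "x k - xs" s] xk by linarith
    then show "((x k - xs) $ s)\<^sup>2 \<le> (R + 2 * \<eta> * Dm)\<^sup>2" by (metis abs_ge_zero power2_abs power_mono)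
  qed (use wt_increasing[OF k] in auto)
  finally have drift: "wsq k (x k - xs) - wsq (k - 1) (x k - xs)
      \<le> (R + 2 * \<eta> * Dm)\<^sup>2 * (\<Sum>s\<in>UNIV. wt k s - wt (k - 1) s)"
    by (simp add: sum_distrib_left mult.commute)
  have "2 * \<eta> * - ?D
      \<le> 2 * \<eta> * (- noise k + Gi * R * norm (p k))"
    using minty[OF k] pert pos unfolding cross by (intro mult_left_mono) auto
  moreover have "\<eta>\<^sup>2 * (G0 * (norm (D (k - 1)))\<^sup>2) \<le> \<eta>\<^sup>2 * wsq (k - 1) (D (k - 1))"
    using wsq_lower[OF k1] by (intro mult_left_mono) auto
  ultimately show ?thesis using main drift by (simp add: algebra_simps)
qed

text \<open>One of the two factors in the square of \<open>norm (p k)\<close> is replaced by its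
  bound \<open>pm\<close>, because the sum of first powers is what can be controlled.\<close>

definition err :: "nat \<Rightarrow> real" where
  "err k = 2 * (norm (n k))\<^sup>2 + 2 * pm * norm (p k)"

lemma err_bound:
  assumes "k \<in> {1..N}" shows "(norm (n k + p k))\<^sup>2 \<le> err k"
proof -
  have "(norm (n k + p k))\<^sup>2 \<le> (norm (n k) + norm (p k))\<^sup>2"
    by (intro power_mono norm_triangle_ineq) auto
  also have "\<dots> \<le> 2 * (norm (n k))\<^sup>2 + 2 * (norm (p k))\<^sup>2" by (rule square_sum_le)
  also have "(norm (p k))\<^sup>2 \<le> pm * norm (p k)"
    unfolding power2_eq_square using p_bound[OF assms] by (intro mult_right_mono) auto
  finally show ?thesis by (simp add: err_def)
qed

lemma err_nonneg: "k \<in> {1..N} \<Longrightarrow> 0 \<le> err k"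
  using err_bound order_trans[OF zero_le_power2] by blast

lemma gap_1: "gap 1 \<le> Gi * Dm\<^sup>2"
proof -
  have "gap 1 \<le> Gi * (norm (D 1))\<^sup>2"
    using wsq_upper[of 0 "D 1 - D 0"] D_0 by (simp add: gap_def)
  also have "\<dots> \<le> Gi * Dm\<^sup>2"
    using D_bound[of 1] N Gi_pos by (intro mult_left_mono power_mono) auto
  finally show ?thesis .
qed

lemma norm_sum3_square: "(norm (a + b + c))\<^sup>2 \<le> 3 * ((norm a)\<^sup>2 + (norm b)\<^sup>2 + (norm c)\<^sup>2)"
  for a b c :: "real ^ 'd"
proof -
  have "(norm (a + b + c))\<^sup>2 \<le> (norm a + norm b + norm c)\<^sup>2"
    by (intro power_mono) (auto intro: norm_triangle_le add_right_mono norm_triangle_ineq)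
  also have "\<dots> \<le> 3 * ((norm a)\<^sup>2 + (norm b)\<^sup>2 + (norm c)\<^sup>2)"
    using zero_le_power2[of "norm a - norm b"] zero_le_power2[of "norm a - norm c"]
      zero_le_power2[of "norm b - norm c"]
    by (simp add: power2_eq_square algebra_simps)
  finally show ?thesis .
qed

text \<open>\<open>D k\<close> - \<open>D (k - 1)\<close> consists of the scaled difference of
  gradients, the change of scaling times the old gradient, and the noise and perturbation of both
  steps. The first part is estimated through \<open>z k\<close> - \<open>z (k - 1)\<close> = -\<eta>
  (\<open>D (k - 1)\<close> + (\<open>D (k - 1)\<close> - \<open>D (k - 2)\<close>)) and the
  Lipschitz condition: two splittings of a square give a factor 4, and the 72 of the step-size bound
  turns it into 1/18. Step 1 is excluded since it has no earlier gradient to compare with.\<close>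

lemma gap_step:
  assumes k: "k \<in> {2..N}"
  shows "gap k \<le> G0 / 18 * (norm (D (k - 1)))\<^sup>2 + gap (k - 1) / 18
    + 6 * Gi * (Gg\<^sup>2 / G0 * (\<Sum>s\<in>UNIV. A (k - 2) $ s - A (k - 1) $ s) + err k + err (k - 1))"
proof -
  let ?q = "(norm (D (k - 1)))\<^sup>2" and ?c = "(norm (D (k - 1) - D (k - 2)))\<^sup>2" and ?d = "(\<Sum>s\<in>UNIV. A (k - 2) $ s - A (k - 1) $ s)"
  have kk: "k \<in> {1..N}" "k - 1 \<in> {1..N}" "k - 1 \<le> N" "k - 2 \<le> N" and k2: "k - 1 - 1 = k - 2"
    using k by auto
  define y1 where "y1 = (\<chi> s. (A (k - 1) $ s - A (k - 2) $ s) * g (z (k - 1)) $ s)"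
  define y where "y = y1 + (n k + p k) + (- (n (k - 1) + p (k - 1)))"
  define dg where "dg = g (z k) - g (z (k - 1))"
  have split: "(D k - D (k - 1)) $ s = A (k - 1) $ s * dg $ s + y $ s" for s
    unfolding vector_minus_component D_eq[OF kk(1)] D_eq[OF kk(2)] k2
    by (simp add: y_def y1_def dg_def algebra_simps)
  have "gap k \<le> (\<Sum>s\<in>UNIV. 2 / G0 * (dg $ s)\<^sup>2 + 2 * Gi * (y $ s)\<^sup>2)"
    unfolding gap_def wsq_def
  proof (rule sum_mono)
    fix s
    let ?b = "wt (k - 1) s" and ?a = "A (k - 1) $ s"
    have "((D k - D (k - 1)) $ s)\<^sup>2 \<le> 2 * (?a * dg $ s)\<^sup>2 + 2 * (y $ s)\<^sup>2"
      unfolding split by (rule square_sum_le)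
    then have "?b * ((D k - D (k - 1)) $ s)\<^sup>2 \<le> ?b * (2 * (?a * dg $ s)\<^sup>2 + 2 * (y $ s)\<^sup>2)"
      using wt_bounds[OF kk(3)] by (intro mult_left_mono) (auto simp: less_imp_le)
    also have "\<dots> = 2 * (?b * ?a) * ?a * (dg $ s)\<^sup>2 + 2 * ?b * (y $ s)\<^sup>2"
      by (simp add: power2_eq_square algebra_simps)
    also have "\<dots> \<le> 2 * (1 / G0) * (dg $ s)\<^sup>2 + 2 * Gi * (y $ s)\<^sup>2"
    proof (intro add_mono mult_right_mono zero_le_power2)
      show "2 * (?b * ?a) * ?a \<le> 2 * (1 / G0)"
        unfolding wt_mult[OF kk(3)] using A_upper[OF kk(3), of s] by simp
      show "2 * ?b \<le> 2 * Gi" using wt_bounds[OF kk(3), of s] by simp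
    qed
    finally show "?b * ((D k - D (k - 1)) $ s)\<^sup>2 \<le> 2 / G0 * (dg $ s)\<^sup>2 + 2 * Gi * (y $ s)\<^sup>2" by simp
  qed
  also have "\<dots> = 2 / G0 * (norm dg)\<^sup>2 + 2 * Gi * (norm y)\<^sup>2"
    by (simp add: sum.distrib sum_distrib_left norm_square_vec)
  finally have gk: "gap k \<le> 2 / G0 * (norm dg)\<^sup>2 + 2 * Gi * (norm y)\<^sup>2" .
  have "z k - z (k - 1) = - \<eta> *\<^sub>R (D (k - 1) + (D (k - 1) - D (k - 2)))"
    unfolding z_eq[OF kk(1)] z_eq[OF kk(2)] x_eq[OF kk(2)] k2
    by (simp add: Finite_Cartesian_Product.vec_eq_iff algebra_simps)
  then have zz: "norm (z k - z (k - 1)) = \<eta> * norm (D (k - 1) + (D (k - 1) - D (k - 2)))"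
    using pos by simp
  have "(norm dg)\<^sup>2 \<le> (L * norm (z k - z (k - 1)))\<^sup>2"
    unfolding dg_def by (intro power_mono lipschitz) auto
  also have "\<dots> = L\<^sup>2 * \<eta>\<^sup>2 * (norm (D (k - 1) + (D (k - 1) - D (k - 2))))\<^sup>2"
    unfolding zz by (simp add: power_mult_distrib)
  also have "\<dots> \<le> G0 ^ 3 / (72 * Gi) * (2 * ?q + 2 * ?c)"
  proof (intro mult_mono step_size)
    have "(norm (D (k - 1) + (D (k - 1) - D (k - 2))))\<^sup>2 \<le> (norm (D (k - 1)) + norm (D (k - 1) - D (k - 2)))\<^sup>2"
      by (intro power_mono norm_triangle_ineq) auto
    also have "\<dots> \<le> 2 * ?q + 2 * ?c" by (rule square_sum_le)
    finally show "(norm (D (k - 1) + (D (k - 1) - D (k - 2))))\<^sup>2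
      \<le> 2 * ?q + 2 * ?c" .
  qed (use pos in auto)
  finally have "2 / G0 * (norm dg)\<^sup>2 \<le> 2 / G0 * (G0 ^ 3 / (72 * Gi) *
      (2 * ?q + 2 * ?c))"
    using pos by (intro mult_left_mono) auto
  also have "\<dots> = G0 / 18 * ((G0 / Gi) * (?q + ?c))"
    using pos Gi_pos by (simp add: field_simps power3_eq_cube)
  also have "\<dots> \<le> G0 / 18 * (1 * (?q + ?c))"
    using pos Gi_pos by (intro mult_left_mono mult_right_mono) auto
  also have "\<dots> \<le> G0 / 18 * ?q + gap (k - 1) / 18"
    using wsq_lower[OF kk(4), of "D (k - 1) - D (k - 2)"] unfolding gap_def k2 by (simp add: algebra_simps)
  finally have dgb: "2 / G0 * (norm dg)\<^sup>2 \<le> G0 / 18 * ?q + gap (k - 1) / 18" .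
  \<comment> \<open>Of the squared decrement of the scaling, one factor is bounded by 1 /
    \<open>G0\<close>; the remaining first power telescopes.\<close>
  have "(norm y1)\<^sup>2 \<le> (\<Sum>s\<in>UNIV. (A (k - 2) $ s - A (k - 1) $ s) * (Gg\<^sup>2 / G0))"
    unfolding norm_square_vec
  proof (rule sum_mono)
    fix s
    let ?da = "A (k - 2) $ s - A (k - 1) $ s"
    have da: "0 \<le> ?da" "?da \<le> 1 / G0"
      using A_decreasing[OF kk(2), of s] A_upper[OF kk(4), of s] A_pos[OF kk(3), of s] unfolding k2 by auto
    have "\<bar>g (z (k - 1)) $ s\<bar> \<le> Gg"
      using component_le_norm_cart[of "g (z (k - 1))" s] g_bound[OF kk(2)] by linarith
    then have "(g (z (k - 1)) $ s)\<^sup>2 \<le> Gg\<^sup>2" by (metis abs_ge_zero power2_abs power_mono)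
    then have "?da * (?da * (g (z (k - 1)) $ s)\<^sup>2) \<le> ?da * (1 / G0 * Gg\<^sup>2)"
      using da pos by (intro mult_left_mono mult_mono) auto
    then show "(y1 $ s)\<^sup>2 \<le> ?da * (Gg\<^sup>2 / G0)"
      by (simp add: y1_def power2_eq_square algebra_simps)
  qed
  then have y1b: "(norm y1)\<^sup>2 \<le> Gg\<^sup>2 / G0 * ?d"
    by (simp add: sum_distrib_left mult.commute)
  have "(norm y)\<^sup>2 \<le> 3 * ((norm y1)\<^sup>2 + (norm (n k + p k))\<^sup>2 + (norm (- (n (k - 1) + p (k - 1))))\<^sup>2)"
    unfolding y_def by (rule norm_sum3_square)
  also have "\<dots> \<le> 3 * (Gg\<^sup>2 / G0 * ?d + err k + err (k - 1))"
    unfolding norm_minus_cancel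
    by (intro mult_left_mono add_mono y1b err_bound[OF kk(1)] err_bound[OF kk(2)]) simp
  finally have "2 * Gi * (norm y)\<^sup>2 \<le> 2 * Gi * (3 * (Gg\<^sup>2 / G0 * ?d + err k + err (k - 1)))"
    using Gi_pos by (intro mult_left_mono) auto
  then show ?thesis using gk dgb by linarith
qed

text \<open>Summing \<open>gap_step\<close> bounds the total \<open>T\<close> of the gaps by
  \<open>T\<close> / 18 + \<open>G0\<close> \<open>S\<close> / 18 and a remainder. Solving for
  \<open>T\<close> yields \<open>G0\<close> \<open>S\<close> / 17 and 18/17 of the remainder, so
  16/17 of \<open>G0\<close> \<open>S\<close> survives in the summed descent. The gradients come
  back from the directions by g = wt (D - n - p), with the weight at most \<open>Gi\<close>.\<close>

lemma sum_gradient_bound: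
  defines "S \<equiv> (\<Sum>k\<in>{1..N}. (norm (D (k - 1)))\<^sup>2)"
    and "E \<equiv> (\<Sum>k\<in>{1..N}. err k)"
    and "Pn \<equiv> (\<Sum>k\<in>{1..N}. norm (p k))"
    and "V \<equiv> (\<Sum>k\<in>{1..N}. noise k)"
    and "d \<equiv> real CARD('d)"
  shows "\<eta>\<^sup>2 * (16 / 17 * G0 * S) \<le> Gi * R\<^sup>2 + (R + 2 * \<eta> * Dm)\<^sup>2 * (d * Gi) - 2 * \<eta> * V + 2 * \<eta> * Gi * R * Pn
      + \<eta>\<^sup>2 * (18 / 17 * (Gi * Dm\<^sup>2 + 6 * Gi * (Gg\<^sup>2 / G0 * (d / G0) + 2 * E)))"
    and "(\<Sum>k\<in>{1..N}. (norm (g (z k)))\<^sup>2) \<le> 2 * Gi\<^sup>2 * (S + Dm\<^sup>2 + E)"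
proof -
  let ?Q = "18 / 17 * (Gi * Dm\<^sup>2 + 6 * Gi * (Gg\<^sup>2 / G0 * (d / G0) + 2 * E))" and ?R = "(R + 2 * \<eta> * Dm)\<^sup>2" and ?A = "\<lambda>k. \<Sum>s\<in>UNIV. A (k - 2) $ s - A (k - 1) $ s"
  define T where "T = (\<Sum>k\<in>{1..N}. gap k)"
  have split: "{1..N} = insert 1 {2..N}" using N by auto
  have wtN: "(\<Sum>s\<in>UNIV. wt N s - wt 0 s) \<le> d * Gi"
  proof -
    have "(\<Sum>s\<in>UNIV. wt N s - wt 0 s) \<le> (\<Sum>s\<in>(UNIV :: 'd set). Gi)"
    proof (rule sum_mono)
      fix s show "wt N s - wt 0 s \<le> Gi" using wt_bounds[of N s] wt_bounds[of 0 s] by simp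
    qed
    then show ?thesis by (simp add: d_def)
  qed
  have tele: "(\<Sum>k\<in>{1..N}. f k - f (k - 1)) = f N - f 0" for f :: "nat \<Rightarrow> real"
    using sum_telescope''[of 0 N f] by simp
  have "\<eta>\<^sup>2 * (G0 * S - T) = (\<Sum>k\<in>{1..N}. \<eta>\<^sup>2 * (G0 * (norm (D (k - 1)))\<^sup>2 - gap k))"
    by (simp only: S_def T_def sum_subtractf sum_distrib_left right_diff_distrib)
  also have "\<dots> \<le> (\<Sum>k\<in>{1..N}. wsq (k - 1) (x (k - 1) - xs) - wsq k (x k - xs)
      + ?R * (\<Sum>s\<in>UNIV. wt k s - wt (k - 1) s)
      - 2 * \<eta> * noise k + 2 * \<eta> * Gi * R * norm (p k))"
    by (intro sum_mono descent_step)
  also have "\<dots> = - (\<Sum>k\<in>{1..N}. wsq k (x k - xs) - wsq (k - 1) (x (k - 1) - xs))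
      + ?R * (\<Sum>k\<in>{1..N}. \<Sum>s\<in>UNIV. wt k s - wt (k - 1) s)
      - 2 * \<eta> * V + 2 * \<eta> * Gi * R * Pn"
    unfolding V_def Pn_def by (rule sum_combination)
  also have "\<dots> = wsq 0 (x 0 - xs) - wsq N (x N - xs)
      + ?R * (\<Sum>s\<in>UNIV. wt N s - wt 0 s) - 2 * \<eta> * V + 2 * \<eta> * Gi * R * Pn"
    unfolding tele[of "\<lambda>k. wsq k (x k - xs)"] using tele[of "\<lambda>k. wt k s" for s]
    by (subst sum.swap) simp
  also have "\<dots> \<le> Gi * R\<^sup>2 + ?R * (d * Gi) - 2 * \<eta> * V + 2 * \<eta> * Gi * R * Pn"
  proof -
    \<comment> \<open>Because \<open>D 0\<close> = 0, the starting point equals \<open>z 1\<close>,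
      and the bound on \<open>z\<close> also covers the initial distance.\<close>
    have x0: "x 0 - xs = z 1 - xs" using z_eq[of 1] N D_0 by simp
    have "wsq 0 (x 0 - xs) \<le> Gi * (norm (z 1 - xs))\<^sup>2" unfolding x0 by (rule wsq_upper) simp
    also have "Gi * (norm (z 1 - xs))\<^sup>2 \<le> Gi * R\<^sup>2"
      using z_bound[of 1] N Gi_pos by (intro mult_left_mono power_mono) auto
    finally have "wsq 0 (x 0 - xs) \<le> Gi * R\<^sup>2" .
    moreover have "0 \<le> wsq N (x N - xs)" by (rule wsq_nonneg) simp
    moreover have "?R * (\<Sum>s\<in>UNIV. wt N s - wt 0 s) \<le> ?R * (d * Gi)"
      by (intro mult_left_mono wtN) simp
    ultimately show ?thesis by linarith
  qed
  finally have descent: "\<eta>\<^sup>2 * (G0 * S - T)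
      \<le> Gi * R\<^sup>2 + ?R * (d * Gi) - 2 * \<eta> * V + 2 * \<eta> * Gi * R * Pn" .
  have T_split: "T = gap 1 + (\<Sum>k\<in>{2..N}. gap k)" unfolding T_def split by (rule sum.insert) auto
  have "(\<Sum>k\<in>{2..N}. gap k) \<le> (\<Sum>k\<in>{2..N}. G0 / 18 * (norm (D (k - 1)))\<^sup>2 + gap (k - 1) / 18
    + 6 * Gi * (Gg\<^sup>2 / G0 * (?A k) + err k + err (k - 1)))"
    by (intro sum_mono gap_step)
  also have "\<dots> = G0 / 18 * (\<Sum>k\<in>{2..N}. (norm (D (k - 1)))\<^sup>2) + (\<Sum>k\<in>{2..N}. gap (k - 1)) / 18
    + 6 * Gi * (Gg\<^sup>2 / G0 * (\<Sum>k\<in>{2..N}. ?A k)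
      + (\<Sum>k\<in>{2..N}. err k) + (\<Sum>k\<in>{2..N}. err (k - 1)))"
    by (rule sum_combination2)
  also have "\<dots> \<le> G0 / 18 * S + T / 18 + 6 * Gi * (Gg\<^sup>2 / G0 * (d / G0) + E + E)"
  proof -
    have "(\<Sum>k\<in>{2..N}. (norm (D (k - 1)))\<^sup>2) \<le> S" unfolding S_def by (intro sum_mono2) auto
    moreover have "(\<Sum>k\<in>{2..N}. gap (k - 1)) \<le> T"
      unfolding sum_atLeast2_shift T_def by (intro sum_mono2) (auto intro: gap_nonneg)
    moreover have "(\<Sum>k\<in>{2..N}. err (k - 1)) \<le> E"
      unfolding sum_atLeast2_shift E_def by (intro sum_mono2) (auto intro: err_nonneg)
    moreover have "(\<Sum>k\<in>{2..N}. err k) \<le> E"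
      unfolding E_def by (intro sum_mono2) (auto intro: err_nonneg)
    moreover have "(\<Sum>k\<in>{2..N}. ?A k) \<le> d / G0"
    proof -
      have "(\<Sum>k\<in>{2..N}. ?A k)
        = (\<Sum>s\<in>UNIV. \<Sum>k\<in>{1..<N}. A (k - 1) $ s - A k $ s)"
        using sum_atLeast2_shift[of "\<lambda>k. A (k - 1) $ s - A k $ s" N for s]
        by (subst sum.swap) (simp add: numeral_2_eq_2)
      also have "\<dots> \<le> (\<Sum>s\<in>(UNIV :: 'd set). 1 / G0)"
      proof (rule sum_mono)
        fix s
        have "(\<Sum>k\<in>{1..<N}. A (k - 1) $ s - A k $ s) \<le> (\<Sum>k\<in>{1..N}. A (k - 1) $ s - A k $ s)"
          using A_decreasing by (intro sum_mono2) auto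
        also have "\<dots> = - (\<Sum>k\<in>{1..N}. A k $ s - A (k - 1) $ s)" by (simp add: sum_subtractf)
        also have "\<dots> = A 0 $ s - A N $ s" using tele[of "\<lambda>k. A k $ s"] by simp
        also have "\<dots> \<le> 1 / G0" using A_upper[of 0 s] A_pos[of N s] by simp
        finally show "(\<Sum>k\<in>{1..<N}. A (k - 1) $ s - A k $ s) \<le> 1 / G0" .
      qed
      finally show ?thesis by (simp add: d_def)
    qed
    ultimately show ?thesis using pos Gi_pos
      by (intro add_mono mult_left_mono divide_right_mono) simp_all
  qed
  \<comment> \<open>The gaps occur on both sides with coefficients 1 and 1/18; this is the solved
    form.\<close>
  finally have "T \<le> ?Q + G0 / 17 * S"
    using gap_1 T_split by argo
  then have "\<eta>\<^sup>2 * T \<le> \<eta>\<^sup>2 * (?Q + G0 / 17 * S)"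
    by (intro mult_left_mono) auto
  then show "\<eta>\<^sup>2 * (16 / 17 * G0 * S) \<le> Gi * R\<^sup>2 + ?R * (d * Gi) - 2 * \<eta> * V + 2 * \<eta> * Gi * R * Pn
      + \<eta>\<^sup>2 * (?Q)"
    using descent by (simp add: algebra_simps)
  have "(\<Sum>k\<in>{1..N}. (norm (g (z k)))\<^sup>2) \<le> (\<Sum>k\<in>{1..N}. 2 * Gi\<^sup>2 * ((norm (D k))\<^sup>2 + err k))"
  proof (rule sum_mono)
    fix k assume k: "k \<in> {1..N}"
    then have k1: "k - 1 \<le> N" by auto
    have gk: "(norm (g (z k)))\<^sup>2 \<le> Gi\<^sup>2 * (norm (D k - (n k + p k)))\<^sup>2"
      unfolding norm_square_vec sum_distrib_left
    proof (rule sum_mono)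
      fix s
      have "g (z k) $ s = wt (k - 1) s * A (k - 1) $ s * g (z k) $ s" using wt_mult[OF k1] by simp
      also have "\<dots> = wt (k - 1) s * (D k - (n k + p k)) $ s" using D_eq[OF k, of s] by simp
      finally have "(g (z k) $ s)\<^sup>2 = (wt (k - 1) s)\<^sup>2 * ((D k - (n k + p k)) $ s)\<^sup>2"
        by (simp add: power_mult_distrib)
      also have "\<dots> \<le> Gi\<^sup>2 * ((D k - (n k + p k)) $ s)\<^sup>2"
        using wt_bounds[OF k1, of s] by (intro mult_right_mono power_mono) auto
      finally show "(g (z k) $ s)\<^sup>2 \<le> Gi\<^sup>2 * ((D k - (n k + p k)) $ s)\<^sup>2" .
    qed
    have "(norm (D k - (n k + p k)))\<^sup>2 \<le> (norm (D k) + norm (n k + p k))\<^sup>2"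
      by (intro power_mono norm_triangle_ineq4) auto
    also have "\<dots> \<le> 2 * (norm (D k))\<^sup>2 + 2 * (norm (n k + p k))\<^sup>2" by (rule square_sum_le)
    also have "\<dots> \<le> 2 * (norm (D k))\<^sup>2 + 2 * err k" using err_bound[OF k] by simp
    finally have "Gi\<^sup>2 * (norm (D k - (n k + p k)))\<^sup>2 \<le> Gi\<^sup>2 * (2 * (norm (D k))\<^sup>2 + 2 * err k)"
      by (rule mult_left_mono) simp
    then show "(norm (g (z k)))\<^sup>2 \<le> 2 * Gi\<^sup>2 * ((norm (D k))\<^sup>2 + err k)"
      using gk by (simp add: algebra_simps)
  qed
  also have "\<dots> = 2 * Gi\<^sup>2 * ((\<Sum>k\<in>{1..N}. (norm (D k))\<^sup>2) + E)"
    by (simp only: sum_distrib_left[symmetric] sum.distrib E_def)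
  also have "\<dots> \<le> 2 * Gi\<^sup>2 * (S + Dm\<^sup>2 + E)"
  proof (intro mult_left_mono add_right_mono)
    \<comment> \<open>\<open>S\<close> is shifted by one index, which matters only for the last
      term.\<close>
    have "(\<Sum>k\<in>{1..N}. (norm (D k))\<^sup>2) - S = (norm (D N))\<^sup>2 - (norm (D 0))\<^sup>2"
      unfolding S_def using tele[of "\<lambda>k. (norm (D k))\<^sup>2"] by (simp add: sum_subtractf)
    moreover have "(norm (D N))\<^sup>2 \<le> Dm\<^sup>2" using D_bound[of N] N by (intro power_mono) auto
    ultimately show "(\<Sum>k\<in>{1..N}. (norm (D k))\<^sup>2) \<le> S + Dm\<^sup>2" by (simp add: D_0)
  qed simp
  finally show "(\<Sum>k\<in>{1..N}. (norm (g (z k)))\<^sup>2) \<le> 2 * Gi\<^sup>2 * (S + Dm\<^sup>2 + E)" .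
qed

end

section \<open>Explicit coefficients\<close>

text \<open>The factor 2 Gi^2 from recovering gradients, times the reciprocal of the coefficient
  (16/17) \<eta>^2 G0 that \<open>S\<close> has in the descent inequality.\<close>

definition descent_coeff :: "real \<Rightarrow> real \<Rightarrow> real \<Rightarrow> real" where
  "descent_coeff G0 Gi \<eta> = 2 * Gi\<^sup>2 * (17 / (16 * \<eta>\<^sup>2 * G0))"

definition const_coeff :: "real \<Rightarrow> real \<Rightarrow> real \<Rightarrow> real \<Rightarrow> real \<Rightarrow> real \<Rightarrow> real \<Rightarrow> real" where
  "const_coeff G0 Gi \<eta> R Dm Gg d = descent_coeff G0 Gi \<eta> *
    (Gi * R\<^sup>2 + (R + 2 * \<eta> * Dm)\<^sup>2 * (d * Gi)
      + \<eta>\<^sup>2 * (18 / 17 * (Gi * Dm\<^sup>2 + 6 * Gi * (Gg\<^sup>2 / G0 * (d / G0))))) + 2 * Gi\<^sup>2 * Dm\<^sup>2"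

text \<open>24 = 6 * 2 * 2: the constant of \<open>gap_step\<close>, the errors of the two steps in
  it, and the factor 2 in \<open>err\<close>.\<close>

definition variance_coeff :: "real \<Rightarrow> real \<Rightarrow> real \<Rightarrow> real" where
  "variance_coeff G0 Gi \<eta> = descent_coeff G0 Gi \<eta> * (\<eta>\<^sup>2 * (18 / 17 * (24 * Gi))) + 4 * Gi\<^sup>2"

definition perturbation_coeff :: "real \<Rightarrow> real \<Rightarrow> real \<Rightarrow> real \<Rightarrow> real \<Rightarrow> real" where
  "perturbation_coeff G0 Gi \<eta> R pm = descent_coeff G0 Gi \<eta> *
    (2 * \<eta> * Gi * R + \<eta>\<^sup>2 * (18 / 17 * (24 * Gi * pm))) + 4 * Gi\<^sup>2 * pm"

text \<open>\<open>S\<close> is eliminated between the two bounds. The coefficients contain no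
  quantity of the path, so the inequality can be integrated, and they can be compared across
  instances.\<close>

lemma (in optimistic_iteration) sum_gradient_bound_explicit:
  "(\<Sum>k\<in>{1..N}. (norm (g (z k)))\<^sup>2)
    \<le> const_coeff G0 Gi \<eta> R Dm Gg (real CARD('d))
      + variance_coeff G0 Gi \<eta> * (\<Sum>k\<in>{1..N}. (norm (n k))\<^sup>2)
      + perturbation_coeff G0 Gi \<eta> R pm * (\<Sum>k\<in>{1..N}. norm (p k))
      - descent_coeff G0 Gi \<eta> * (2 * \<eta>) *
        (\<Sum>k\<in>{1..N}. \<Sum>s\<in>UNIV. 1 / A (k - 1) $ s * (z k - xs) $ s * n k $ s)"
proof -
  define d where "d = real CARD('d)"
  define S where "S = (\<Sum>k\<in>{1..N}. (norm (D (k - 1)))\<^sup>2)"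
  define Nn where "Nn = (\<Sum>k\<in>{1..N}. (norm (n k))\<^sup>2)"
  define Pn where "Pn = (\<Sum>k\<in>{1..N}. norm (p k))"
  define V where "V = (\<Sum>k\<in>{1..N}. noise k)"
  have E: "(\<Sum>k\<in>{1..N}. err k) = 2 * Nn + 2 * pm * Pn"
    by (simp only: err_def sum.distrib sum_distrib_left[symmetric] Nn_def Pn_def)
  define X where "X = Gi * R\<^sup>2 + (R + 2 * \<eta> * Dm)\<^sup>2 * (d * Gi) - 2 * \<eta> * V + 2 * \<eta> * Gi * R * Pn
      + \<eta>\<^sup>2 * (18 / 17 * (Gi * Dm\<^sup>2 + 6 * Gi * (Gg\<^sup>2 / G0 * (d / G0) + 2 * (2 * Nn + 2 * pm * Pn))))"
  define c where "c = 17 / (16 * \<eta>\<^sup>2 * G0)"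
  have c: "c * (\<eta>\<^sup>2 * (16 / 17 * G0)) = 1" using pos by (simp add: c_def)
  have "c \<ge> 0" using pos by (simp add: c_def)
  have "\<eta>\<^sup>2 * (16 / 17 * G0 * S) \<le> X"
    using sum_gradient_bound(1) unfolding E X_def S_def Pn_def V_def d_def .
  then have cX: "c * (\<eta>\<^sup>2 * (16 / 17 * G0 * S)) \<le> c * X"
    using \<open>c \<ge> 0\<close> by (rule mult_left_mono)
  have cS: "c * (\<eta>\<^sup>2 * (16 / 17 * G0 * S)) = S" using arg_cong[OF c, of "\<lambda>u. u * S"] by (simp add: mult_ac)
  have SX: "S \<le> c * X" using cX unfolding cS .
  have "(\<Sum>k\<in>{1..N}. (norm (g (z k)))\<^sup>2) \<le> 2 * Gi\<^sup>2 * (S + Dm\<^sup>2 + (2 * Nn + 2 * pm * Pn))"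
    using sum_gradient_bound(2) unfolding E S_def .
  also have "\<dots> \<le> 2 * Gi\<^sup>2 * (c * X + Dm\<^sup>2 + (2 * Nn + 2 * pm * Pn))"
    using SX by (intro mult_left_mono) auto
  also have "\<dots> = 2 * Gi\<^sup>2 * c * X + 2 * Gi\<^sup>2 * Dm\<^sup>2 + 4 * Gi\<^sup>2 * Nn + 4 * Gi\<^sup>2 * pm * Pn"
    by (simp add: algebra_simps)
  also have "2 * Gi\<^sup>2 * c = descent_coeff G0 Gi \<eta>" by (simp add: c_def descent_coeff_def)
  also have "descent_coeff G0 Gi \<eta> * X + 2 * Gi\<^sup>2 * Dm\<^sup>2 + 4 * Gi\<^sup>2 * Nn + 4 * Gi\<^sup>2 * pm * Pn
     = const_coeff G0 Gi \<eta> R Dm Gg d + variance_coeff G0 Gi \<eta> * Nn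
      + perturbation_coeff G0 Gi \<eta> R pm * Pn - descent_coeff G0 Gi \<eta> * (2 * \<eta>) * V"
  proof -
    have "c * (P - 2 * \<eta> * V + Q * Pn + e * (q * (H + 6 * Gi * (K + 2 * (2 * Nn + 2 * pm * Pn))))) + U + w * Nn + w * pm * Pn
      = (c * (P + e * (q * (H + 6 * Gi * K))) + U) + (c * (e * (q * (24 * Gi))) + w) * Nn
        + (c * (Q + e * (q * (24 * Gi * pm))) + w * pm) * Pn - c * (2 * \<eta>) * V" for c P Q e H K U w q :: real
      by (simp add: algebra_simps)
    then show ?thesis
      unfolding const_coeff_def variance_coeff_def perturbation_coeff_def X_def .
  qed
  finally show ?thesis
    unfolding d_def Nn_def Pn_def V_def noise_def wt_def .
qed

lemma coeffs_nonneg: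
  assumes "0 < G0" "0 < Gi" "0 < \<eta>"
  shows "0 \<le> variance_coeff G0 Gi \<eta>"
    and "0 \<le> R \<Longrightarrow> 0 \<le> pm \<Longrightarrow> 0 \<le> perturbation_coeff G0 Gi \<eta> R pm"
  using assms by (simp_all add: variance_coeff_def perturbation_coeff_def descent_coeff_def)

section \<open>Node averages and sample paths\<close>

lemma node_avg_nth: "node_avg n Y $ s = node_avg n (\<lambda>i. Y i $ s)"
  by (simp add: node_avg_def)

lemma node_avg_bounds:
  fixes u :: "nat \<Rightarrow> real"
  assumes "1 \<le> n"
  shows "(\<And>i. i < n \<Longrightarrow> a \<le> u i) \<Longrightarrow> a \<le> node_avg n u"
    and "(\<And>i. i < n \<Longrightarrow> u i \<le> b) \<Longrightarrow> node_avg n u \<le> b"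
proof -
  assume "\<And>i. i < n \<Longrightarrow> a \<le> u i"
  then have "(\<Sum>i<n. a) \<le> (\<Sum>i<n. u i)" by (intro sum_mono) simp
  then show "a \<le> node_avg n u" using assms by (simp add: node_avg_def field_simps)
next
  assume "\<And>i. i < n \<Longrightarrow> u i \<le> b"
  then have "(\<Sum>i<n. u i) \<le> (\<Sum>i<n. b)" by (intro sum_mono) simp
  then show "node_avg n u \<le> b" using assms by (simp add: node_avg_def field_simps)
qed

lemma node_avg_mono:
  fixes u v :: "nat \<Rightarrow> real"
  shows "(\<And>i. i < n \<Longrightarrow> u i \<le> v i) \<Longrightarrow> node_avg n u \<le> node_avg n v"
  unfolding node_avg_def real_scaleR_def by (intro mult_left_mono sum_mono) auto

lemma node_avg_cong: "(\<And>i. i < n \<Longrightarrow> u i = v i) \<Longrightarrow> node_avg n u = node_avg n v"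
  by (simp add: node_avg_def)

lemma abs_node_avg: "\<bar>node_avg n u\<bar> \<le> node_avg n (\<lambda>i. \<bar>u i\<bar>)" for u :: "nat \<Rightarrow> real"
  unfolding node_avg_def by (simp add: divide_right_mono sum_abs)

lemma norm_node_avg: "1 \<le> n \<Longrightarrow> (\<And>i. i < n \<Longrightarrow> norm (Y i) \<le> b) \<Longrightarrow> norm (node_avg n Y) \<le> b"
  for Y :: "nat \<Rightarrow> 'v::real_normed_vector"
proof -
  assume n: "1 \<le> n" and b: "\<And>i. i < n \<Longrightarrow> norm (Y i) \<le> b"
  have "norm (node_avg n Y) \<le> node_avg n (\<lambda>i. norm (Y i))"
    unfolding node_avg_def by (simp add: divide_right_mono norm_sum)
  also have "\<dots> \<le> b" using node_avg_bounds(2)[OF n b] .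
  finally show ?thesis .
qed

lemma node_avg_linear:
  "node_avg n (\<lambda>i. Y i + Z i) = node_avg n Y + node_avg n Z"
  "node_avg n (\<lambda>i. Y i - Z i) = node_avg n Y - node_avg n Z"
  "node_avg n (\<lambda>i. c *\<^sub>R Y i) = c *\<^sub>R node_avg n Y"
proof -
  show "node_avg n (\<lambda>i. Y i + Z i) = node_avg n Y + node_avg n Z"
    by (simp add: node_avg_def sum.distrib scaleR_add_right)
  show "node_avg n (\<lambda>i. Y i - Z i) = node_avg n Y - node_avg n Z"
    by (simp add: node_avg_def sum_subtractf scaleR_diff_right)
  show "node_avg n (\<lambda>i. c *\<^sub>R Y i) = c *\<^sub>R node_avg n Y"
    unfolding node_avg_def scaleR_sum_right by (simp add: mult.commute)
qed

lemma node_avg_const: "1 \<le> n \<Longrightarrow> node_avg n (\<lambda>_. c) = c"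
  by (simp add: node_avg_def sum_constant_scaleR)

text \<open>Bounding by the sum of absolute values gives the factor d in place of its square root;
  this affects constants only.\<close>

lemma norm_le_card_bound:
  fixes v :: "real ^ 'd"
  assumes "\<And>s. \<bar>v $ s\<bar> \<le> b"
  shows "norm v \<le> real CARD('d) * b"
proof -
  have "norm v \<le> (\<Sum>s\<in>UNIV. \<bar>v $ s\<bar>)" by (rule norm_le_l1_cart)
  also have "\<dots> \<le> (\<Sum>s\<in>(UNIV :: 'd set). b)" by (intro sum_mono assms)
  finally show ?thesis by simp
qed

section \<open>Deviation of the nodes from their average\<close>

text \<open>The Euclidean norm over the nodes: it obeys the triangle inequality, and the spectral
  bound applies to it directly.\<close>

definition deviation :: "nat \<Rightarrow> (nat \<Rightarrow> 'v::real_normed_vector) \<Rightarrow> real" where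
  "deviation n Y = L2_set (\<lambda>i. norm (Y i - node_avg n Y)) {..<n}"

lemma deviation_nonneg: "0 \<le> deviation n Y"
  by (simp add: deviation_def)

lemma deviation_cong: "(\<And>i. i < n \<Longrightarrow> Y i = Z i) \<Longrightarrow> deviation n Y = deviation n Z"
  unfolding deviation_def using node_avg_cong[of n Y Z] by (auto intro!: L2_set_cong)

lemma deviation_diff_le: "deviation n (\<lambda>i. Y i - Z i) \<le> deviation n Y + deviation n Z"
proof -
  have "deviation n (\<lambda>i. Y i - Z i)
      \<le> L2_set (\<lambda>i. norm (Y i - node_avg n Y) + norm (Z i - node_avg n Z)) {..<n}"
    unfolding deviation_def node_avg_linear
  proof (rule L2_set_mono)
    fix i
    have "Y i - Z i - (node_avg n Y - node_avg n Z) = (Y i - node_avg n Y) - (Z i - node_avg n Z)" by simp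
    then show "norm (Y i - Z i - (node_avg n Y - node_avg n Z))
      \<le> norm (Y i - node_avg n Y) + norm (Z i - node_avg n Z)" by (metis norm_triangle_ineq4)
  qed simp
  also have "\<dots> \<le> deviation n Y + deviation n Z"
    unfolding deviation_def by (rule L2_set_triangle_ineq)
  finally show ?thesis .
qed

lemma deviation_bound:
  assumes "1 \<le> n" "\<And>i. i < n \<Longrightarrow> norm (Y i) \<le> b"
  shows "deviation n Y \<le> sqrt (real n) * (2 * b)"
proof -
  have b: "0 \<le> b" using order_trans[OF norm_ge_zero assms(2)[of 0]] assms(1) by simp
  have "norm (node_avg n Y) \<le> b" using assms by (rule norm_node_avg)
  then have "norm (Y i - node_avg n Y) \<le> 2 * b" if "i < n" for i
    using assms(2)[OF that] norm_triangle_ineq4[of "Y i" "node_avg n Y"] by linarith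
  then have "deviation n Y \<le> L2_set (\<lambda>_. 2 * b) {..<n}"
    unfolding deviation_def by (intro L2_set_mono) auto
  then show ?thesis using b by (simp add: L2_set_def real_sqrt_mult)
qed

text \<open>Cauchy-Schwarz against the constant 1. The division by the root of n cancels the same
  root in \<open>deviation_bound\<close>, which keeps the consensus error free of the number of
  nodes.\<close>

lemma node_avg_deviation_le:
  assumes "1 \<le> n"
  shows "node_avg n (\<lambda>i. norm (Y i - node_avg n Y)) \<le> deviation n Y / sqrt (real n)"
proof -
  have "(\<Sum>i<n. norm (Y i - node_avg n Y)) = (\<Sum>i<n. \<bar>norm (Y i - node_avg n Y)\<bar> * \<bar>1::real\<bar>)" by simp
  also have "\<dots> \<le> deviation n Y * L2_set (\<lambda>_. 1) {..<n}"
    unfolding deviation_def by (rule L2_set_mult_ineq)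
  also have "L2_set (\<lambda>_. 1::real) {..<n} = sqrt (real n)" by (simp add: L2_set_def)
  finally have "node_avg n (\<lambda>i. norm (Y i - node_avg n Y)) \<le> deviation n Y * sqrt (real n) / real n"
    unfolding node_avg_def using assms by (simp add: divide_right_mono)
  also have "\<dots> = deviation n Y / sqrt (real n)"
    using assms by (simp add: field_simps)
  finally show ?thesis .
qed

lemma mixing_rate_nonneg: "0 \<le> mixing_rate W" by (simp add: mixing_rate_def)

lemma deviation_mix_power:
  fixes W :: "real mat" and Y :: "nat \<Rightarrow> real ^ 'd"
  assumes W: "W \<in> carrier_mat n n" "transpose_mat W = W"
    and ds: "doubly_stochastic W" and rate: "mixing_rate W < 1" and n: "1 \<le> n"
  shows "deviation n (mix (W ^\<^sub>m t) Y) \<le> mixing_rate W ^ t * deviation n Y"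
proof (rule power2_le_imp_le)
  show "(deviation n (mix (W ^\<^sub>m t) Y))\<^sup>2 \<le> (mixing_rate W ^ t * deviation n Y)\<^sup>2"
    using mix_power_consensus[OF assms, of t Y]
    by (simp add: deviation_def power_mult_distrib L2_set_def sum_nonneg)
qed (simp add: mixing_rate_nonneg deviation_nonneg)

definition inv_sqrt :: "real ^ 'd \<Rightarrow> real ^ 'd" where
  "inv_sqrt v = (\<chi> s. (v $ s) powr (- 1 / 2))"

lemma inv_sqrt_antimono:
  assumes "0 < a" "a \<le> b" shows "b powr (- 1 / 2) \<le> a powr (- 1 / 2 :: real)"
  using assms by (intro powr_mono2') auto

lemma inv_sqrt_square: "0 < a \<Longrightarrow> (a\<^sup>2) powr (- 1 / 2) = 1 / (a :: real)"
  by (simp add: powr_powr powr_minus_divide flip: powr_numeral)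

section \<open>Bounds along a tame path\<close>

context dadam3
begin

abbreviation F where "F \<equiv> global_objective \<D> f M"
abbreviation gF where "gF \<equiv> signed_grad F"
abbreviation r where "r \<equiv> mixing_rate W ^ t"
abbreviation lam_rt where "lam_rt k i \<omega> \<equiv> inv_sqrt (lam T k i \<omega>)"

text \<open>The gradient bounds hold only almost surely; \<open>tame\<close> is the almost sure event on which the
  trace is analysed path by path.\<close>

definition tame :: "'w \<Rightarrow> bool" where
  "tame \<omega> \<longleftrightarrow> \<omega> \<in> space P
    \<and> (\<forall>k\<in>{1..N}. \<forall>i<M. \<forall>s. \<bar>ghat T k i \<omega> $ s\<bar> \<le> G_inf)
    \<and> (\<forall>k\<in>{1..N}. \<forall>i<M. norm (zpt T k i \<omega>) \<le> diam / 2)"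

definition d :: real where "d = real CARD('p1 + 'p2)"

lemma d_pos: "0 < d" unfolding d_def of_nat_0_less_iff by (rule zero_less_card_finite)

definition dir_max :: real where "dir_max = d * (G_inf / G\<^sub>0)"

lemma G_inf_nonneg: "0 \<le> G_inf"
proof -
  interpret D: prob_space \<D> by (rule prob_D)
  have "AE s in \<D>. 0 \<le> G_inf"
    using bounded_grad[of 0] by eventually_elim (meson infnorm_pos_le order_trans)
  then show ?thesis by simp
qed

lemma component_le_infnorm: "\<bar>v $ s\<bar> \<le> infnorm v" for v :: "real ^ 'e"
  using component_le_infnorm_cart by blast

lemma v0_bounds: "i < M \<Longrightarrow> G\<^sub>0\<^sup>2 \<le> v0 i $ s" "i < M \<Longrightarrow> v0 i $ s \<le> G_inf\<^sup>2"
  using v0_lower v0_upper[of i] component_le_infnorm[of "v0 i" s] by auto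

lemma G0_le_G_inf: "G\<^sub>0 \<le> G_inf"
proof (rule power2_le_imp_le[OF _ G_inf_nonneg])
  have "0 < M" using M_pos by simp
  then show "G\<^sub>0\<^sup>2 \<le> G_inf\<^sup>2" using v0_bounds[of 0 undefined] by simp
qed

lemma G_inf_pos: "0 < G_inf" using G0_pos G0_le_G_inf by simp

lemma dir_max_nonneg: "0 \<le> dir_max" using d_pos G_inf_pos G0_pos by (simp add: dir_max_def)

lemma r_nonneg: "0 \<le> r" by (simp add: mixing_rate_nonneg)

lemma step_size: "L\<^sup>2 * \<eta>\<^sup>2 \<le> G\<^sub>0 ^ 3 / (72 * G_inf)"
proof (cases "L = 0")
  case True
  then show ?thesis using G0_pos G_inf_pos by simp
next
  case False
  then have "\<eta> \<le> sqrt (G\<^sub>0 ^ 3 / (72 * L\<^sup>2 * G_inf))" using eta_bound by blast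
  then have "\<eta>\<^sup>2 \<le> (sqrt (G\<^sub>0 ^ 3 / (72 * L\<^sup>2 * G_inf)))\<^sup>2" using eta_pos by (intro power_mono) auto
  also have "\<dots> = G\<^sub>0 ^ 3 / (72 * L\<^sup>2 * G_inf)" using G0_pos G_inf_pos by simp
  finally have "L\<^sup>2 * \<eta>\<^sup>2 \<le> L\<^sup>2 * (G\<^sub>0 ^ 3 / (72 * L\<^sup>2 * G_inf))" by (intro mult_left_mono) auto
  also have "\<dots> = G\<^sub>0 ^ 3 / (72 * G_inf)" using False by simp
  finally show ?thesis .
qed

lemma init': "i < M \<Longrightarrow> \<omega> \<in> space P \<Longrightarrow> xpt T 0 i \<omega> = 0" "i < M \<Longrightarrow> \<omega> \<in> space P \<Longrightarrow> zpt T 0 i \<omega> = 0"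
  "i < M \<Longrightarrow> \<omega> \<in> space P \<Longrightarrow> mom T 0 i \<omega> = 0" "i < M \<Longrightarrow> \<omega> \<in> space P \<Longrightarrow> sqr T 0 i \<omega> = 0"
  "i < M \<Longrightarrow> \<omega> \<in> space P \<Longrightarrow> dir T 0 i \<omega> = 0" "i < M \<Longrightarrow> \<omega> \<in> space P \<Longrightarrow> lam T 0 i \<omega> = v0 i"
  using init by auto

definition beta1 :: "nat \<Rightarrow> real" where "beta1 k = \<beta>\<^sub>1\<^sub>1 * decay ^ (k - 1)"

lemma beta1_bounds: "0 \<le> beta1 k" "beta1 k \<le> 1"
proof -
  show "0 \<le> beta1 k" using betas decay by (simp add: beta1_def)
  have "decay ^ (k - 1) \<le> 1" using decay by (intro power_le_one) auto
  then show "beta1 k \<le> 1" unfolding beta1_def using betas decay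
    by (intro mult_le_one) auto
qed

lemma sum_beta1: "(\<Sum>k\<in>{1..N}. beta1 k) \<le> 1 / (1 - decay)"
proof -
  have "(\<Sum>k\<in>{1..N}. beta1 k) \<le> (\<Sum>k\<in>{1..N}. decay ^ (k - 1))"
    unfolding beta1_def using betas decay by (intro sum_mono mult_left_le_one_le) auto
  also have "\<dots> = (\<Sum>k<N. decay ^ k)"
    by (rule sum.reindex_bij_witness[of _ Suc "\<lambda>k. k - 1"]) auto
  also have "\<dots> \<le> 1 / (1 - decay)" using decay by (simp add: sum_gp_strict divide_right_mono)
  finally show ?thesis .
qed

lemma convex_bound:
  fixes a b c :: real
  assumes "0 \<le> \<beta>" "\<beta> \<le> 1" "\<bar>a\<bar> \<le> c" "\<bar>b\<bar> \<le> c"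
  shows "\<bar>\<beta> * a + (1 - \<beta>) * b\<bar> \<le> c"
proof -
  have "\<bar>\<beta> * a + (1 - \<beta>) * b\<bar> \<le> \<beta> * \<bar>a\<bar> + (1 - \<beta>) * \<bar>b\<bar>"
    using assms abs_triangle_ineq[of "\<beta> * a" "(1 - \<beta>) * b"] by (simp add: abs_mult)
  also have "\<dots> \<le> \<beta> * c + (1 - \<beta>) * c" using assms by (intro add_mono mult_left_mono) auto
  finally show ?thesis by (simp add: algebra_simps)
qed

context
  fixes \<omega> assumes tame: "tame \<omega>"
begin

lemma \<omega>_space: "\<omega> \<in> space P" using tame by (simp add: tame_def)

lemma ghat_bound: "k \<in> {1..N} \<Longrightarrow> i < M \<Longrightarrow> \<bar>ghat T k i \<omega> $ s\<bar> \<le> G_inf"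
  using tame by (simp add: tame_def)

lemma mom_bound: "k \<le> N \<Longrightarrow> i < M \<Longrightarrow> \<bar>mom T k i \<omega> $ s\<bar> \<le> G_inf"
proof (induct k)
  case 0
  then show ?case using init' \<omega>_space G_inf_nonneg by simp
next
  case (Suc k)
  then have k: "Suc k \<in> {1..N}" by auto
  show ?case
    unfolding mom_step[OF k Suc.prems(2) \<omega>_space] beta1_def[symmetric]
    using convex_bound[OF beta1_bounds[of "Suc k"] _ ghat_bound[OF k Suc.prems(2), of s]] Suc by simp
qed

lemma sqr_bound: "k \<le> N \<Longrightarrow> i < M \<Longrightarrow> \<bar>sqr T k i \<omega> $ s\<bar> \<le> G_inf\<^sup>2"
proof (induct k)
  case 0
  then show ?case using init' \<omega>_space by simp
next
  case (Suc k)
  then have k: "Suc k \<in> {1..N}" by auto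
  have "\<bar>ghat T (Suc k) i \<omega> $ s * ghat T (Suc k) i \<omega> $ s\<bar> \<le> G_inf\<^sup>2"
    unfolding power2_eq_square abs_mult using ghat_bound[OF k Suc.prems(2), of s]
    by (intro mult_mono) auto
  then show ?case
    unfolding sqr_step[OF k Suc.prems(2) \<omega>_space]
    using convex_bound[of \<beta>\<^sub>2] betas Suc by simp
qed

text \<open>A convex combination of the old value and something at least as large cannot decrease,
  so the lower bound on \<open>v0\<close> persists. The upper bound is inherited from the squared
  gradients by convexity.\<close>

lemma lam_bounds:
  "k \<le> N \<Longrightarrow> i < M \<Longrightarrow> G\<^sub>0\<^sup>2 \<le> lam T k i \<omega> $ s"
  "k \<le> N \<Longrightarrow> i < M \<Longrightarrow> lam T k i \<omega> $ s \<le> G_inf\<^sup>2"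
  and lam_increasing: "k \<in> {1..N} \<Longrightarrow> i < M \<Longrightarrow> lam T (k - 1) i \<omega> $ s \<le> lam T k i \<omega> $ s"
proof -
  show inc: "lam T (k - 1) i \<omega> $ s \<le> lam T k i \<omega> $ s" if "k \<in> {1..N}" "i < M" for k i s
  proof -
    have "lam T k i \<omega> $ s = \<beta>\<^sub>3 * lam T (k - 1) i \<omega> $ s
        + (1 - \<beta>\<^sub>3) * max (lam T (k - 1) i \<omega> $ s) (sqr T k i \<omega> $ s)"
      using lam_step[OF that \<omega>_space] by simp
    moreover have "(1 - \<beta>\<^sub>3) * lam T (k - 1) i \<omega> $ s
        \<le> (1 - \<beta>\<^sub>3) * max (lam T (k - 1) i \<omega> $ s) (sqr T k i \<omega> $ s)"
      using betas by (intro mult_left_mono) auto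
    ultimately show ?thesis by (simp add: algebra_simps)
  qed
  show lower: "G\<^sub>0\<^sup>2 \<le> lam T k i \<omega> $ s" if "k \<le> N" "i < M" for k i s
    using that
  proof (induct k)
    case 0
    then show ?case using init' \<omega>_space v0_bounds by simp
  next
    case (Suc k)
    then show ?case using inc[of "Suc k" i s] by simp
  qed
  show "lam T k i \<omega> $ s \<le> G_inf\<^sup>2" if "k \<le> N" "i < M"
    using that
  proof (induct k)
    case 0
    then show ?case using init' \<omega>_space v0_bounds by simp
  next
    case (Suc k)
    then have k: "Suc k \<in> {1..N}" by auto
    have "0 \<le> G\<^sub>0\<^sup>2" by simp
    also have "\<dots> \<le> lam T k i \<omega> $ s" using Suc lower[of k i s] by simp
    finally have "\<bar>lam T k i \<omega> $ s\<bar> \<le> G_inf\<^sup>2" using Suc by simp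
    moreover have "\<bar>max (lam T k i \<omega> $ s) (sqr T (Suc k) i \<omega> $ s)\<bar> \<le> G_inf\<^sup>2"
      using sqr_bound[OF Suc.prems, of s] calculation by (simp add: max_def)
    ultimately have "\<bar>lam T (Suc k) i \<omega> $ s\<bar> \<le> G_inf\<^sup>2"
      unfolding lam_step[OF k Suc.prems(2) \<omega>_space]
      using convex_bound[of \<beta>\<^sub>3] betas by simp
    then show ?case by simp
  qed
qed

lemma lam_rt_bounds:
  assumes "k \<le> N" "i < M"
  shows "1 / G_inf \<le> lam_rt k i \<omega> $ s" "lam_rt k i \<omega> $ s \<le> 1 / G\<^sub>0" "0 < lam_rt k i \<omega> $ s"
proof -
  have pos: "0 < lam T k i \<omega> $ s"
    using lam_bounds(1)[OF assms, of s] G0_pos by (meson less_le_trans zero_less_power)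
  show "lam_rt k i \<omega> $ s \<le> 1 / G\<^sub>0"
    using inv_sqrt_antimono[OF _ lam_bounds(1)[OF assms, of s]] G0_pos
    by (simp only: inv_sqrt_def vec_lambda_beta inv_sqrt_square zero_less_power)
  show le: "1 / G_inf \<le> lam_rt k i \<omega> $ s"
    using inv_sqrt_antimono[OF pos lam_bounds(2)[OF assms, of s]] G_inf_pos
    by (simp only: inv_sqrt_def vec_lambda_beta inv_sqrt_square)
  have "0 < 1 / G_inf" using G_inf_pos by simp
  then show "0 < lam_rt k i \<omega> $ s" using le by linarith
qed

lemma lam_rt_decreasing:
  assumes "k \<in> {1..N}" "i < M"
  shows "lam_rt k i \<omega> $ s \<le> lam_rt (k - 1) i \<omega> $ s"
proof -
  have "k - 1 \<le> N" using assms by auto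
  then have "0 < lam T (k - 1) i \<omega> $ s"
    using lam_bounds(1)[of "k - 1" i s] assms G0_pos by (meson less_le_trans zero_less_power)
  then show ?thesis
    using inv_sqrt_antimono lam_increasing[OF assms] by (simp add: inv_sqrt_def)
qed

lemma dir_eq: "k \<in> {1..N} \<Longrightarrow> i < M \<Longrightarrow> dir T k i \<omega> $ s = lam_rt k i \<omega> $ s * mom T k i \<omega> $ s"
  using dir_step \<omega>_space by (simp add: inv_sqrt_def)

lemma dir_bound:
  assumes "k \<le> N" "i < M" shows "norm (dir T k i \<omega>) \<le> dir_max"
  unfolding d_def dir_max_def
proof (rule norm_le_card_bound)
  fix s
  show "\<bar>dir T k i \<omega> $ s\<bar> \<le> G_inf / G\<^sub>0"
  proof (cases "k = 0")
    case True
    then show ?thesis using init' \<omega>_space assms G_inf_nonneg G0_pos by simp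
  next
    case False
    then have k: "k \<in> {1..N}" using assms by auto
    have "\<bar>lam_rt k i \<omega> $ s\<bar> * \<bar>mom T k i \<omega> $ s\<bar> \<le> 1 / G\<^sub>0 * G_inf"
      using lam_rt_bounds[OF assms, of s] mom_bound[OF assms, of s] G0_pos by (intro mult_mono) auto
    then show ?thesis by (simp add: dir_eq[OF k assms(2)] abs_mult)
  qed
qed

definition xb where "xb k = node_avg M (\<lambda>i. xpt T k i \<omega>)"
definition Db where "Db k = node_avg M (\<lambda>i. dir T k i \<omega>)"

lemma zbar_eq: "zbar M T k \<omega> = node_avg M (\<lambda>i. zpt T k i \<omega>)"
  by (simp add: zbar_def node_avg_def)

lemmas consensus = mix_power_consensus(1)[OF W_dim W_symmetric W_doubly_stochastic W_rate M_pos]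
lemmas contraction = deviation_mix_power[OF W_dim W_symmetric W_doubly_stochastic W_rate M_pos]

lemma zb_step: "k \<in> {1..N} \<Longrightarrow> zbar M T k \<omega> = xb (k - 1) - \<eta> *\<^sub>R Db (k - 1)"
proof -
  assume k: "k \<in> {1..N}"
  have "zbar M T k \<omega> = node_avg M (mix (W ^\<^sub>m t) (\<lambda>j. xpt T (k - 1) j \<omega> - \<eta> *\<^sub>R dir T (k - 1) j \<omega>))"
    unfolding zbar_eq by (rule node_avg_cong) (rule z_step[OF k _ \<omega>_space])
  then show ?thesis unfolding consensus node_avg_linear xb_def Db_def .
qed

lemma xb_step: "k \<in> {1..N} \<Longrightarrow> xb k = xb (k - 1) - \<eta> *\<^sub>R Db k"
proof -
  assume k: "k \<in> {1..N}"
  have "xb k = node_avg M (mix (W ^\<^sub>m t) (\<lambda>j. xpt T (k - 1) j \<omega> - \<eta> *\<^sub>R dir T k j \<omega>))"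
    unfolding xb_def by (rule node_avg_cong) (rule x_step[OF k _ \<omega>_space])
  then show ?thesis unfolding consensus node_avg_linear xb_def Db_def .
qed

lemma deviation_update:
  assumes "k \<le> N" "deviation M (\<lambda>i. xpt T k' i \<omega>) \<le> e"
  shows "deviation M (mix (W ^\<^sub>m t) (\<lambda>j. xpt T k' j \<omega> - \<eta> *\<^sub>R dir T k j \<omega>))
    \<le> r * (e + sqrt (real M) * (2 * (\<eta> * dir_max)))"
proof -
  have "deviation M (\<lambda>i. \<eta> *\<^sub>R dir T k i \<omega>) \<le> sqrt (real M) * (2 * (\<eta> * dir_max))"
    using dir_bound[OF assms(1)] eta_pos by (intro deviation_bound M_pos) (simp add: mult_left_mono)
  then have "deviation M (\<lambda>j. xpt T k' j \<omega> - \<eta> *\<^sub>R dir T k j \<omega>)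
      \<le> e + sqrt (real M) * (2 * (\<eta> * dir_max))"
    using deviation_diff_le[of M "\<lambda>j. xpt T k' j \<omega>" "\<lambda>j. \<eta> *\<^sub>R dir T k j \<omega>"] assms(2) by linarith
  then show ?thesis
    by (intro order_trans[OF contraction] mult_left_mono r_nonneg)
qed

text \<open>One step maps a deviation bound e to r (e + b), where b stands for \<open>?b\<close>.
  For \<open>r\<close> \<le> 1/2 the value 2 r b is preserved, because r (2 r b + b) \<le> 2 r b,
  and the nodes start in consensus.\<close>

lemma deviation_x:
  assumes r: "r \<le> 1 / 2"
  shows "k \<le> N \<Longrightarrow> deviation M (\<lambda>i. xpt T k i \<omega>) \<le> r * (sqrt (real M) * (4 * (\<eta> * dir_max)))"
proof (induct k)
  let ?b = "sqrt (real M) * (2 * (\<eta> * dir_max))"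
  have b: "0 \<le> ?b" using eta_pos dir_max_nonneg by simp
  have rb: "2 * r * ?b \<le> ?b" using mult_right_mono[of "2 * r" 1 ?b] r b by simp
  {
    case 0
    have "deviation M (\<lambda>i. xpt T 0 i \<omega>) = deviation M (\<lambda>i. 0 :: real ^ ('p1 + 'p2))"
      by (rule deviation_cong) (use init' \<omega>_space in simp)
    also have "\<dots> = 0" by (simp add: deviation_def node_avg_const M_pos L2_set_def)
    finally show ?case using b r_nonneg by (simp del: zero_le_power)
  next
    case (Suc k)
    then have k: "Suc k \<in> {1..N}" by auto
    have "deviation M (\<lambda>i. xpt T (Suc k) i \<omega>)
      = deviation M (mix (W ^\<^sub>m t) (\<lambda>j. xpt T k j \<omega> - \<eta> *\<^sub>R dir T (Suc k) j \<omega>))"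
      by (rule deviation_cong) (use x_step[OF k _ \<omega>_space] in simp)
    also have "\<dots> \<le> r * (r * (sqrt (real M) * (4 * (\<eta> * dir_max))) + ?b)"
      using Suc by (intro deviation_update) auto
    also have "\<dots> = r * (2 * r * ?b + ?b)" by (simp add: algebra_simps)
    also have "\<dots> \<le> r * (?b + ?b)"
      by (intro mult_left_mono add_right_mono rb r_nonneg)
    finally show ?case by (simp add: algebra_simps)
  }
qed

lemma consensus_error:
  assumes r: "r \<le> 1 / 2" and k: "k \<in> {1..N}"
  shows "node_avg M (\<lambda>i. norm (zpt T k i \<omega> - zbar M T k \<omega>)) \<le> r * (4 * (\<eta> * dir_max))"
proof -
  let ?b = "sqrt (real M) * (2 * (\<eta> * dir_max))"
  have b: "0 \<le> ?b" using eta_pos dir_max_nonneg by simp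
  have rb: "2 * r * ?b \<le> ?b" using mult_right_mono[of "2 * r" 1 ?b] r b by simp
  have "deviation M (\<lambda>i. zpt T k i \<omega>)
      = deviation M (mix (W ^\<^sub>m t) (\<lambda>j. xpt T (k - 1) j \<omega> - \<eta> *\<^sub>R dir T (k - 1) j \<omega>))"
    by (rule deviation_cong) (use z_step[OF k _ \<omega>_space] in simp)
  also have "\<dots> \<le> r * (r * (sqrt (real M) * (4 * (\<eta> * dir_max))) + ?b)"
    using k by (intro deviation_update deviation_x[OF r]) auto
  also have "\<dots> = r * (2 * r * ?b + ?b)" by (simp add: algebra_simps)
  also have "\<dots> \<le> r * (?b + ?b)"
    by (intro mult_left_mono add_right_mono rb r_nonneg)
  also have "\<dots> = sqrt (real M) * (r * (4 * (\<eta> * dir_max)))" by (simp add: algebra_simps)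
  finally have "deviation M (\<lambda>i. zpt T k i \<omega>) / sqrt (real M) \<le> r * (4 * (\<eta> * dir_max))"
    using M_pos by (simp add: divide_le_eq mult.commute)
  then show ?thesis
    using node_avg_deviation_le[OF M_pos, of "\<lambda>i. zpt T k i \<omega>"] unfolding zbar_eq by linarith
qed

end

end

lemma node_avg_scale: "node_avg n (\<lambda>i. c * u i) = c * node_avg n u" for c :: real
  using node_avg_linear(3)[of n c u] by simp

section \<open>Splitting the averaged direction into gradient, noise and perturbation\<close>

context dadam3
begin

definition scale_avg :: "nat \<Rightarrow> 'w \<Rightarrow> real ^ ('p1 + 'p2)" where
  "scale_avg k \<omega> = node_avg M (\<lambda>i. lam_rt k i \<omega>)"

text \<open>Each node is compared with the true gradient at its own point, where its samples are
  unbiased, and uses its scaling of step k - 1, which is fixed before they are drawn.\<close>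

definition grad_noise :: "nat \<Rightarrow> 'w \<Rightarrow> real ^ ('p1 + 'p2)" where
  "grad_noise k \<omega> = node_avg M (\<lambda>i. \<chi> s. lam_rt (k - 1) i \<omega> $ s * (ghat T k i \<omega> - gF (zpt T k i \<omega>)) $ s)"

text \<open>Two sources: the telescoped total change of the scaling and the geometric sum of the
  momentum weights.\<close>

definition momentum_const :: real where
  "momentum_const = d * (G_inf / G\<^sub>0) + d * (2 * G_inf / G\<^sub>0) * (1 / (1 - decay))"

definition consensus_const :: real where
  "consensus_const = d * (L / G\<^sub>0) * (4 * (\<eta> * dir_max))"

lemma consensus_const_nonneg: "0 \<le> consensus_const"
  using d_pos L_nonneg G0_pos eta_pos dir_max_nonneg by (simp add: consensus_const_def)

definition pert_max :: real where
  "pert_max = d * (G_inf / G\<^sub>0 + 2 * G_inf / G\<^sub>0 + L / G\<^sub>0 * diam)"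

text \<open>The almost sure bound on sampled gradients passes to their mean, which leaves no
  exceptional set for the true gradient.\<close>

lemma gF_component_bound: "\<bar>gF y $ s\<bar> \<le> G_inf"
proof -
  interpret D: prob_space \<D> by (rule prob_D)
  let ?h = "\<lambda>x. signed_grad (\<lambda>y. f y x) y"
  have int: "integrable \<D> (\<lambda>x. ?h x $ s)"
    using integrable_bounded_linear[OF bounded_linear_vec_nth unbiased(1)] .
  have "gF y $ s = (LINT x|\<D>. ?h x $ s)"
    unfolding unbiased(2)[symmetric]
    using integral_bounded_linear[OF bounded_linear_vec_nth unbiased(1)] by simp
  moreover have ae: "AE x in \<D>. \<bar>?h x $ s\<bar> \<le> G_inf"
    using bounded_grad[of y] by eventually_elim (rule order_trans[OF component_le_infnorm])
  have "(LINT x|\<D>. ?h x $ s) \<le> G_inf"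
    by (rule D.integral_le_const[OF int]) (use ae in eventually_elim, simp)
  moreover have "- G_inf \<le> (LINT x|\<D>. ?h x $ s)"
    by (rule D.integral_ge_const[OF int]) (use ae in eventually_elim, simp)
  ultimately show ?thesis by simp
qed

lemma gF_bound: "norm (gF y) \<le> d * G_inf"
  unfolding d_def by (rule norm_le_card_bound) (rule gF_component_bound)

lemma diam_nonneg: "0 \<le> diam"
  using order_trans[OF norm_ge_zero xs_bounded] by simp

context
  fixes \<omega> assumes tame: "tame \<omega>"
begin

abbreviation z where "z k i \<equiv> zpt T k i \<omega>"
abbreviation zb where "zb k \<equiv> zbar M T k \<omega>"
abbreviation spread where "spread k \<equiv> node_avg M (\<lambda>i. norm (z k i - zb k))"
abbreviation decrease where "decrease k \<equiv> (\<Sum>s\<in>UNIV. scale_avg (k - 1) \<omega> $ s - scale_avg k \<omega> $ s)"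

lemma z_norm: "k \<in> {1..N} \<Longrightarrow> i < M \<Longrightarrow> norm (z k i) \<le> diam / 2"
  using tame by (simp add: tame_def)

lemma zb_norm: "k \<in> {1..N} \<Longrightarrow> norm (zb k) \<le> diam / 2"
  unfolding zbar_eq[OF tame] by (intro norm_node_avg[OF M_pos] z_norm)

lemma zb_xs: "k \<in> {1..N} \<Longrightarrow> norm (zb k - xs) \<le> diam"
  using zb_norm[of k] xs_bounded norm_triangle_ineq4[of "zb k" xs] by linarith

lemma scale_avg_nth: "scale_avg k \<omega> $ s = node_avg M (\<lambda>i. lam_rt k i \<omega> $ s)"
  by (simp add: scale_avg_def node_avg_nth)

lemma scale_avg_bounds:
  assumes "k \<le> N"
  shows "1 / G_inf \<le> scale_avg k \<omega> $ s" "scale_avg k \<omega> $ s \<le> 1 / G\<^sub>0"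
  unfolding scale_avg_nth
  by (intro node_avg_bounds[OF M_pos] lam_rt_bounds[OF tame assms]; assumption)+

lemma scale_avg_decreasing:
  assumes "k \<in> {1..N}" shows "scale_avg k \<omega> $ s \<le> scale_avg (k - 1) \<omega> $ s"
  unfolding scale_avg_nth by (intro node_avg_mono lam_rt_decreasing[OF tame assms])

text \<open>The remainder by definition, so that the equation of the averaged direction is immediate
  and all work lies in the bound.\<close>

definition pert where
  "pert k = Db \<omega> k - (\<chi> s. scale_avg (k - 1) \<omega> $ s * gF (zb k) $ s) - grad_noise k \<omega>"

lemma pert_nth:
  assumes k: "k \<in> {1..N}"
  shows "\<bar>pert k $ s\<bar> \<le> G_inf * (scale_avg (k - 1) \<omega> $ s - scale_avg k \<omega> $ s)
    + 2 * G_inf / G\<^sub>0 * beta1 k + L / G\<^sub>0 * spread k"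
proof -
  have k1: "k - 1 \<le> N" and kN: "k \<le> N" using k by auto
  let ?rt = "\<lambda>k i. lam_rt k i \<omega> $ s"
  let ?u = "\<lambda>i. (?rt k i - ?rt (k - 1) i) * mom T k i \<omega> $ s
      + ?rt (k - 1) i * (beta1 k * (mom T (k - 1) i \<omega> $ s - ghat T k i \<omega> $ s))
      + ?rt (k - 1) i * (gF (z k i) $ s - gF (zb k) $ s)"
  have "pert k $ s = node_avg M (\<lambda>i. dir T k i \<omega> $ s) - node_avg M (\<lambda>i. ?rt (k - 1) i * gF (zb k) $ s)
      - node_avg M (\<lambda>i. ?rt (k - 1) i * (ghat T k i \<omega> $ s - gF (z k i) $ s))"
    by (simp add: pert_def Db_def[OF tame] grad_noise_def node_avg_nth scale_avg_nth
        node_avg_scale[symmetric] mult.commute)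
  also have "\<dots> = node_avg M ?u"
    unfolding node_avg_linear[symmetric]
  proof (rule node_avg_cong)
    fix i assume i: "i < M"
    have "mom T k i \<omega> $ s = ghat T k i \<omega> $ s + beta1 k * (mom T (k - 1) i \<omega> $ s - ghat T k i \<omega> $ s)"
      unfolding mom_step[OF k i \<omega>_space[OF tame]] beta1_def by (simp add: algebra_simps)
    then have "?rt (k - 1) i * (mom T k i \<omega> $ s)
      = ?rt (k - 1) i * (ghat T k i \<omega> $ s + beta1 k * (mom T (k - 1) i \<omega> $ s - ghat T k i \<omega> $ s))" by simp
    then show "dir T k i \<omega> $ s - ?rt (k - 1) i * gF (zb k) $ s
        - ?rt (k - 1) i * (ghat T k i \<omega> $ s - gF (z k i) $ s) = ?u i"
      unfolding dir_eq[OF tame k i] by (simp add: distrib_left right_diff_distrib left_diff_distrib)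
  qed
  finally have "\<bar>pert k $ s\<bar> \<le> node_avg M (\<lambda>i. \<bar>?u i\<bar>)" by (simp only: abs_node_avg)
  also have "\<dots> \<le> node_avg M (\<lambda>i. G_inf * (?rt (k - 1) i - ?rt k i) + 2 * G_inf / G\<^sub>0 * beta1 k
      + L / G\<^sub>0 * norm (z k i - zb k))"
  proof (rule node_avg_mono)
    fix i assume i: "i < M"
    note rt = lam_rt_bounds[OF tame k1 i, of s] lam_rt_decreasing[OF tame k i, of s]
    have m1: "\<bar>(?rt k i - ?rt (k - 1) i) * mom T k i \<omega> $ s\<bar> \<le> (?rt (k - 1) i - ?rt k i) * G_inf"
      unfolding abs_mult using rt mom_bound[OF tame kN i, of s] by (intro mult_mono) auto
    have m2: "\<bar>?rt (k - 1) i * (beta1 k * (mom T (k - 1) i \<omega> $ s - ghat T k i \<omega> $ s))\<bar>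
        \<le> 1 / G\<^sub>0 * (beta1 k * (2 * G_inf))"
    proof -
      have "\<bar>mom T (k - 1) i \<omega> $ s - ghat T k i \<omega> $ s\<bar> \<le> 2 * G_inf"
        using mom_bound[OF tame k1 i, of s] ghat_bound[OF tame k i, of s] by linarith
      then show ?thesis unfolding abs_mult using rt beta1_bounds[of k] G0_pos G_inf_pos
        by (intro mult_mono) auto
    qed
    have m3: "\<bar>?rt (k - 1) i * (gF (z k i) $ s - gF (zb k) $ s)\<bar> \<le> 1 / G\<^sub>0 * (L * norm (z k i - zb k))"
    proof -
      have "\<bar>gF (z k i) $ s - gF (zb k) $ s\<bar> \<le> L * norm (z k i - zb k)"
        using component_le_norm_cart[of "gF (z k i) - gF (zb k)" s] lipschitz[of "z k i" "zb k"] by simp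
      then show ?thesis unfolding abs_mult using rt G0_pos by (intro mult_mono) auto
    qed
    have "\<bar>a + b + c\<bar> \<le> A + B + C" if "\<bar>a\<bar> \<le> A" "\<bar>b\<bar> \<le> B" "\<bar>c\<bar> \<le> C" for a b c A B C :: real
      using that by linarith
    from this[OF m1 m2 m3]
    show "\<bar>?u i\<bar> \<le> G_inf * (?rt (k - 1) i - ?rt k i) + 2 * G_inf / G\<^sub>0 * beta1 k
      + L / G\<^sub>0 * norm (z k i - zb k)"
    proof (rule order_trans)
      show "(?rt (k - 1) i - ?rt k i) * G_inf + 1 / G\<^sub>0 * (beta1 k * (2 * G_inf)) + 1 / G\<^sub>0 * (L * norm (z k i - zb k))
        \<le> G_inf * (?rt (k - 1) i - ?rt k i) + 2 * G_inf / G\<^sub>0 * beta1 k + L / G\<^sub>0 * norm (z k i - zb k)"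
        by (simp add: mult_ac)
    qed
  qed
  also have "\<dots> = G_inf * (scale_avg (k - 1) \<omega> $ s - scale_avg k \<omega> $ s)
    + 2 * G_inf / G\<^sub>0 * beta1 k + L / G\<^sub>0 * spread k"
    by (simp only: node_avg_linear node_avg_scale node_avg_const[OF M_pos] scale_avg_nth)
  finally show ?thesis .
qed

lemma pert_norm:
  assumes k: "k \<in> {1..N}"
  shows "norm (pert k) \<le> G_inf * decrease k
    + d * (2 * G_inf / G\<^sub>0) * beta1 k + d * (L / G\<^sub>0) * spread k"
proof -
  have "norm (pert k) \<le> (\<Sum>s\<in>UNIV. \<bar>pert k $ s\<bar>)" by (rule norm_le_l1_cart)
  also have "\<dots> \<le> (\<Sum>s\<in>UNIV. G_inf * (scale_avg (k - 1) \<omega> $ s - scale_avg k \<omega> $ s)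
    + 2 * G_inf / G\<^sub>0 * beta1 k + L / G\<^sub>0 * spread k)"
    by (intro sum_mono pert_nth[OF k])
  also have "\<dots> = G_inf * decrease k
    + d * (2 * G_inf / G\<^sub>0) * beta1 k + d * (L / G\<^sub>0) * spread k"
    unfolding sum.distrib sum_distrib_left[symmetric] sum_constant d_def by (simp add: mult_ac)
  finally show ?thesis .
qed

text \<open>A crude bound uniform in k, which serves to trade squares of perturbations for first
  powers.\<close>

lemma pert_max:
  assumes k: "k \<in> {1..N}" shows "norm (pert k) \<le> pert_max"
  unfolding pert_max_def d_def
proof (rule norm_le_card_bound)
  fix s
  have k1: "k - 1 \<le> N" and kN: "k \<le> N" using k by auto
  have "scale_avg (k - 1) \<omega> $ s - scale_avg k \<omega> $ s \<le> 1 / G\<^sub>0"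
  proof -
    have "0 < 1 / G_inf" using G_inf_pos by simp
    then show ?thesis using scale_avg_bounds(2)[OF k1, of s] scale_avg_bounds(1)[OF kN, of s] by linarith
  qed
  then have "G_inf * (scale_avg (k - 1) \<omega> $ s - scale_avg k \<omega> $ s) \<le> G_inf * (1 / G\<^sub>0)"
    using G_inf_nonneg by (rule mult_left_mono)
  moreover have "2 * G_inf / G\<^sub>0 * beta1 k \<le> 2 * G_inf / G\<^sub>0 * 1"
    using beta1_bounds G_inf_nonneg G0_pos by (intro mult_left_mono) auto
  moreover have "spread k \<le> diam"
  proof (rule node_avg_bounds(2)[OF M_pos])
    fix i assume "i < M"
    then show "norm (z k i - zb k) \<le> diam"
      using z_norm[OF k, of i] zb_norm[OF k] norm_triangle_ineq4[of "z k i" "zb k"] by linarith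
  qed
  then have "L / G\<^sub>0 * spread k \<le> L / G\<^sub>0 * diam"
    using L_nonneg G0_pos by (intro mult_left_mono) auto
  ultimately show "\<bar>pert k $ s\<bar> \<le> G_inf / G\<^sub>0 + 2 * G_inf / G\<^sub>0 + L / G\<^sub>0 * diam"
    using pert_nth[OF k, of s] by simp
qed

lemma sum_pert:
  assumes r: "r \<le> 1 / 2"
  shows "(\<Sum>k\<in>{1..N}. norm (pert k)) \<le> momentum_const + real N * (consensus_const * r)"
proof -
  have "(\<Sum>k\<in>{1..N}. norm (pert k))
    \<le> (\<Sum>k\<in>{1..N}. G_inf * decrease k
      + d * (2 * G_inf / G\<^sub>0) * beta1 k + consensus_const * r)"
  proof (rule sum_mono)
    fix k assume k: "k \<in> {1..N}"
    have "d * (L / G\<^sub>0) * spread k \<le> d * (L / G\<^sub>0) * (r * (4 * (\<eta> * dir_max)))"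
      using consensus_error[OF tame r k] d_pos L_nonneg G0_pos by (intro mult_left_mono) auto
    also have "\<dots> = consensus_const * r" by (simp add: consensus_const_def)
    finally show "norm (pert k) \<le> G_inf * decrease k
      + d * (2 * G_inf / G\<^sub>0) * beta1 k + consensus_const * r"
      using pert_norm[OF k] by linarith
  qed
  also have "\<dots> = G_inf * (\<Sum>k\<in>{1..N}. decrease k)
      + d * (2 * G_inf / G\<^sub>0) * (\<Sum>k\<in>{1..N}. beta1 k) + real N * (consensus_const * r)"
    unfolding sum.distrib sum_distrib_left[symmetric] sum_constant by simp
  also have "\<dots> \<le> G_inf * (d * (1 / G\<^sub>0)) + d * (2 * G_inf / G\<^sub>0) * (1 / (1 - decay)) + real N * (consensus_const * r)"
  proof (intro add_mono mult_left_mono sum_beta1 order_refl)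
    have "(\<Sum>k\<in>{1..N}. decrease k)
      = (\<Sum>s\<in>UNIV. \<Sum>k\<in>{1..N}. scale_avg (k - 1) \<omega> $ s - scale_avg k \<omega> $ s)" by (rule sum.swap)
    also have "\<dots> \<le> (\<Sum>s\<in>(UNIV :: ('p1 + 'p2) set). 1 / G\<^sub>0)"
    proof (rule sum_mono)
      fix s
      have "(\<Sum>k\<in>{1..N}. scale_avg (k - 1) \<omega> $ s - scale_avg k \<omega> $ s)
          = - (\<Sum>k\<in>{1..N}. scale_avg k \<omega> $ s - scale_avg (k - 1) \<omega> $ s)" by (simp add: sum_subtractf)
      also have "\<dots> = scale_avg 0 \<omega> $ s - scale_avg N \<omega> $ s"
        using sum_telescope''[of 0 N "\<lambda>k. scale_avg k \<omega> $ s"] by simp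
      also have "\<dots> \<le> 1 / G\<^sub>0"
      proof -
        have "0 < 1 / G_inf" using G_inf_pos by simp
        then show ?thesis using scale_avg_bounds(2)[of 0 s] scale_avg_bounds(1)[of N s] by linarith
      qed
      finally show "(\<Sum>k\<in>{1..N}. scale_avg (k - 1) \<omega> $ s - scale_avg k \<omega> $ s) \<le> 1 / G\<^sub>0" .
    qed
    finally show "(\<Sum>k\<in>{1..N}. decrease k) \<le> d * (1 / G\<^sub>0)"
      by (simp add: d_def)
  qed (use G_inf_nonneg d_pos G0_pos consensus_const_nonneg in simp_all)
  finally show ?thesis by (simp add: momentum_const_def mult.commute)
qed

lemma path_iteration:
  assumes N: "1 \<le> N"
  shows "optimistic_iteration G\<^sub>0 G_inf \<eta> L diam dir_max (d * G_inf) pert_max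
    (xb \<omega>) zb (Db \<omega>) (\<lambda>k. grad_noise k \<omega>) pert (\<lambda>k. scale_avg k \<omega>) gF xs N"
proof
  show "Db \<omega> 0 = 0"
    unfolding Db_def[OF tame] using init'(5)[OF _ \<omega>_space[OF tame]] node_avg_cong[of M "\<lambda>i. dir T 0 i \<omega>" "\<lambda>_. 0"]
    by (simp add: node_avg_const[OF M_pos])
  fix k assume k: "k \<in> {1..N}"
  show "Db \<omega> k $ s = scale_avg (k - 1) \<omega> $ s * gF (zb k) $ s + grad_noise k \<omega> $ s + pert k $ s" for s
    by (simp add: pert_def)
  show "norm (Db \<omega> k) \<le> dir_max"
    unfolding Db_def[OF tame] using k by (intro norm_node_avg[OF M_pos] dir_bound[OF tame]) auto
  show "zb k = xb \<omega> (k - 1) - \<eta> *\<^sub>R Db \<omega> (k - 1)" by (rule zb_step[OF tame k])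
  show "xb \<omega> k = xb \<omega> (k - 1) - \<eta> *\<^sub>R Db \<omega> k" by (rule xb_step[OF tame k])
  show "scale_avg k \<omega> $ s \<le> scale_avg (k - 1) \<omega> $ s" for s by (rule scale_avg_decreasing[OF k])
  show "0 \<le> (zb k - xs) \<bullet> gF (zb k)" by (rule minty)
  show "norm (zb k - xs) \<le> diam" by (rule zb_xs[OF k])
  show "norm (gF (zb k)) \<le> d * G_inf" by (rule gF_bound)
  show "norm (pert k) \<le> pert_max" by (rule pert_max[OF k])
next
  fix k s assume "k \<le> N"
  then show "1 / G_inf \<le> scale_avg k \<omega> $ s" "scale_avg k \<omega> $ s \<le> 1 / G\<^sub>0"
    by (rule scale_avg_bounds)+
qed (fact N G0_pos G0_le_G_inf eta_pos L_nonneg step_size lipschitz)+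

lemma path_bound:
  assumes N: "1 \<le> N" and r: "r \<le> 1 / 2"
  shows "(\<Sum>k\<in>{1..N}. (norm (gF (zb k)))\<^sup>2)
    \<le> const_coeff G\<^sub>0 G_inf \<eta> diam dir_max (d * G_inf) d
      + variance_coeff G\<^sub>0 G_inf \<eta> * (\<Sum>k\<in>{1..N}. (norm (grad_noise k \<omega>))\<^sup>2)
      + perturbation_coeff G\<^sub>0 G_inf \<eta> diam pert_max * (momentum_const + real N * (consensus_const * r))
      - descent_coeff G\<^sub>0 G_inf \<eta> * (2 * \<eta>) *
        (\<Sum>k\<in>{1..N}. \<Sum>s\<in>UNIV. 1 / scale_avg (k - 1) \<omega> $ s * (zb k - xs) $ s * grad_noise k \<omega> $ s)"
proof -
  interpret optimistic_iteration G\<^sub>0 G_inf \<eta> L diam dir_max "d * G_inf" pert_max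
    "xb \<omega>" zb "Db \<omega>" "\<lambda>k. grad_noise k \<omega>" pert "\<lambda>k. scale_avg k \<omega>" gF xs N
    by (rule path_iteration[OF N])
  have "0 \<le> pert_max" using order_trans[OF norm_ge_zero pert_max[of 1]] N by simp
  then have "0 \<le> perturbation_coeff G\<^sub>0 G_inf \<eta> diam pert_max"
    by (rule coeffs_nonneg(2)[OF G0_pos G_inf_pos eta_pos diam_nonneg])
  then have pK: "perturbation_coeff G\<^sub>0 G_inf \<eta> diam pert_max * (\<Sum>k\<in>{1..N}. norm (pert k))
    \<le> perturbation_coeff G\<^sub>0 G_inf \<eta> diam pert_max * (momentum_const + real N * (consensus_const * r))"
    by (intro mult_left_mono sum_pert[OF r])
  show ?thesis
    by (rule order_trans[OF sum_gradient_bound_explicit[folded d_def]])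
      (intro diff_right_mono add_left_mono pK)
qed

end

end

section \<open>Conditional expectations over the samples\<close>

text \<open>\<open>F\<close> plays a sub-sigma-algebra of the probability space, expressed by an
  equal space and a measurable identity map. Independence on rectangles determines the joint law as
  a product.\<close>

lemma (in prob_space) indep_pair_distr:
  assumes F: "space F = space M" "(\<lambda>\<omega>. \<omega>) \<in> measurable M F"
    and X: "X \<in> measurable M D" "distr M D X = D"
    and indep: "\<And>A B. A \<in> sets F \<Longrightarrow> B \<in> sets D \<Longrightarrow>
      prob (A \<inter> (X -` B \<inter> space M)) = prob A * prob (X -` B \<inter> space M)"
  shows "distr M (F \<Otimes>\<^sub>M D) (\<lambda>\<omega>. (\<omega>, X \<omega>)) = distr M F (\<lambda>\<omega>. \<omega>) \<Otimes>\<^sub>M D"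
proof -
  interpret F: prob_space "distr M F (\<lambda>\<omega>. \<omega>)" using F(2) by (rule prob_space_distr)
  interpret D: prob_space "distr M D X" using X(1) by (rule prob_space_distr)
  interpret D': prob_space D using D.prob_space_axioms X by simp
  have "distr M F (\<lambda>\<omega>. \<omega>) \<Otimes>\<^sub>M D = distr M (F \<Otimes>\<^sub>M D) (\<lambda>\<omega>. (\<omega>, X \<omega>))"
  proof (rule pair_measure_eqI)
    show "sigma_finite_measure (distr M F (\<lambda>\<omega>. \<omega>))" "sigma_finite_measure D" ..
    show "sets (distr M F (\<lambda>\<omega>. \<omega>) \<Otimes>\<^sub>M D) = sets (distr M (F \<Otimes>\<^sub>M D) (\<lambda>\<omega>. (\<omega>, X \<omega>)))"
      by (simp cong: sets_pair_measure_cong)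
    fix A B assume A: "A \<in> sets (distr M F (\<lambda>\<omega>. \<omega>))" and B: "B \<in> sets D"
    then have A': "A \<in> sets F" by simp
    have AM: "A \<inter> space M = A" "A \<in> events"
      using sets.sets_into_space[OF A'] measurable_sets[OF F(2) A'] F(1) by (auto simp: Int_absorb2)
    have "emeasure (distr M (F \<Otimes>\<^sub>M D) (\<lambda>\<omega>. (\<omega>, X \<omega>))) (A \<times> B)
        = emeasure M ((\<lambda>\<omega>. (\<omega>, X \<omega>)) -` (A \<times> B) \<inter> space M)"
      using A' B F X by (intro emeasure_distr) auto
    also have "(\<lambda>\<omega>. (\<omega>, X \<omega>)) -` (A \<times> B) \<inter> space M = A \<inter> (X -` B \<inter> space M)"
      by auto
    also have "emeasure M \<dots> = emeasure M A * emeasure M (X -` B \<inter> space M)"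
      unfolding emeasure_eq_measure indep[OF A' B] by (simp add: ennreal_mult)
    also have "emeasure M A = emeasure (distr M F (\<lambda>\<omega>. \<omega>)) A"
      using A' F AM by (subst emeasure_distr) (simp_all add: vimage_def)
    also have "emeasure M (X -` B \<inter> space M) = emeasure D B"
      using emeasure_distr[OF X(1) B] X(2) by simp
    finally show "emeasure (distr M F (\<lambda>\<omega>. \<omega>)) A * emeasure D B
        = emeasure (distr M (F \<Otimes>\<^sub>M D) (\<lambda>\<omega>. (\<omega>, X \<omega>))) (A \<times> B)" ..
  qed
  then show ?thesis ..
qed

text \<open>Fubini for null sets: the exceptional set in \<open>D\<close> may depend on the outcome,
  as long as the fresh sample is independent of what determines it.\<close>

lemma (in prob_space) AE_indep:
  assumes F: "space F = space M" "(\<lambda>\<omega>. \<omega>) \<in> measurable M F"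
    and X: "X \<in> measurable M D" "distr M D X = D"
    and indep: "\<And>A B. A \<in> sets F \<Longrightarrow> B \<in> sets D \<Longrightarrow>
      prob (A \<inter> (X -` B \<inter> space M)) = prob A * prob (X -` B \<inter> space M)"
    and Q: "Measurable.pred (F \<Otimes>\<^sub>M D) (\<lambda>(\<omega>, s). Q \<omega> s)"
    and ae: "\<And>\<omega>. \<omega> \<in> space M \<Longrightarrow> AE s in D. Q \<omega> s"
  shows "AE \<omega> in M. Q \<omega> (X \<omega>)"
proof -
  interpret F: prob_space "distr M F (\<lambda>\<omega>. \<omega>)" using F(2) by (rule prob_space_distr)
  interpret D: prob_space "distr M D X" using X(1) by (rule prob_space_distr)
  interpret D': prob_space D using D.prob_space_axioms X by simp
  interpret pair_sigma_finite "distr M F (\<lambda>\<omega>. \<omega>)" D ..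
  have "AE x in distr M F (\<lambda>\<omega>. \<omega>) \<Otimes>\<^sub>M D. (\<lambda>(\<omega>, s). Q \<omega> s) x"
  proof (rule AE_pair_measure)
    show "{x \<in> space (distr M F (\<lambda>\<omega>. \<omega>) \<Otimes>\<^sub>M D). (\<lambda>(\<omega>, s). Q \<omega> s) x} \<in> sets (distr M F (\<lambda>\<omega>. \<omega>) \<Otimes>\<^sub>M D)"
      using Q by (simp add: pred_def space_pair_measure cong: sets_pair_measure_cong)
    show "AE x in distr M F (\<lambda>\<omega>. \<omega>). AE y in D. (\<lambda>(\<omega>, s). Q \<omega> s) (x, y)"
      by (rule AE_I2) (simp add: F ae)
  qed
  then have "AE x in distr M (F \<Otimes>\<^sub>M D) (\<lambda>\<omega>. (\<omega>, X \<omega>)). (\<lambda>(\<omega>, s). Q \<omega> s) x"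
    by (subst indep_pair_distr[OF F X]) (simp_all add: indep)
  then show ?thesis
    using F X Q by (subst (asm) AE_distr_iff) (auto simp: pred_def)
qed

text \<open>The freezing rule of conditional expectation: an independent sample is integrated out
  while the past is held fixed.\<close>

lemma (in prob_space) integral_indep:
  fixes \<phi> :: "'a \<Rightarrow> 's \<Rightarrow> real"
  assumes F: "space F = space M" "(\<lambda>\<omega>. \<omega>) \<in> measurable M F"
    and X: "X \<in> measurable M D" "distr M D X = D"
    and indep: "\<And>A B. A \<in> sets F \<Longrightarrow> B \<in> sets D \<Longrightarrow>
      prob (A \<inter> (X -` B \<inter> space M)) = prob A * prob (X -` B \<inter> space M)"
    and \<phi>: "(\<lambda>(\<omega>, s). \<phi> \<omega> s) \<in> borel_measurable (F \<Otimes>\<^sub>M D)"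
    and int: "integrable M (\<lambda>\<omega>. \<phi> \<omega> (X \<omega>))"
  shows "(LINT \<omega>|M. \<phi> \<omega> (X \<omega>)) = (LINT \<omega>|M. LINT s|D. \<phi> \<omega> s)"
proof -
  interpret F: prob_space "distr M F (\<lambda>\<omega>. \<omega>)" using F(2) by (rule prob_space_distr)
  interpret D: prob_space "distr M D X" using X(1) by (rule prob_space_distr)
  interpret D': prob_space D using D.prob_space_axioms X by simp
  interpret pair_sigma_finite "distr M F (\<lambda>\<omega>. \<omega>)" D ..
  have eq: "distr M (F \<Otimes>\<^sub>M D) (\<lambda>\<omega>. (\<omega>, X \<omega>)) = distr M F (\<lambda>\<omega>. \<omega>) \<Otimes>\<^sub>M D"
    by (rule indep_pair_distr[OF F X]) (rule indep)
  have pair: "(\<lambda>\<omega>. (\<omega>, X \<omega>)) \<in> measurable M (F \<Otimes>\<^sub>M D)" using F X by simp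
  have int': "integrable (distr M F (\<lambda>\<omega>. \<omega>) \<Otimes>\<^sub>M D) (\<lambda>(\<omega>, s). \<phi> \<omega> s)"
  proof -
    have "integrable (distr M (F \<Otimes>\<^sub>M D) (\<lambda>\<omega>. (\<omega>, X \<omega>))) (\<lambda>(\<omega>, s). \<phi> \<omega> s)"
      unfolding integrable_distr_eq[OF pair \<phi>] using int by simp
    then show ?thesis by (simp only: eq)
  qed
  have "(LINT \<omega>|M. \<phi> \<omega> (X \<omega>)) = (LINT x|distr M (F \<Otimes>\<^sub>M D) (\<lambda>\<omega>. (\<omega>, X \<omega>)). (\<lambda>(\<omega>, s). \<phi> \<omega> s) x)"
    by (subst integral_distr[OF pair \<phi>]) simp
  also have "\<dots> = (LINT \<omega>|distr M F (\<lambda>\<omega>. \<omega>). LINT s|D. \<phi> \<omega> s)"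
    unfolding eq using integral_fst[OF int'] by simp
  also have "\<dots> = (LINT \<omega>|M. LINT s|D. \<phi> \<omega> s)"
    using \<phi> by (intro integral_distr F(2) D'.borel_measurable_lebesgue_integral)
  finally show ?thesis .
qed

section \<open>Measurability of gradients and node averages\<close>

text \<open>A limit along a fixed sequence of difference quotients: it makes the sampled gradient
  jointly measurable in point and sample, given joint measurability of the function values.\<close>

lemma signed_grad_nth_limit:
  fixes h :: "real ^ ('p1::finite + 'p2::finite) \<Rightarrow> real"
  assumes "h differentiable (at y)"
  shows "(\<lambda>n. (case s of Inl _ \<Rightarrow> 1 | Inr _ \<Rightarrow> - 1) *
      ((h (y + (1 / real (Suc n)) *\<^sub>R axis s 1) - h y) * real (Suc n))) \<longlonglongrightarrow> signed_grad h y $ s"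
proof -
  let ?D = "frechet_derivative h (at y)" and ?e = "axis s 1 :: real ^ ('p1 + 'p2)"
  have D: "(h has_derivative ?D) (at y)" using assms by (simp only: frechet_derivative_works)
  have lin: "bounded_linear ?D" using D by (rule has_derivative_bounded_linear)
  have "((\<lambda>t. y + t *\<^sub>R ?e) has_derivative (\<lambda>t. t *\<^sub>R ?e)) (at 0)"
    by (auto intro!: derivative_eq_intros)
  then have "((\<lambda>t. h (y + t *\<^sub>R ?e)) has_derivative (\<lambda>t. ?D (t *\<^sub>R ?e))) (at 0)"
    by (rule has_derivative_compose) (use D in simp)
  moreover have "(\<lambda>t. ?D (t *\<^sub>R ?e)) = (*) (?D ?e)"
    using linear_scale[OF bounded_linear.linear[OF lin]] by (simp add: fun_eq_iff mult.commute)
  ultimately have "((\<lambda>t. h (y + t *\<^sub>R ?e)) has_field_derivative ?D ?e) (at 0)"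
    by (simp only: has_field_derivative_def)
  then have "((\<lambda>t. (h (y + t *\<^sub>R ?e) - h y) / t) \<longlongrightarrow> ?D ?e) (at 0)"
    by (simp add: DERIV_def)
  moreover have "filterlim (\<lambda>n. 1 / real (Suc n)) (at 0) sequentially"
    unfolding filterlim_at using LIMSEQ_inverse_real_of_nat by (simp add: inverse_eq_divide)
  ultimately have "(\<lambda>n. (h (y + (1 / real (Suc n)) *\<^sub>R ?e) - h y) / (1 / real (Suc n))) \<longlonglongrightarrow> ?D ?e"
    by (rule filterlim_compose)
  then have "(\<lambda>n. (h (y + (1 / real (Suc n)) *\<^sub>R ?e) - h y) * real (Suc n)) \<longlonglongrightarrow> ?D ?e" by simp
  then have "(\<lambda>n. (case s of Inl _ \<Rightarrow> 1 | Inr _ \<Rightarrow> - 1) *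
      ((h (y + (1 / real (Suc n)) *\<^sub>R ?e) - h y) * real (Suc n)))
     \<longlonglongrightarrow> (case s of Inl _ \<Rightarrow> 1 | Inr _ \<Rightarrow> - 1) * ?D ?e"
    by (intro tendsto_intros)
  moreover have "signed_grad h y $ s = (case s of Inl _ \<Rightarrow> 1 | Inr _ \<Rightarrow> - 1) * ?D ?e"
    by (simp add: signed_grad_def split: sum.split)
  ultimately show ?thesis by simp
qed

lemma borel_measurable_vecI:
  fixes g :: "'a \<Rightarrow> real ^ 'd"
  assumes "\<And>s. (\<lambda>x. g x $ s) \<in> borel_measurable A"
  shows "g \<in> borel_measurable A"
  using assms unfolding borel_measurable_euclidean_space[of g A]
  by (auto simp: Basis_vec_def inner_axis)

lemma borel_measurable_vec_nth_comp [measurable (raw)]: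
  fixes g :: "'a \<Rightarrow> real ^ 'd"
  assumes "g \<in> borel_measurable A"
  shows "(\<lambda>x. g x $ s) \<in> borel_measurable A"
  by (rule borel_measurable_continuous_on[OF _ assms]) (intro continuous_intros)

lemma borel_measurable_vec_lambda_comp [measurable (raw)]:
  fixes g :: "'d::finite \<Rightarrow> 'a \<Rightarrow> real"
  assumes "\<And>s. g s \<in> borel_measurable A"
  shows "(\<lambda>x. \<chi> s. g s x) \<in> borel_measurable A"
  using assms by (intro borel_measurable_vecI) simp

lemma borel_measurable_node_avg [measurable (raw)]:
  fixes Y :: "nat \<Rightarrow> 'a \<Rightarrow> 'b::{real_normed_vector, second_countable_topology}"
  assumes "\<And>i. i < n \<Longrightarrow> Y i \<in> borel_measurable A"
  shows "(\<lambda>x. node_avg n (\<lambda>i. Y i x)) \<in> borel_measurable A"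
  unfolding node_avg_def using assms by (intro borel_measurable_scaleR borel_measurable_sum) auto

context dadam3
begin

abbreviation G where "G y s \<equiv> signed_grad (\<lambda>x. f x s) y"

section \<open>The sigma-algebras generated by the samples\<close>

definition idx :: "(nat \<times> nat \<times> nat) set" where
  "idx = {(k, i, j). k \<in> {1..N} \<and> i < M \<and> j < m k}"

definition smp :: "nat \<times> nat \<times> nat \<Rightarrow> 'w \<Rightarrow> 's" where "smp = (\<lambda>(k, i, j). \<xi> k i j)"

definition past :: "nat \<Rightarrow> (nat \<times> nat \<times> nat) set" where
  "past k = {(k', i, j). k' < k \<and> k' \<in> {1..N} \<and> i < M \<and> j < m k'}"

text \<open>Generated by the samples with index in \<open>A\<close>. Index sets rather than times
  are used so that a single sample of the current batch can be added to the past.\<close>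

definition Fil :: "(nat \<times> nat \<times> nat) set \<Rightarrow> 'w measure" where
  "Fil A = vimage_algebra (space P) (\<lambda>\<omega>. \<lambda>a\<in>A. smp a \<omega>) (PiM A (\<lambda>_. \<D>))"

lemma past_subset: "past k \<subseteq> idx" by (auto simp: past_def idx_def)

lemma past_mono: "k \<le> k' \<Longrightarrow> past k \<subseteq> past k'" by (auto simp: past_def)

lemma smp_indep: "prob_space.indep_vars P (\<lambda>_. \<D>) smp idx"
  using samples_indep by (simp add: smp_def idx_def)

lemma smp_measurable: "a \<in> idx \<Longrightarrow> smp a \<in> measurable P \<D>"
  using smp_indep unfolding prob_space.indep_vars_def[OF prob_P] by auto

lemma smp_distr: "a \<in> idx \<Longrightarrow> distr P \<D> (smp a) = \<D>"
  using samples_distr by (auto simp: idx_def smp_def)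

lemma space_Fil [simp]: "space (Fil A) = space P" by (simp add: Fil_def)

lemma restrict_smp_measurable: "A \<subseteq> idx \<Longrightarrow> (\<lambda>\<omega>. \<lambda>a\<in>A. smp a \<omega>) \<in> measurable P (PiM A (\<lambda>_. \<D>))"
  using smp_measurable by (intro measurable_restrict) auto

lemma sets_Fil: "A \<subseteq> idx \<Longrightarrow>
    sets (Fil A) = {(\<lambda>\<omega>. \<lambda>a\<in>A. smp a \<omega>) -` S \<inter> space P | S. S \<in> sets (PiM A (\<lambda>_. \<D>))}"
  unfolding Fil_def using measurable_space[OF restrict_smp_measurable]
  by (intro sets_vimage_algebra2) auto

lemma id_measurable_Fil: "A \<subseteq> idx \<Longrightarrow> (\<lambda>\<omega>. \<omega>) \<in> measurable P (Fil A)"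
  by (intro measurableI) (auto simp: sets_Fil intro: measurable_sets[OF restrict_smp_measurable])

lemma measurable_Fil_P: "A \<subseteq> idx \<Longrightarrow> g \<in> measurable (Fil A) N' \<Longrightarrow> g \<in> measurable P N'"
  using measurable_compose[OF id_measurable_Fil] by blast

lemma smp_measurable_Fil:
  assumes "A \<subseteq> idx" "a \<in> A" shows "smp a \<in> measurable (Fil A) \<D>"
proof -
  have "(\<lambda>\<omega>. \<lambda>a\<in>A. smp a \<omega>) \<in> measurable (Fil A) (PiM A (\<lambda>_. \<D>))"
    unfolding Fil_def using measurable_space[OF restrict_smp_measurable[OF assms(1)]]
    by (intro measurable_vimage_algebra1) auto
  then have "(\<lambda>\<omega>. (\<lambda>a\<in>A. smp a \<omega>) a) \<in> measurable (Fil A) \<D>"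
    using assms(2) by (rule measurable_compose[OF _ measurable_component_singleton])
  then show ?thesis using assms(2) by simp
qed

lemma measurable_Fil_mono:
  assumes "A \<subseteq> B" "B \<subseteq> idx" "g \<in> measurable (Fil A) N'"
  shows "g \<in> measurable (Fil B) N'"
proof -
  have "(\<lambda>\<omega>. \<omega>) \<in> measurable (Fil B) (Fil A)"
    unfolding Fil_def[of A]
  proof (rule measurable_vimage_algebra2)
    show "(\<lambda>\<omega>. \<omega>) \<in> space (Fil B) \<rightarrow> space P" by simp
    show "(\<lambda>\<omega>. \<lambda>a\<in>A. smp a \<omega>) \<in> measurable (Fil B) (PiM A (\<lambda>_. \<D>))"
      using assms by (intro measurable_restrict smp_measurable_Fil) auto
  qed
  from measurable_compose[OF this assms(3)] show ?thesis .
qed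

text \<open>Disjoint groups of independent variables are independent; the product over the singleton
  index set is identified with the sample itself.\<close>

lemma Fil_indep:
  assumes "A \<subseteq> idx" "a \<in> idx" "a \<notin> A"
    and S: "S \<in> sets (Fil A)" and B: "B \<in> sets \<D>"
  shows "measure P (S \<inter> (smp a -` B \<inter> space P)) = measure P S * measure P (smp a -` B \<inter> space P)"
proof -
  interpret prob_space P by (rule prob_P)
  obtain S' where S': "S' \<in> sets (PiM A (\<lambda>_. \<D>))" "S = (\<lambda>\<omega>. \<lambda>a\<in>A. smp a \<omega>) -` S' \<inter> space P"
    using S unfolding sets_Fil[OF assms(1)] by blast
  have B': "(\<lambda>x. x a) -` B \<inter> space (PiM {a} (\<lambda>_. \<D>)) \<in> sets (PiM {a} (\<lambda>_. \<D>))" (is "?B \<in> _")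
    using B by (intro measurable_sets[OF measurable_component_singleton]) auto
  have eq: "(\<lambda>\<omega>. \<lambda>a\<in>{a}. smp a \<omega>) -` ?B \<inter> space P = smp a -` B \<inter> space P"
    using measurable_space[OF smp_measurable[OF assms(2)]] by (auto simp: space_PiM)
  have "indep_var (PiM A (\<lambda>_. \<D>)) (\<lambda>\<omega>. \<lambda>a\<in>A. smp a \<omega>) (PiM {a} (\<lambda>_. \<D>)) (\<lambda>\<omega>. \<lambda>a\<in>{a}. smp a \<omega>)"
    using assms by (intro indep_var_restrict[OF smp_indep]) auto
  from indep_varD[OF this S'(1) B']
  have "prob ((\<lambda>\<omega>. (\<lambda>a\<in>A. smp a \<omega>, \<lambda>a\<in>{a}. smp a \<omega>)) -` (S' \<times> ?B) \<inter> space P)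
    = prob S * prob (smp a -` B \<inter> space P)"
    unfolding eq S'(2) .
  also have "(\<lambda>\<omega>. (\<lambda>a\<in>A. smp a \<omega>, \<lambda>a\<in>{a}. smp a \<omega>)) -` (S' \<times> ?B) \<inter> space P
    = S \<inter> ((\<lambda>\<omega>. \<lambda>a\<in>{a}. smp a \<omega>) -` ?B \<inter> space P)"
    unfolding S'(2) by auto
  finally show ?thesis unfolding eq .
qed

lemma G_measurable: "(\<lambda>(y, s). G y s) \<in> borel_measurable (borel \<Otimes>\<^sub>M \<D>)"
proof (rule borel_measurable_vecI)
  fix c :: "'p1 + 'p2"
  let ?q = "\<lambda>n (y, s). (case c of Inl _ \<Rightarrow> 1 | Inr _ \<Rightarrow> - 1) *
      ((f (y + (1 / real (Suc n)) *\<^sub>R axis c 1) s - f y s) * real (Suc n))"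
  show "(\<lambda>x. (case x of (y, s) \<Rightarrow> G y s) $ c) \<in> borel_measurable (borel \<Otimes>\<^sub>M \<D>)"
  proof (rule borel_measurable_LIMSEQ_real)
    fix x assume "x \<in> space (borel \<Otimes>\<^sub>M \<D> :: ((real ^ ('p1 + 'p2)) \<times> 's) measure)"
    then have "snd x \<in> space \<D>" by (auto simp: space_pair_measure)
    then show "(\<lambda>n. ?q n x) \<longlonglongrightarrow> (case x of (y, s) \<Rightarrow> G y s) $ c"
      using signed_grad_nth_limit[OF f_differentiable, of "snd x" c "fst x"] by (simp add: case_prod_beta)
  next
    fix n
    have "(\<lambda>x. (fst x + (1 / real (Suc n)) *\<^sub>R axis c (1 :: real), snd x)) \<in> measurable (borel \<Otimes>\<^sub>M \<D>) (borel \<Otimes>\<^sub>M \<D>)"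
      by (rule measurable_Pair[OF borel_measurable_add[OF measurable_fst borel_measurable_const] measurable_snd])
    from measurable_compose[OF this f_measurable]
    have "(\<lambda>x. f (fst x + (1 / real (Suc n)) *\<^sub>R axis c 1) (snd x)) \<in> borel_measurable (borel \<Otimes>\<^sub>M \<D>)"
      by simp
    moreover have "(\<lambda>x. f (fst x) (snd x)) \<in> borel_measurable (borel \<Otimes>\<^sub>M \<D>)"
      using f_measurable by (simp add: case_prod_beta)
    ultimately show "?q n \<in> borel_measurable (borel \<Otimes>\<^sub>M \<D>)"
      unfolding case_prod_beta by (intro borel_measurable_times borel_measurable_diff borel_measurable_const)
  qed
qed

lemma gF_measurable [measurable]: "gF \<in> borel_measurable borel"
proof (rule borel_measurable_continuous_onI)
  have "L-lipschitz_on UNIV gF"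
    using lipschitz L_nonneg by (intro lipschitz_onI) (auto simp: dist_norm)
  then show "continuous_on UNIV gF" by (rule lipschitz_on_continuous_on)
qed

lemma G_comp_measurable:
  assumes "y \<in> borel_measurable A" "s \<in> measurable A \<D>"
  shows "(\<lambda>x. G (y x) (s x)) \<in> borel_measurable A"
  using measurable_compose[OF measurable_Pair[OF assms] G_measurable] by simp

lemma borel_cong:
  assumes "\<And>\<omega>. \<omega> \<in> space P \<Longrightarrow> g \<omega> = h \<omega>" "h \<in> borel_measurable (Fil A)"
  shows "g \<in> borel_measurable (Fil A)"
  using assms by (subst measurable_cong[of _ g h]) auto

lemma mix_measurable:
  assumes "\<And>j. j < M \<Longrightarrow> Y j \<in> borel_measurable A"
  shows "(\<lambda>\<omega>. mix (W ^\<^sub>m t) (\<lambda>j. Y j \<omega> :: real ^ ('p1 + 'p2)) i) \<in> borel_measurable A"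
proof -
  have "dim_row (W ^\<^sub>m t) = M" by (rule carrier_matD(1)[OF pow_carrier_mat[OF W_dim]])
  then show ?thesis unfolding mix_def using assms
    by (intro borel_measurable_sum borel_measurable_scaleR borel_measurable_const) auto
qed

section \<open>Adaptedness of the trace\<close>

lemma z_measurable_step:
  assumes k: "k \<in> {1..N}" and i: "i < M"
    and x: "\<And>j. j < M \<Longrightarrow> xpt T (k - 1) j \<in> borel_measurable (Fil A)"
    and dir: "\<And>j. j < M \<Longrightarrow> dir T (k - 1) j \<in> borel_measurable (Fil A)"
  shows "zpt T k i \<in> borel_measurable (Fil A)"
  by (rule borel_cong, erule z_step[OF k i])
    (intro mix_measurable borel_measurable_diff borel_measurable_scaleR borel_measurable_const x dir)

lemma ghat_measurable_step:
  assumes k: "k \<in> {1..N}" and i: "i < M" and z: "zpt T k i \<in> borel_measurable (Fil (past k))"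
  shows "ghat T k i \<in> borel_measurable (Fil (past (Suc k)))"
proof (rule borel_cong, erule g_step[OF k i])
  have "(\<lambda>\<omega>. G (zpt T k i \<omega>) (\<xi> k i j \<omega>)) \<in> borel_measurable (Fil (past (Suc k)))" if "j < m k" for j
  proof (rule G_comp_measurable)
    show "zpt T k i \<in> borel_measurable (Fil (past (Suc k)))"
      using measurable_Fil_mono[OF past_mono past_subset z] by simp
    have "smp (k, i, j) \<in> measurable (Fil (past (Suc k))) \<D>"
      using k i that by (intro smp_measurable_Fil past_subset) (auto simp: past_def)
    then show "\<xi> k i j \<in> measurable (Fil (past (Suc k))) \<D>" by (simp add: smp_def)
  qed
  then show "(\<lambda>\<omega>. (1 / real (m k)) *\<^sub>R (\<Sum>j<m k. G (zpt T k i \<omega>) (\<xi> k i j \<omega>)))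
      \<in> borel_measurable (Fil (past (Suc k)))"
    by (intro borel_measurable_scaleR borel_measurable_const borel_measurable_sum) auto
qed

text \<open>These fields of iteration k may use the samples of iteration k, hence
  \<open>past (Suc k)\<close>. The points \<open>zpt\<close> of the next iteration are computed from
  them alone, which makes those points predictable.\<close>

lemma trace_measurable:
  assumes "k \<le> N" "i < M"
  shows "xpt T k i \<in> borel_measurable (Fil (past (Suc k))) \<and> mom T k i \<in> borel_measurable (Fil (past (Suc k)))
    \<and> sqr T k i \<in> borel_measurable (Fil (past (Suc k))) \<and> lam T k i \<in> borel_measurable (Fil (past (Suc k)))
    \<and> dir T k i \<in> borel_measurable (Fil (past (Suc k)))"
  using assms
proof (induct k arbitrary: i)
  case 0
  note i = 0(2)
  show ?case
    by (intro conjI; (rule borel_cong, erule init'[OF i], rule borel_measurable_const))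
next
  case (Suc k)
  let ?A = "Fil (past (Suc (Suc k)))"
  have k: "Suc k \<in> {1..N}" using Suc by auto
  have k': "Suc k - 1 = k" by simp
  note mono = measurable_Fil_mono[OF past_mono[of "Suc k" "Suc (Suc k)"] past_subset]
  have IH: "xpt T k j \<in> borel_measurable (Fil (past (Suc k)))" "mom T k j \<in> borel_measurable (Fil (past (Suc k)))"
    "sqr T k j \<in> borel_measurable (Fil (past (Suc k)))" "lam T k j \<in> borel_measurable (Fil (past (Suc k)))"
    "dir T k j \<in> borel_measurable (Fil (past (Suc k)))" if "j < M" for j
    using Suc.hyps[of j] Suc.prems that by auto
  have IH': "xpt T k j \<in> borel_measurable ?A" "mom T k j \<in> borel_measurable ?A"
    "sqr T k j \<in> borel_measurable ?A" "lam T k j \<in> borel_measurable ?A" if "j < M" for j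
    using IH[OF that] by (auto intro: mono)
  have z: "zpt T (Suc k) j \<in> borel_measurable (Fil (past (Suc k)))" if "j < M" for j
    using IH by (intro z_measurable_step[OF k that]) auto
  have gh: "ghat T (Suc k) j \<in> borel_measurable ?A" if "j < M" for j
    by (rule ghat_measurable_step[OF k that z[OF that]])
  have mom: "mom T (Suc k) j \<in> borel_measurable ?A" if j: "j < M" for j
    by (rule borel_cong, erule mom_step[OF k j, unfolded k'])
      (intro borel_measurable_add borel_measurable_scaleR borel_measurable_const gh[OF j] IH'[OF j])
  have sqr: "sqr T (Suc k) j \<in> borel_measurable ?A" if j: "j < M" for j
    by (rule borel_cong, erule sqr_step[OF k j, unfolded k'])
      (intro borel_measurable_add borel_measurable_scaleR borel_measurable_const borel_measurable_vec_lambda_comp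
        borel_measurable_times borel_measurable_vec_nth_comp gh[OF j] IH'[OF j])
  have lam: "lam T (Suc k) j \<in> borel_measurable ?A" if j: "j < M" for j
    by (rule borel_cong, erule lam_step[OF k j, unfolded k'])
      (intro borel_measurable_add borel_measurable_scaleR borel_measurable_const borel_measurable_vec_lambda_comp
        borel_measurable_max borel_measurable_vec_nth_comp sqr[OF j] IH'[OF j])
  have dir: "dir T (Suc k) j \<in> borel_measurable ?A" if j: "j < M" for j
    by (rule borel_cong, erule dir_step[OF k j])
      (intro borel_measurable_vec_lambda_comp borel_measurable_times powr_real_measurable borel_measurable_const
        borel_measurable_vec_nth_comp lam[OF j] mom[OF j])
  have "xpt T (Suc k) i \<in> borel_measurable ?A"
    by (rule borel_cong, erule x_step[OF k Suc.prems(2), unfolded k'])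
      (intro mix_measurable borel_measurable_diff borel_measurable_scaleR borel_measurable_const dir IH')
  then show ?case using mom sqr lam dir Suc.prems by simp
qed

lemma z_measurable:
  assumes k: "k \<in> {1..N}" and i: "i < M" shows "zpt T k i \<in> borel_measurable (Fil (past k))"
proof (rule z_measurable_step[OF k i])
  have "k - 1 \<le> N" "Suc (k - 1) = k" using k by auto
  then show "xpt T (k - 1) j \<in> borel_measurable (Fil (past k))" "dir T (k - 1) j \<in> borel_measurable (Fil (past k))"
    if "j < M" for j using trace_measurable[of "k - 1" j] that by auto
qed

lemma lam_rt_measurable:
  assumes k: "k \<in> {1..N}" and i: "i < M" shows "(\<lambda>\<omega>. lam_rt (k - 1) i \<omega>) \<in> borel_measurable (Fil (past k))"
proof -
  have "k - 1 \<le> N" "Suc (k - 1) = k" using k by auto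
  then have "lam T (k - 1) i \<in> borel_measurable (Fil (past k))" using trace_measurable[of "k - 1" i] i by auto
  then show ?thesis unfolding inv_sqrt_def
    by (intro borel_measurable_vec_lambda_comp powr_real_measurable borel_measurable_const
        borel_measurable_vec_nth_comp)
qed

lemma scale_avg_measurable: "k \<in> {1..N} \<Longrightarrow> scale_avg (k - 1) \<in> borel_measurable (Fil (past k))"
  unfolding scale_avg_def by (intro borel_measurable_node_avg lam_rt_measurable)

lemma zbar_measurable: "k \<in> {1..N} \<Longrightarrow> zbar M T k \<in> borel_measurable (Fil (past k))"
  unfolding zbar_def
  by (intro borel_measurable_scaleR borel_measurable_const borel_measurable_sum z_measurable) auto

section \<open>Deviations of single samples\<close>

definition sdev :: "nat \<Rightarrow> nat \<Rightarrow> nat \<Rightarrow> 'w \<Rightarrow> real ^ ('p1 + 'p2)" where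
  "sdev k i j \<omega> = G (zpt T k i \<omega>) (smp (k, i, j) \<omega>) - gF (zpt T k i \<omega>)"

lemma idx_iff: "(k, i, j) \<in> idx \<longleftrightarrow> k \<in> {1..N} \<and> i < M \<and> j < m k"
  by (simp add: idx_def)

lemma sdev_measurable:
  assumes a: "(k, i, j) \<in> idx" and A: "past k \<subseteq> A" "A \<subseteq> idx" "(k, i, j) \<in> A"
  shows "sdev k i j \<in> borel_measurable (Fil A)"
proof -
  have z: "zpt T k i \<in> borel_measurable (Fil A)"
    using z_measurable a measurable_Fil_mono[OF A(1,2)] by (auto simp: idx_iff)
  then show ?thesis unfolding sdev_def
    by (intro borel_measurable_diff G_comp_measurable smp_measurable_Fil[OF A(2,3)]
        measurable_compose[OF z gF_measurable])
qed

lemma sdev_measurable_P: "(k, i, j) \<in> idx \<Longrightarrow> sdev k i j \<in> borel_measurable P"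
  by (rule measurable_Fil_P[OF order_refl sdev_measurable]) (use past_subset in auto)

lemma pair_measurable:
  assumes a: "(k, i, j) \<in> idx" and A: "past k \<subseteq> A" "A \<subseteq> idx"
  shows "(\<lambda>(\<omega>, s). G (zpt T k i \<omega>) s) \<in> borel_measurable (Fil A \<Otimes>\<^sub>M \<D>)"
    and "(\<lambda>(\<omega>, s). gF (zpt T k i \<omega>)) \<in> borel_measurable (Fil A \<Otimes>\<^sub>M \<D>)"
proof -
  have "zpt T k i \<in> borel_measurable (Fil A)"
    using z_measurable a measurable_Fil_mono[OF A] by (auto simp: idx_iff)
  then have z: "(\<lambda>x. zpt T k i (fst x)) \<in> borel_measurable (Fil A \<Otimes>\<^sub>M \<D>)"
    by (rule measurable_compose[OF measurable_fst])
  show "(\<lambda>(\<omega>, s). G (zpt T k i \<omega>) s) \<in> borel_measurable (Fil A \<Otimes>\<^sub>M \<D>)"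
    unfolding case_prod_beta by (rule G_comp_measurable[OF z measurable_snd])
  show "(\<lambda>(\<omega>, s). gF (zpt T k i \<omega>)) \<in> borel_measurable (Fil A \<Otimes>\<^sub>M \<D>)"
    unfolding case_prod_beta by (rule measurable_compose[OF z gF_measurable])
qed

text \<open>The martingale difference property: both the weight and the evaluation point are
  determined by \<open>A\<close>, and the sample outside \<open>A\<close> is unbiased at every fixed
  point.\<close>

lemma mean_zero:
  assumes a: "(k, i, j) \<in> idx" and A: "past k \<subseteq> A" "A \<subseteq> idx" "(k, i, j) \<notin> A"
    and w: "w \<in> borel_measurable (Fil A)"
  shows "(LINT \<omega>|P. w \<omega> \<bullet> sdev k i j \<omega>) = 0"
proof (cases "integrable P (\<lambda>\<omega>. w \<omega> \<bullet> sdev k i j \<omega>)")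
  case False
  \<comment> \<open>The integral of a function that is not integrable is 0 by convention, so the
    claim needs no integrability.\<close>
  then show ?thesis by (rule not_integrable_integral_eq)
next
  case True
  interpret prob_space P by (rule prob_P)
  interpret D: prob_space \<D> by (rule prob_D)
  let ?\<phi> = "\<lambda>\<omega> s. w \<omega> \<bullet> (G (zpt T k i \<omega>) s - gF (zpt T k i \<omega>))"
  have "(\<lambda>x. w (fst x)) \<in> borel_measurable (Fil A \<Otimes>\<^sub>M \<D>)"
    by (rule measurable_compose[OF measurable_fst w])
  then have "(\<lambda>(\<omega>, s). ?\<phi> \<omega> s) \<in> borel_measurable (Fil A \<Otimes>\<^sub>M \<D>)"
    using pair_measurable[OF a A(1,2)] unfolding case_prod_beta
    by (intro borel_measurable_inner borel_measurable_diff)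
  then have "(LINT \<omega>|P. ?\<phi> \<omega> (smp (k, i, j) \<omega>)) = (LINT \<omega>|P. LINT s|\<D>. ?\<phi> \<omega> s)"
    by (rule integral_indep[rotated 5])
      (use True A Fil_indep[OF A(2) a A(3)] in \<open>auto simp: sdev_def id_measurable_Fil smp_measurable[OF a] smp_distr[OF a]\<close>)
  also have "(\<lambda>\<omega>. LINT s|\<D>. ?\<phi> \<omega> s) = (\<lambda>\<omega>. 0)"
  proof
    fix \<omega>
    let ?y = "zpt T k i \<omega>"
    have "(LINT s|\<D>. w \<omega> \<bullet> (G ?y s - gF ?y)) = w \<omega> \<bullet> (LINT s|\<D>. G ?y s - gF ?y)"
      using unbiased(1) by (intro integral_inner_right) simp
    also have "(LINT s|\<D>. G ?y s - gF ?y) = 0"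
      using unbiased by (simp add: D.prob_space)
    finally show "(LINT s|\<D>. ?\<phi> \<omega> s) = 0" by simp
  qed
  finally show ?thesis by (simp add: sdev_def)
qed

text \<open>Besides the batch means that \<open>tame\<close> bounds, single deviations are bounded
  here, since the variance is computed sample by sample.\<close>

definition good :: "'w \<Rightarrow> bool" where
  "good \<omega> \<longleftrightarrow> tame \<omega> \<and> (\<forall>(k, i, j) \<in> idx. \<forall>s. \<bar>sdev k i j \<omega> $ s\<bar> \<le> 2 * G_inf)"

lemma finite_idx: "finite idx"
proof -
  have "idx = (SIGMA k:{1..N}. {..<M} \<times> {..<m k})" by (auto simp: idx_def)
  then show ?thesis by simp
qed

text \<open>The null set in \<open>bounded_grad\<close> depends on the point, and the point is
  random; independence of the fresh sample makes the union harmless.\<close>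

lemma AE_sample_bound:
  assumes a: "(k, i, j) \<in> idx"
  shows "AE \<omega> in P. infnorm (G (zpt T k i \<omega>) (smp (k, i, j) \<omega>)) \<le> G_inf"
proof -
  interpret prob_space P by (rule prob_P)
  have A: "past k \<subseteq> idx" "(k, i, j) \<notin> past k" using past_subset by (auto simp: past_def)
  have "(\<lambda>x. infnorm (case x of (\<omega>, s) \<Rightarrow> G (zpt T k i \<omega>) s)) \<in> borel_measurable (Fil (past k) \<Otimes>\<^sub>M \<D>)"
    by (rule borel_measurable_continuous_on[OF _ pair_measurable(1)[OF a order_refl A(1)]])
      (intro continuous_on_infnorm continuous_on_id)
  then have "Measurable.pred (Fil (past k) \<Otimes>\<^sub>M \<D>) (\<lambda>(\<omega>, s). infnorm (G (zpt T k i \<omega>) s) \<le> G_inf)"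
    by (simp add: case_prod_beta)
  then show ?thesis
    by (rule AE_indep[rotated 5])
      (use A bounded_grad Fil_indep[OF A(1) a A(2)] in \<open>auto simp: id_measurable_Fil smp_measurable[OF a] smp_distr[OF a]\<close>)
qed

lemma AE_good: "AE \<omega> in P. good \<omega>"
proof -
  have "AE \<omega> in P. \<forall>a\<in>idx. (case a of (k, i, j) \<Rightarrow> infnorm (G (zpt T k i \<omega>) (smp a \<omega>)) \<le> G_inf)"
    using AE_sample_bound by (intro AE_finite_allI finite_idx) auto
  then show ?thesis using z_bounded AE_space
  proof eventually_elim
    case (elim \<omega>)
    have G: "\<bar>G (zpt T k i \<omega>) (smp (k, i, j) \<omega>) $ s\<bar> \<le> G_inf" if "(k, i, j) \<in> idx" for k i j s
      using elim(1) that component_le_infnorm[of "G (zpt T k i \<omega>) (smp (k, i, j) \<omega>)" s] by fastforce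
    have "\<bar>sdev k i j \<omega> $ s\<bar> \<le> 2 * G_inf" if "(k, i, j) \<in> idx" for k i j s
      using G[OF that, of s] gF_component_bound[of "zpt T k i \<omega>" s] by (simp add: sdev_def)
    moreover have "\<bar>ghat T k i \<omega> $ s\<bar> \<le> G_inf" if k: "k \<in> {1..N}" "i < M" for k i s
    proof -
      have "ghat T k i \<omega> = node_avg (m k) (\<lambda>j. G (zpt T k i \<omega>) (smp (k, i, j) \<omega>))"
        using g_step[OF k elim(3)] by (simp add: node_avg_def smp_def)
      then have "norm (ghat T k i \<omega> $ s) \<le> G_inf"
        unfolding node_avg_nth
        using norm_node_avg[OF batch_pos[OF k(1)], of "\<lambda>j. G (zpt T k i \<omega>) (smp (k, i, j) \<omega>) $ s" G_inf] G k
        by (simp add: idx_iff node_avg_nth)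
      then show ?thesis by simp
    qed
    ultimately show ?case using elim by (auto simp: good_def tame_def)
  qed
qed

lemma good_tame: "good \<omega> \<Longrightarrow> tame \<omega>" by (simp add: good_def)

lemma good_sdev: "good \<omega> \<Longrightarrow> (k, i, j) \<in> idx \<Longrightarrow> \<bar>sdev k i j \<omega> $ s\<bar> \<le> 2 * G_inf"
  by (fastforce simp: good_def)

text \<open>The quantities to be integrated are bounded on the almost sure event
  \<open>good\<close>, which reduces integrability to measurability and an estimate on a
  path.\<close>

lemma integrable_bounded:
  fixes g :: "'w \<Rightarrow> real"
  assumes "g \<in> borel_measurable P" "\<And>\<omega>. good \<omega> \<Longrightarrow> \<bar>g \<omega>\<bar> \<le> b"
  shows "integrable P g"
proof -
  interpret prob_space P by (rule prob_P)
  show ?thesis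
    by (rule integrable_const_bound[OF _ assms(1), of b]) (use AE_good in eventually_elim, use assms(2) in simp)
qed

section \<open>Moments of the averaged noise\<close>

text \<open>The contribution of sample j at node i, with a = (i, j), to the noise before
  averaging.\<close>

definition hdev :: "nat \<Rightarrow> nat \<times> nat \<Rightarrow> 'w \<Rightarrow> real ^ ('p1 + 'p2)" where
  "hdev k a \<omega> = (\<chi> s. lam_rt (k - 1) (fst a) \<omega> $ s * sdev k (fst a) (snd a) \<omega> $ s)"

lemma grad_noise_eq:
  assumes k: "k \<in> {1..N}" and \<omega>: "\<omega> \<in> space P"
  shows "grad_noise k \<omega> = (1 / (real M * real (m k))) *\<^sub>R (\<Sum>a\<in>{..<M} \<times> {..<m k}. hdev k a \<omega>)"
proof -
  have m: "real (m k) \<noteq> 0" using batch_pos[OF k] by simp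
  have "ghat T k i \<omega> - gF (zpt T k i \<omega>) = (1 / real (m k)) *\<^sub>R (\<Sum>j<m k. sdev k i j \<omega>)" if "i < M" for i
  proof -
    have "(1 / real (m k)) *\<^sub>R (\<Sum>j<m k. gF (zpt T k i \<omega>)) = gF (zpt T k i \<omega>)"
      using m by (simp only: sum_constant_scaleR card_lessThan scaleR_scaleR) simp
    then show ?thesis using g_step[OF k that \<omega>]
      by (simp add: sdev_def smp_def sum_subtractf scaleR_diff_right)
  qed
  then have "(\<chi> s. lam_rt (k - 1) i \<omega> $ s * (ghat T k i \<omega> - gF (zpt T k i \<omega>)) $ s)
      = (1 / real (m k)) *\<^sub>R (\<Sum>j<m k. hdev k (i, j) \<omega>)" if "i < M" for i
    using that by (simp add: Finite_Cartesian_Product.vec_eq_iff hdev_def sum_distrib_left)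
  then have "grad_noise k \<omega> = node_avg M (\<lambda>i. (1 / real (m k)) *\<^sub>R (\<Sum>j<m k. hdev k (i, j) \<omega>))"
    unfolding grad_noise_def by (intro node_avg_cong) simp
  also have "\<dots> = (1 / real (m k)) *\<^sub>R ((1 / real M) *\<^sub>R (\<Sum>i<M. \<Sum>j<m k. hdev k (i, j) \<omega>))"
    unfolding node_avg_linear node_avg_def ..
  finally show ?thesis by (simp add: sum.cartesian_product mult.commute)
qed

context
  fixes k assumes k: "k \<in> {1..N}"
begin

lemma hdev_measurable:
  assumes a: "a \<in> {..<M} \<times> {..<m k}" and A: "past k \<subseteq> A" "A \<subseteq> idx" "(k, a) \<in> A"
  shows "hdev k a \<in> borel_measurable (Fil A)"
proof -
  have "(\<lambda>\<omega>. lam_rt (k - 1) (fst a) \<omega>) \<in> borel_measurable (Fil A)"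
    using lam_rt_measurable[OF k] a by (auto intro: measurable_Fil_mono[OF A(1,2)])
  moreover have "sdev k (fst a) (snd a) \<in> borel_measurable (Fil A)"
    using a k A by (intro sdev_measurable) (auto simp: idx_iff)
  ultimately show ?thesis unfolding hdev_def
    by (intro borel_measurable_vec_lambda_comp borel_measurable_times borel_measurable_vec_nth_comp)
qed

lemma k1: "k - 1 \<le> N" using k by auto

lemma hdev_nth_bound:
  assumes "good \<omega>" "a \<in> {..<M} \<times> {..<m k}"
  shows "\<bar>hdev k a \<omega> $ s\<bar> \<le> 1 / G\<^sub>0 * \<bar>sdev k (fst a) (snd a) \<omega> $ s\<bar>"
proof -
  have "fst a < M" using assms by auto
  note lam_rt_bounds[OF good_tame[OF assms(1)] k1 this, of s]
  then show ?thesis unfolding hdev_def vec_lambda_beta abs_mult by (intro mult_right_mono) auto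
qed

lemma hdev_norm_bound:
  assumes "good \<omega>" "a \<in> {..<M} \<times> {..<m k}"
  shows "norm (hdev k a \<omega>) \<le> d * (1 / G\<^sub>0 * (2 * G_inf))"
  unfolding d_def
proof (rule norm_le_card_bound)
  fix s
  have "(k, fst a, snd a) \<in> idx" using assms k by (auto simp: idx_iff)
  then have "1 / G\<^sub>0 * \<bar>sdev k (fst a) (snd a) \<omega> $ s\<bar> \<le> 1 / G\<^sub>0 * (2 * G_inf)"
    using good_sdev[OF assms(1)] G0_pos by (intro mult_left_mono) auto
  then show "\<bar>hdev k a \<omega> $ s\<bar> \<le> 1 / G\<^sub>0 * (2 * G_inf)"
    using hdev_nth_bound[OF assms, of s] by linarith
qed

lemma hdev_measurable_P: "a \<in> {..<M} \<times> {..<m k} \<Longrightarrow> hdev k a \<in> borel_measurable P"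
  by (rule measurable_Fil_P[OF order_refl hdev_measurable]) (use past_subset k in \<open>auto simp: idx_iff\<close>)

lemma hdev_inner_integrable:
  assumes "a \<in> {..<M} \<times> {..<m k}" "b \<in> {..<M} \<times> {..<m k}"
  shows "integrable P (\<lambda>\<omega>. hdev k a \<omega> \<bullet> hdev k b \<omega>)"
proof (rule integrable_bounded)
  show "(\<lambda>\<omega>. hdev k a \<omega> \<bullet> hdev k b \<omega>) \<in> borel_measurable P"
    using assms by (intro borel_measurable_inner hdev_measurable_P)
  let ?H = "d * (1 / G\<^sub>0 * (2 * G_inf))"
  fix \<omega> assume g: "good \<omega>"
  have "\<bar>hdev k a \<omega> \<bullet> hdev k b \<omega>\<bar> \<le> norm (hdev k a \<omega>) * norm (hdev k b \<omega>)"
    by (rule Cauchy_Schwarz_ineq2)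
  also have "\<dots> \<le> ?H * ?H"
    using hdev_norm_bound[OF g] assms by (intro mult_mono) (auto intro: order_trans[OF norm_ge_zero])
  finally show "\<bar>hdev k a \<omega> \<bullet> hdev k b \<omega>\<bar> \<le> ?H * ?H" .
qed

text \<open>Sample b is added to the past. Relative to this enlarged past, the deviation of b and
  both scalings are fixed while sample a still has mean zero; whether the two samples sit on the
  same node makes no difference.\<close>

lemma hdev_uncorrelated:
  assumes a: "a \<in> {..<M} \<times> {..<m k}" and b: "b \<in> {..<M} \<times> {..<m k}" and "a \<noteq> b"
  shows "(LINT \<omega>|P. hdev k a \<omega> \<bullet> hdev k b \<omega>) = 0"
proof -
  define A where "A = insert (k, b) (past k)"
  have A: "past k \<subseteq> A" "A \<subseteq> idx" "(k, b) \<in> A" using past_subset b k by (auto simp: A_def idx_iff)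
  have aA: "(k, fst a, snd a) \<notin> A" using \<open>a \<noteq> b\<close> by (auto simp: A_def past_def)
  have aI: "(k, fst a, snd a) \<in> idx" using a k by (auto simp: idx_iff)
  let ?w = "\<lambda>\<omega>. \<chi> s. lam_rt (k - 1) (fst a) \<omega> $ s * hdev k b \<omega> $ s"
  have w: "?w \<in> borel_measurable (Fil A)"
    using lam_rt_measurable[OF k, of "fst a"] a hdev_measurable[OF b A]
    by (intro borel_measurable_vec_lambda_comp borel_measurable_times borel_measurable_vec_nth_comp)
      (auto intro: measurable_Fil_mono[OF A(1,2)])
  have "hdev k a \<omega> \<bullet> hdev k b \<omega> = ?w \<omega> \<bullet> sdev k (fst a) (snd a) \<omega>" for \<omega>
    by (simp add: inner_vec_def hdev_def mult_ac)
  then show ?thesis using mean_zero[OF aI A(1,2) aA w] by simp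
qed

text \<open>The variance is the same at every point, so the inner integral obtained by freezing the
  past is constant.\<close>

lemma sdev_second_moment:
  assumes a: "(k, i, j) \<in> idx"
  shows "integrable P (\<lambda>\<omega>. (norm (sdev k i j \<omega>))\<^sup>2)" "(LINT \<omega>|P. (norm (sdev k i j \<omega>))\<^sup>2) = \<sigma>\<^sup>2"
proof -
  interpret prob_space P by (rule prob_P)
  show int: "integrable P (\<lambda>\<omega>. (norm (sdev k i j \<omega>))\<^sup>2)"
  proof (rule integrable_bounded)
    show "(\<lambda>\<omega>. (norm (sdev k i j \<omega>))\<^sup>2) \<in> borel_measurable P"
      using sdev_measurable_P[OF a] by (intro borel_measurable_power measurable_compose[OF _ borel_measurable_norm])
    fix \<omega> assume "good \<omega>"
    then have "norm (sdev k i j \<omega>) \<le> d * (2 * G_inf)"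
      unfolding d_def using good_sdev[OF _ a] by (intro norm_le_card_bound)
    then show "\<bar>(norm (sdev k i j \<omega>))\<^sup>2\<bar> \<le> (d * (2 * G_inf))\<^sup>2" by (simp add: power_mono)
  qed
  have A: "past k \<subseteq> idx" "(k, i, j) \<notin> past k" using past_subset by (auto simp: past_def)
  let ?\<phi> = "\<lambda>\<omega> s. (norm (G (zpt T k i \<omega>) s - gF (zpt T k i \<omega>)))\<^sup>2"
  have "(\<lambda>(\<omega>, s). ?\<phi> \<omega> s) \<in> borel_measurable (Fil (past k) \<Otimes>\<^sub>M \<D>)"
    using pair_measurable[OF a order_refl A(1)] unfolding case_prod_beta
    by (intro borel_measurable_power measurable_compose[OF _ borel_measurable_norm] borel_measurable_diff)
  then have "(LINT \<omega>|P. ?\<phi> \<omega> (smp (k, i, j) \<omega>)) = (LINT \<omega>|P. LINT s|\<D>. ?\<phi> \<omega> s)"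
    by (rule integral_indep[rotated 5])
      (use int A Fil_indep[OF A(1) a A(2)] in \<open>auto simp: sdev_def id_measurable_Fil smp_measurable[OF a] smp_distr[OF a]\<close>)
  also have "\<dots> = \<sigma>\<^sup>2" unfolding variance by (simp add: prob_space)
  finally show "(LINT \<omega>|P. (norm (sdev k i j \<omega>))\<^sup>2) = \<sigma>\<^sup>2" by (simp add: sdev_def)
qed

lemma hdev_second_moment:
  assumes a: "a \<in> {..<M} \<times> {..<m k}"
  shows "(LINT \<omega>|P. hdev k a \<omega> \<bullet> hdev k a \<omega>) \<le> \<sigma>\<^sup>2 / G\<^sub>0\<^sup>2"
proof -
  have aI: "(k, fst a, snd a) \<in> idx" using a k by (auto simp: idx_iff)
  have "(LINT \<omega>|P. hdev k a \<omega> \<bullet> hdev k a \<omega>) \<le> (LINT \<omega>|P. (1 / G\<^sub>0)\<^sup>2 * (norm (sdev k (fst a) (snd a) \<omega>))\<^sup>2)"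
  proof (rule integral_mono_AE)
    show "AE \<omega> in P. hdev k a \<omega> \<bullet> hdev k a \<omega> \<le> (1 / G\<^sub>0)\<^sup>2 * (norm (sdev k (fst a) (snd a) \<omega>))\<^sup>2"
      using AE_good
    proof eventually_elim
      case (elim \<omega>)
      show ?case
        unfolding power2_norm_eq_inner[symmetric] norm_square_vec sum_distrib_left power_mult_distrib[symmetric]
      proof (rule sum_mono)
        fix s
        have "\<bar>hdev k a \<omega> $ s\<bar>\<^sup>2 \<le> (1 / G\<^sub>0 * \<bar>sdev k (fst a) (snd a) \<omega> $ s\<bar>)\<^sup>2"
          using hdev_nth_bound[OF elim a, of s] by (intro power_mono) auto
        then show "(hdev k a \<omega> $ s)\<^sup>2 \<le> (1 / G\<^sub>0 * sdev k (fst a) (snd a) \<omega> $ s)\<^sup>2"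
          by (simp only: power2_abs power_mult_distrib)
      qed
    qed
  qed (use hdev_inner_integrable[OF a a] sdev_second_moment(1)[OF aI] in auto)
  also have "\<dots> = \<sigma>\<^sup>2 / G\<^sub>0\<^sup>2" using sdev_second_moment(2)[OF aI] by (simp add: power_divide)
  finally show ?thesis .
qed

text \<open>Off-diagonal terms of the expanded square vanish. There remain M \<open>m k\<close>
  diagonal terms under a prefactor with the square of that product in the denominator, which is
  where nodes and batches gain equally.\<close>

lemma grad_noise_second_moment:
  shows "integrable P (\<lambda>\<omega>. (norm (grad_noise k \<omega>))\<^sup>2)"
    and "(LINT \<omega>|P. (norm (grad_noise k \<omega>))\<^sup>2) \<le> \<sigma>\<^sup>2 / G\<^sub>0\<^sup>2 * (1 / (real M * real (m k)))"
proof -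
  let ?J = "{..<M} \<times> {..<m k}" and ?c = "1 / (real M * real (m k))"
  let ?I = "\<lambda>a b. LINT \<omega>|P. hdev k a \<omega> \<bullet> hdev k b \<omega>"
  let ?S = "\<lambda>\<omega>. ?c\<^sup>2 * (\<Sum>a\<in>?J. \<Sum>b\<in>?J. hdev k a \<omega> \<bullet> hdev k b \<omega>)"
  have eq: "(norm (grad_noise k \<omega>))\<^sup>2 = ?S \<omega>" if "\<omega> \<in> space P" for \<omega>
    unfolding grad_noise_eq[OF k that] power2_norm_eq_inner
    unfolding inner_scaleR_left inner_scaleR_right inner_sum_left
    unfolding inner_sum_right power2_eq_square mult.assoc by (rule refl)
  have int: "integrable P ?S"
    using hdev_inner_integrable by (intro integrable_mult_right Bochner_Integration.integrable_sum)
  show "integrable P (\<lambda>\<omega>. (norm (grad_noise k \<omega>))\<^sup>2)"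
    using int by (subst Bochner_Integration.integrable_cong[OF refl eq])
  have pos: "real M * real (m k) > 0" using M_pos batch_pos[OF k] by simp
  have "(LINT \<omega>|P. (norm (grad_noise k \<omega>))\<^sup>2) = (LINT \<omega>|P. ?S \<omega>)"
    by (rule Bochner_Integration.integral_cong[OF refl eq])
  also have "\<dots> = ?c\<^sup>2 * (\<Sum>a\<in>?J. \<Sum>b\<in>?J. ?I a b)"
    using hdev_inner_integrable by (simp add: Bochner_Integration.integral_sum)
  also have "\<dots> = ?c\<^sup>2 * (\<Sum>a\<in>?J. ?I a a)"
  proof -
    have "(\<Sum>b\<in>?J. ?I a b) = ?I a a" if a: "a \<in> ?J" for a
    proof -
      have "(\<Sum>b\<in>?J. ?I a b)
        = (\<Sum>b\<in>?J. if b = a then ?I a a else 0)"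
        using hdev_uncorrelated[OF a] by (intro sum.cong) auto
      then show ?thesis using a by (simp add: sum.delta)
    qed
    then show ?thesis by simp
  qed
  also have "\<dots> \<le> ?c\<^sup>2 * (\<Sum>a\<in>?J. \<sigma>\<^sup>2 / G\<^sub>0\<^sup>2)"
    by (intro mult_left_mono sum_mono hdev_second_moment) auto
  also have "\<dots> = \<sigma>\<^sup>2 / G\<^sub>0\<^sup>2 * ?c"
    using pos by (simp add: power2_eq_square)
  finally show "(LINT \<omega>|P. (norm (grad_noise k \<omega>))\<^sup>2) \<le> \<sigma>\<^sup>2 / G\<^sub>0\<^sup>2 * ?c" .
qed

definition cross :: "'w \<Rightarrow> real" where
  "cross \<omega> = (\<Sum>s\<in>UNIV. 1 / scale_avg (k - 1) \<omega> $ s * (zbar M T k \<omega> - xs) $ s * grad_noise k \<omega> $ s)"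

text \<open>The averaged scaling, the averaged point and the node scaling are all determined by
  \<open>past k\<close>, so each sample enters against a predictable weight.\<close>

lemma cross_mean:
  shows "integrable P cross" and "(LINT \<omega>|P. cross \<omega>) = 0"
proof -
  let ?J = "{..<M} \<times> {..<m k}" and ?c = "1 / (real M * real (m k))"
  let ?e = "\<lambda>\<omega> s. 1 / scale_avg (k - 1) \<omega> $ s * (zbar M T k \<omega> - xs) $ s"
  let ?w = "\<lambda>a \<omega>. \<chi> s. ?e \<omega> s * lam_rt (k - 1) (fst a) \<omega> $ s"
  let ?b = "real CARD('p1 + 'p2) * (G_inf * diam * (1 / G\<^sub>0)) * (real CARD('p1 + 'p2) * (2 * G_inf))"
  let ?S = "\<lambda>\<omega>. ?c * (\<Sum>a\<in>?J. ?w a \<omega> \<bullet> sdev k (fst a) (snd a) \<omega>)"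
  have eq: "cross \<omega> = ?S \<omega>" if "\<omega> \<in> space P" for \<omega>
  proof -
    have "cross \<omega> = ?c * (\<Sum>s\<in>UNIV. \<Sum>a\<in>?J. ?e \<omega> s * hdev k a \<omega> $ s)"
      unfolding cross_def grad_noise_eq[OF k that] by (simp add: sum_distrib_left mult_ac)
    also have "\<dots> = ?c * (\<Sum>a\<in>?J. \<Sum>s\<in>UNIV. ?e \<omega> s * hdev k a \<omega> $ s)"
      by (subst sum.swap) (rule refl)
    finally show ?thesis by (simp add: inner_vec_def hdev_def mult_ac)
  qed
  have w: "?w a \<in> borel_measurable (Fil (past k))" if "a \<in> ?J" for a
    using that by (intro borel_measurable_vec_lambda_comp borel_measurable_times borel_measurable_divide
        borel_measurable_vec_nth_comp borel_measurable_diff borel_measurable_const scale_avg_measurable[OF k]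
        zbar_measurable[OF k] lam_rt_measurable[OF k]) auto
  have int: "integrable P (\<lambda>\<omega>. ?w a \<omega> \<bullet> sdev k (fst a) (snd a) \<omega>)" if a: "a \<in> ?J" for a
  proof (rule integrable_bounded)
    have aI: "(k, fst a, snd a) \<in> idx" using a k by (auto simp: idx_iff)
    show "(\<lambda>\<omega>. ?w a \<omega> \<bullet> sdev k (fst a) (snd a) \<omega>) \<in> borel_measurable P"
      by (intro borel_measurable_inner measurable_Fil_P[OF past_subset w[OF a]] sdev_measurable_P[OF aI])
    fix \<omega> assume g: "good \<omega>"
    note t = good_tame[OF g]
    have i: "fst a < M" using a by auto
    have "norm (?w a \<omega>) \<le> real CARD('p1 + 'p2) * (G_inf * diam * (1 / G\<^sub>0))"
    proof (rule norm_le_card_bound)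
      fix s
      have "0 < 1 / G_inf" using G_inf_pos by simp
      then have sc: "0 < scale_avg (k - 1) \<omega> $ s" "1 / G_inf \<le> scale_avg (k - 1) \<omega> $ s"
        using scale_avg_bounds(1)[OF t k1, of s] by linarith+
      then have "1 / scale_avg (k - 1) \<omega> $ s \<le> G_inf"
        using G_inf_pos by (simp add: field_simps)
      then have 1: "\<bar>1 / scale_avg (k - 1) \<omega> $ s\<bar> \<le> G_inf" using sc by simp
      have 2: "\<bar>(zbar M T k \<omega> - xs) $ s\<bar> \<le> diam"
        using component_le_norm_cart[of "zbar M T k \<omega> - xs" s] zb_xs[OF t k] by linarith
      have 3: "\<bar>lam_rt (k - 1) (fst a) \<omega> $ s\<bar> \<le> 1 / G\<^sub>0"
        using lam_rt_bounds[OF t k1 i, of s] by simp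
      show "\<bar>?w a \<omega> $ s\<bar> \<le> G_inf * diam * (1 / G\<^sub>0)"
        unfolding vec_lambda_beta abs_mult
        using 1 2 3 G_inf_nonneg diam_nonneg by (intro mult_mono) auto
    qed
    moreover have "norm (sdev k (fst a) (snd a) \<omega>) \<le> real CARD('p1 + 'p2) * (2 * G_inf)"
      by (rule norm_le_card_bound) (rule good_sdev[OF g aI])
    ultimately have "norm (?w a \<omega>) * norm (sdev k (fst a) (snd a) \<omega>)
      \<le> ?b"
      by (intro mult_mono) (auto intro: order_trans[OF norm_ge_zero])
    then show "\<bar>?w a \<omega> \<bullet> sdev k (fst a) (snd a) \<omega>\<bar>
      \<le> ?b"
      by (rule order_trans[OF Cauchy_Schwarz_ineq2])
  qed
  have intS: "integrable P ?S" using int by (intro integrable_mult_right Bochner_Integration.integrable_sum)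
  then show "integrable P cross" by (subst Bochner_Integration.integrable_cong[OF refl eq])
  have "(LINT \<omega>|P. cross \<omega>) = (LINT \<omega>|P. ?S \<omega>)" by (rule Bochner_Integration.integral_cong[OF refl eq])
  also have "\<dots> = ?c * (\<Sum>a\<in>?J. LINT \<omega>|P. ?w a \<omega> \<bullet> sdev k (fst a) (snd a) \<omega>)"
    using int by (simp add: Bochner_Integration.integral_sum)
  also have "(\<Sum>a\<in>?J. LINT \<omega>|P. ?w a \<omega> \<bullet> sdev k (fst a) (snd a) \<omega>) = 0"
  proof (rule sum.neutral, rule ballI)
    fix a assume a: "a \<in> ?J"
    show "(LINT \<omega>|P. ?w a \<omega> \<bullet> sdev k (fst a) (snd a) \<omega>) = 0"
      using a k by (intro mean_zero[OF _ order_refl past_subset _ w[OF a]]) (auto simp: idx_iff past_def)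
  qed
  finally show "(LINT \<omega>|P. cross \<omega>) = 0" by simp
qed

lemma gF_zbar_integrable: "integrable P (\<lambda>\<omega>. (norm (gF (zbar M T k \<omega>)))\<^sup>2)"
proof (rule integrable_bounded)
  have "zbar M T k \<in> borel_measurable P" by (rule measurable_Fil_P[OF past_subset zbar_measurable[OF k]])
  then show "(\<lambda>\<omega>. (norm (gF (zbar M T k \<omega>)))\<^sup>2) \<in> borel_measurable P"
    by (intro borel_measurable_power measurable_compose[OF _ borel_measurable_norm] measurable_compose[OF _ gF_measurable])
  show "\<bar>(norm (gF (zbar M T k \<omega>)))\<^sup>2\<bar> \<le> (d * G_inf)\<^sup>2" for \<omega>
    using gF_bound by (simp add: power_mono)
qed

end

section \<open>The bound in expectation\<close>

lemma expected_gradient_bound: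
  assumes N: "1 \<le> N" and r: "r \<le> 1 / 2"
  shows "(\<Sum>k\<in>{1..N}. LINT \<omega>|P. (norm (gF (zbar M T k \<omega>)))\<^sup>2)
    \<le> const_coeff G\<^sub>0 G_inf \<eta> diam dir_max (d * G_inf) d
      + variance_coeff G\<^sub>0 G_inf \<eta> * (\<Sum>k\<in>{1..N}. \<sigma>\<^sup>2 / G\<^sub>0\<^sup>2 * (1 / (real M * real (m k))))
      + perturbation_coeff G\<^sub>0 G_inf \<eta> diam pert_max * (momentum_const + real N * (consensus_const * r))"
proof -
  interpret prob_space P by (rule prob_P)
  let ?g = "\<lambda>k \<omega>. (norm (gF (zbar M T k \<omega>)))\<^sup>2" and ?n = "\<lambda>k \<omega>. (norm (grad_noise k \<omega>))\<^sup>2"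
  let ?s = "\<lambda>k. \<sigma>\<^sup>2 / G\<^sub>0\<^sup>2 * (1 / (real M * real (m k)))"
  let ?K = "const_coeff G\<^sub>0 G_inf \<eta> diam dir_max (d * G_inf) d"
  let ?v = "variance_coeff G\<^sub>0 G_inf \<eta>"
  let ?p = "perturbation_coeff G\<^sub>0 G_inf \<eta> diam pert_max * (momentum_const + real N * (consensus_const * r))"
  let ?c = "descent_coeff G\<^sub>0 G_inf \<eta> * (2 * \<eta>)"
  let ?R = "\<lambda>\<omega>. ?K + ?v * (\<Sum>k\<in>{1..N}. ?n k \<omega>) + ?p - ?c * (\<Sum>k\<in>{1..N}. cross k \<omega>)"
  have intn: "integrable P (\<lambda>\<omega>. \<Sum>k\<in>{1..N}. ?n k \<omega>)"
    by (intro Bochner_Integration.integrable_sum grad_noise_second_moment(1))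
  have intc: "integrable P (\<lambda>\<omega>. \<Sum>k\<in>{1..N}. cross k \<omega>)" by (intro Bochner_Integration.integrable_sum cross_mean(1))
  have "(\<Sum>k\<in>{1..N}. LINT \<omega>|P. ?g k \<omega>)
      = (LINT \<omega>|P. (\<Sum>k\<in>{1..N}. ?g k \<omega>))"
    by (intro Bochner_Integration.integral_sum[symmetric] gF_zbar_integrable)
  also have "\<dots> \<le> (LINT \<omega>|P. ?R \<omega>)"
  proof (rule integral_mono_AE)
    show "integrable P (\<lambda>\<omega>. \<Sum>k\<in>{1..N}. ?g k \<omega>)"
      by (intro Bochner_Integration.integrable_sum gF_zbar_integrable)
    show "integrable P ?R"
      using intn intc by (intro Bochner_Integration.integrable_diff Bochner_Integration.integrable_add integrable_mult_right integrable_const)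
    show "AE \<omega> in P. (\<Sum>k\<in>{1..N}. ?g k \<omega>) \<le> ?R \<omega>"
      using AE_good
    proof eventually_elim
      case (elim \<omega>)
      have "(\<Sum>k\<in>{1..N}. cross k \<omega>)
        = (\<Sum>k\<in>{1..N}. \<Sum>s\<in>UNIV. 1 / scale_avg (k - 1) \<omega> $ s * (zbar M T k \<omega> - xs) $ s * grad_noise k \<omega> $ s)"
        by (intro sum.cong refl cross_def)
      then show ?case using path_bound[OF good_tame[OF elim] N r] by simp
    qed
  qed
  also have "\<dots> = ?K + ?v * (LINT \<omega>|P. (\<Sum>k\<in>{1..N}. ?n k \<omega>)) + ?p
      - ?c * (LINT \<omega>|P. (\<Sum>k\<in>{1..N}. cross k \<omega>))"
    using intn intc by (simp add: prob_space)
  also have "(LINT \<omega>|P. (\<Sum>k\<in>{1..N}. cross k \<omega>)) = 0"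
    using cross_mean by (subst Bochner_Integration.integral_sum) auto
  also have "(LINT \<omega>|P. (\<Sum>k\<in>{1..N}. ?n k \<omega>)) = (\<Sum>k\<in>{1..N}. LINT \<omega>|P. ?n k \<omega>)"
    by (intro Bochner_Integration.integral_sum grad_noise_second_moment(1))
  finally have "(\<Sum>k\<in>{1..N}. LINT \<omega>|P. ?g k \<omega>)
    \<le> ?K + ?v * (\<Sum>k\<in>{1..N}. LINT \<omega>|P. ?n k \<omega>) + ?p" by simp
  moreover have "0 \<le> ?v" by (rule coeffs_nonneg(1)[OF G0_pos G_inf_pos eta_pos])
  then have "?v * (\<Sum>k\<in>{1..N}. LINT \<omega>|P. ?n k \<omega>)
    \<le> ?v * (\<Sum>k\<in>{1..N}. ?s k)"
    by (intro mult_left_mono sum_mono grad_noise_second_moment(2))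
  ultimately show ?thesis by linarith
qed

end

section \<open>Complexity in terms of the accuracy\<close>

lemma (in dadam3) rate_power_bound:
  assumes C: "0 \<le> C" and t: "log (1 / mixing_rate W) (1 + C) \<le> real t"
  shows "r \<le> 1 / (1 + C)"
proof (cases "mixing_rate W = 0")
  case True
  \<comment> \<open>At rate 0 the logarithmic condition carries no information; the power is 0
    because \<open>t\<close> is at least 1.\<close>
  then show ?thesis using rounds_pos C by (simp add: power_0_left)
next
  case False
  then have \<rho>: "0 < mixing_rate W" using mixing_rate_nonneg[of W] by simp
  then have b: "1 < 1 / mixing_rate W" using W_rate by simp
  then have "1 + C \<le> (1 / mixing_rate W) powr real t"
    using t C by (simp add: log_le_iff)
  also have "\<dots> = 1 / r" using \<rho> by (simp add: powr_realpow power_one_over)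
  finally show ?thesis using C \<rho> by (simp add: field_simps)
qed

text \<open>Otherwise each of the N terms would exceed \<epsilon>^2, and so would their
  average.\<close>

lemma (in dadam3) exists_SFNE:
  assumes N: "1 \<le> N" and sum: "(\<Sum>k\<in>{1..N}. LINT \<omega>|P. (norm (gF (zbar M T k \<omega>)))\<^sup>2) \<le> real N * \<epsilon>\<^sup>2"
  shows "\<exists>k\<in>{1..N}. SFNE P F \<epsilon> (zbar M T k)"
proof (rule ccontr)
  assume "\<not> ?thesis"
  then have "\<epsilon>\<^sup>2 < (LINT \<omega>|P. (norm (gF (zbar M T k \<omega>)))\<^sup>2)" if "k \<in> {1..N}" for k
    using gF_zbar_integrable[OF that] that by (auto simp: SFNE_def not_le)
  then have "(\<Sum>k\<in>{1..N}. \<epsilon>\<^sup>2) < (\<Sum>k\<in>{1..N}. LINT \<omega>|P. (norm (gF (zbar M T k \<omega>)))\<^sup>2)"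
    using N by (intro sum_strict_mono) auto
  then show False using sum by simp
qed

text \<open>The constants of the locale are rewritten in the numerical parameters and the dimension
  alone. This puts the existential quantifiers in front of objective, network, horizon and
  probability space.\<close>

lemma uniform_gradient_bound:
  fixes G_inf G\<^sub>0 \<sigma> L diam \<beta>\<^sub>1\<^sub>1 \<beta>\<^sub>2 \<beta>\<^sub>3 decay \<eta> :: real
  shows "\<exists>K\<^sub>1 K\<^sub>2 K\<^sub>3 :: real. 0 \<le> K\<^sub>1 \<and> 0 \<le> K\<^sub>2 \<and> 0 \<le> K\<^sub>3 \<and>
    (\<forall>\<D> :: 's measure. \<forall>f :: real ^ ('p1::finite + 'p2::finite) \<Rightarrow> 's \<Rightarrow> real.
      \<forall>xs M E W v0 N t m. \<forall>P :: 'w measure. \<forall>\<xi> T C.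
      dadam3 G_inf G\<^sub>0 \<sigma> L diam \<beta>\<^sub>1\<^sub>1 \<beta>\<^sub>2 \<beta>\<^sub>3 decay \<eta> \<D> f xs M E W v0 N t m P \<xi> T \<longrightarrow>
      1 \<le> N \<longrightarrow> 1 \<le> C \<longrightarrow> log (1 / mixing_rate W) (1 + C) \<le> real t \<longrightarrow>
      (\<Sum>k\<in>{1..N}. LINT \<omega>|P. (norm (signed_grad (global_objective \<D> f M) (zbar M T k \<omega>)))\<^sup>2)
        \<le> K\<^sub>1 + K\<^sub>2 * (\<Sum>k\<in>{1..N}. 1 / (real M * real (m k))) + K\<^sub>3 * (real N / C))"
proof -
  define dd where "dd = real CARD('p1 + 'p2)"
  define Dm where "Dm = dd * (G_inf / G\<^sub>0)"
  define pm where "pm = dd * (G_inf / G\<^sub>0 + 2 * G_inf / G\<^sub>0 + L / G\<^sub>0 * diam)"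
  define pc where "pc = perturbation_coeff G\<^sub>0 G_inf \<eta> diam pm"
  define K1 where "K1 = const_coeff G\<^sub>0 G_inf \<eta> diam Dm (dd * G_inf) dd
    + pc * (dd * (G_inf / G\<^sub>0) + dd * (2 * G_inf / G\<^sub>0) * (1 / (1 - decay)))"
  define K2 where "K2 = variance_coeff G\<^sub>0 G_inf \<eta> * (\<sigma>\<^sup>2 / G\<^sub>0\<^sup>2)"
  define K3 where "K3 = pc * (dd * (L / G\<^sub>0) * (4 * (\<eta> * Dm)))"
  \<comment> \<open>The maxima make the constants nonnegative outright: outside the locale nothing
    is known about the signs of the parameters.\<close>
  have main: "(\<Sum>k\<in>{1..N}. LINT \<omega>|P. (norm (signed_grad (global_objective \<D> f M) (zbar M T k \<omega>)))\<^sup>2)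
        \<le> max 0 K1 + max 0 K2 * (\<Sum>k\<in>{1..N}. 1 / (real M * real (m k))) + max 0 K3 * (real N / C)"
    if dadam: "dadam3 G_inf G\<^sub>0 \<sigma> L diam \<beta>\<^sub>1\<^sub>1 \<beta>\<^sub>2 \<beta>\<^sub>3 decay \<eta> \<D> f xs M E W v0 N t m P \<xi> T"
      and N: "1 \<le> N" and C: "1 \<le> C" and t: "log (1 / mixing_rate W) (1 + C) \<le> real t"
    for \<D> :: "'s measure" and f :: "real ^ ('p1 + 'p2) \<Rightarrow> 's \<Rightarrow> real" and xs M E W v0 N t m
      and P :: "'w measure" and \<xi> T C
  proof -
    interpret dadam3 G_inf G\<^sub>0 \<sigma> L diam \<beta>\<^sub>1\<^sub>1 \<beta>\<^sub>2 \<beta>\<^sub>3 decay \<eta> \<D> f xs M E W v0 N t m P \<xi> T by (rule dadam)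
    let ?r = "mixing_rate W ^ t"
    have r: "?r \<le> 1 / (1 + C)" using rate_power_bound[OF _ t] C by simp
    also have "\<dots> \<le> 1 / C" using C by (intro divide_left_mono) auto
    finally have rC: "?r \<le> 1 / C" .
    \<comment> \<open>This is the purpose of C \<ge> 1: the consensus recursion closes for a power
      of at most 1/2.\<close>
    have "1 / (1 + C) \<le> 1 / 2" using C by simp
    then have r2: "?r \<le> 1 / 2" using r by linarith
    have d0: "0 \<le> dd" unfolding dd_def by (rule of_nat_0_le_iff)
    have pc: "0 \<le> pc"
    proof -
      have "0 \<le> pm"
        unfolding pm_def using d0 G0_pos G_inf_pos L_nonneg diam_nonneg by (intro mult_nonneg_nonneg) auto
      then show ?thesis
        unfolding pc_def using G0_pos G_inf_pos diam_nonneg eta_pos by (intro coeffs_nonneg(2))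
    qed
    have K3: "0 \<le> K3" unfolding K3_def Dm_def
      using pc d0 G0_pos G_inf_pos L_nonneg eta_pos by (intro mult_nonneg_nonneg) auto
    have "(\<Sum>k\<in>{1..N}. LINT \<omega>|P. (norm (signed_grad (global_objective \<D> f M) (zbar M T k \<omega>)))\<^sup>2)
      \<le> const_coeff G\<^sub>0 G_inf \<eta> diam Dm (dd * G_inf) dd
        + variance_coeff G\<^sub>0 G_inf \<eta> * (\<Sum>k\<in>{1..N}. \<sigma>\<^sup>2 / G\<^sub>0\<^sup>2 * (1 / (real M * real (m k))))
        + pc * ((dd * (G_inf / G\<^sub>0) + dd * (2 * G_inf / G\<^sub>0) * (1 / (1 - decay)))
          + real N * (dd * (L / G\<^sub>0) * (4 * (\<eta> * Dm)) * ?r))"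
      using expected_gradient_bound[OF N r2]
      unfolding dir_max_def pert_max_def momentum_const_def consensus_const_def d_def
        pc_def pm_def Dm_def dd_def .
    also have "\<dots> = K1 + K2 * (\<Sum>k\<in>{1..N}. 1 / (real M * real (m k))) + K3 * (real N * ?r)"
      unfolding K1_def K2_def K3_def sum_distrib_left[symmetric] by (simp add: algebra_simps)
    also have "\<dots> \<le> max 0 K1 + max 0 K2 * (\<Sum>k\<in>{1..N}. 1 / (real M * real (m k))) + max 0 K3 * (real N / C)"
    proof (intro add_mono mult_mono)
      show "real N * ?r \<le> real N / C" using mult_left_mono[OF rC, of "real N"] by simp
    qed (use mixing_rate_nonneg[of W] in \<open>auto intro!: sum_nonneg\<close>)
    finally show ?thesis .
  qed
  show ?thesis
    by (rule exI[of _ "max 0 K1"], rule exI[of _ "max 0 K2"], rule exI[of _ "max 0 K3"])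
      (use main in \<open>auto simp only: max.cobounded1\<close>)
qed

section \<open>Logarithms and orders of growth\<close>

text \<open>The inequality ln y \<le> y - 1 at y = (N + 1) / (N + 2) compares each new summand with
  the growth of the logarithm.\<close>

lemma sum_inverse_Suc_le_ln: "(\<Sum>k\<in>{1..N}. 1 / real (k + 1)) \<le> ln (real N + 1)"
proof (induct N)
  case (Suc N)
  have "ln ((real N + 1) / (real N + 2)) \<le> (real N + 1) / (real N + 2) - 1"
    by (rule ln_le_minus_one) simp
  then have "1 / (real N + 2) \<le> ln (real N + 2) - ln (real N + 1)"
    by (simp add: ln_div field_simps)
  then show ?case using Suc by (simp add: add.commute)
qed simp

text \<open>The tangent of the logarithm at \<open>6 K / \<epsilon>\<^sup>2\<close> turns \<open>ln (N + 1)\<close> into a linear function of \<open>N\<close>.\<close>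

lemma ln_linear_bound:
  fixes K \<epsilon> x :: real
  assumes K: "1 \<le> K" and \<epsilon>: "0 < \<epsilon>" and x: "6 * K / \<epsilon>\<^sup>2 * \<bar>ln (6 * K / \<epsilon>\<^sup>2)\<bar> + 1 \<le> x"
  shows "K * ln (x + 1) \<le> x * \<epsilon>\<^sup>2 / 3"
proof -
  \<comment> \<open>With this point of tangency the slope K / a is \<epsilon>^2 / 6, half of the
    allowed \<epsilon>^2 / 3; the hypothesis on x pays for the rest with the other half.\<close>
  define a where "a = 6 * K / \<epsilon>\<^sup>2"
  have a: "a > 0" using K \<epsilon> by (simp add: a_def)
  have "0 \<le> 6 * K / \<epsilon>\<^sup>2 * \<bar>ln (6 * K / \<epsilon>\<^sup>2)\<bar>" using K by simp
  then have x0: "x > 0" using x by linarith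
  have "ln ((x + 1) / a) \<le> (x + 1) / a - 1" using a x0 by (intro ln_le_minus_one) simp
  then have "ln (x + 1) \<le> \<bar>ln a\<bar> + (x + 1) / a" using a x0 by (simp add: ln_div)
  then have "K * ln (x + 1) \<le> K * (\<bar>ln a\<bar> + (x + 1) / a)" using K by (intro mult_left_mono) auto
  also have "\<dots> = \<epsilon>\<^sup>2 / 6 * (a * \<bar>ln a\<bar> + 1) + x * \<epsilon>\<^sup>2 / 6"
    using K \<epsilon> by (simp add: a_def field_simps)
  also have "\<dots> \<le> \<epsilon>\<^sup>2 / 6 * x + x * \<epsilon>\<^sup>2 / 6"
    using x unfolding a_def by (intro add_right_mono mult_left_mono) auto
  finally show ?thesis by simp
qed

lemma eventually_small: "c > 0 \<Longrightarrow> eventually (\<lambda>\<epsilon>::real. 0 < \<epsilon> \<and> \<epsilon> < c) (at_right 0)"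
  by (auto simp: eventually_at_right_field)

lemma inverse_square_bigo:
  fixes a b :: real
  assumes "0 \<le> a" "0 \<le> b"
  shows "(\<lambda>\<epsilon>. a / \<epsilon> ^ 2 + b) \<in> O[at_right 0](\<lambda>\<epsilon>. 1 / \<epsilon> ^ 2)"
proof (rule bigoI)
  show "\<forall>\<^sub>F \<epsilon> in at_right 0. norm (a / \<epsilon>\<^sup>2 + b) \<le> (a + b) * norm (1 / \<epsilon>\<^sup>2)"
    using eventually_small[of 1, simplified]
  proof eventually_elim
    case (elim \<epsilon>)
    then have "1 \<le> 1 / \<epsilon>\<^sup>2" by (simp add: power_le_one)
    then have "b * 1 \<le> b * (1 / \<epsilon>\<^sup>2)" using assms by (intro mult_left_mono) auto
    then show ?case using assms by (simp add: add_divide_distrib)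
  qed
qed

lemma inverse_square_bigo4: "(\<lambda>\<epsilon>::real. 1 / \<epsilon> ^ 2) \<in> O[at_right 0](\<lambda>\<epsilon>. 1 / \<epsilon> ^ 4)"
proof (rule bigoI[where c = 1])
  show "\<forall>\<^sub>F \<epsilon> in at_right 0. norm (1 / \<epsilon>\<^sup>2) \<le> 1 * norm (1 / (\<epsilon>::real) ^ 4)"
    using eventually_small[of 1, simplified]
  proof eventually_elim
    case (elim \<epsilon>)
    then have "\<epsilon> ^ 4 \<le> \<epsilon>\<^sup>2" by (intro power_decreasing) auto
    then show ?case using elim by (simp add: divide_left_mono)
  qed
qed

lemma bigo_imp_soft_bigo: "h \<in> O[Fl](g) \<Longrightarrow> h \<in> soft_bigo Fl g"
  unfolding soft_bigo_def by (auto intro!: exI[of _ 0])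

lemma inverse_square_ln_soft_bigo:
  fixes a b K :: real
  assumes "0 \<le> a" "0 \<le> b" "1 \<le> K"
  shows "(\<lambda>\<epsilon>. a / \<epsilon>\<^sup>2 + (6 * K / \<epsilon>\<^sup>2 * \<bar>ln (6 * K / \<epsilon>\<^sup>2)\<bar> + b)) \<in> soft_bigo (at_right 0) (\<lambda>\<epsilon>. 1 / \<epsilon> ^ 2)"
  unfolding soft_bigo_def
proof (intro CollectI exI[of _ 1] bigoI[where c = "a + 6 * K * (\<bar>ln (6 * K)\<bar> + 1) + b"])
  show "\<forall>\<^sub>F \<epsilon> in at_right 0. norm (a / \<epsilon>\<^sup>2 + (6 * K / \<epsilon>\<^sup>2 * \<bar>ln (6 * K / \<epsilon>\<^sup>2)\<bar> + b))
    \<le> (a + 6 * K * (\<bar>ln (6 * K)\<bar> + 1) + b) * norm (1 / \<epsilon>\<^sup>2 * \<bar>ln (1 / \<epsilon>\<^sup>2)\<bar> ^ 1)"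
    using eventually_small[of "exp (- 1)", simplified]
  proof eventually_elim
    case (elim \<epsilon>)
    let ?h = "a / \<epsilon>\<^sup>2 + (6 * K / \<epsilon>\<^sup>2 * \<bar>ln (6 * K / \<epsilon>\<^sup>2)\<bar> + b)" and ?c = "a + 6 * K * (\<bar>ln (6 * K)\<bar> + 1) + b"
    define u where "u = 1 / \<epsilon>\<^sup>2"
    define l where "l = ln u"
    \<comment> \<open>Below exp (-1) the quantity \<open>l\<close> is at least 1, so that the one
      logarithmic factor absorbs all additive constants.\<close>
    have "ln \<epsilon> < - 1" using elim by (metis exp_gt_zero ln_exp ln_less_cancel_iff)
    moreover have "l = - 2 * ln \<epsilon>" using elim by (simp add: l_def u_def ln_div ln_realpow)
    ultimately have l: "1 \<le> l" by simp
    have "exp (- 1) < (1 :: real)" by simp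
    then have "\<epsilon> < 1" using elim by linarith
    then have u: "1 \<le> u" using elim by (simp add: u_def power_le_one)
    have "ln (6 * K / \<epsilon>\<^sup>2) = ln (6 * K) + l"
      using elim assms by (simp add: l_def u_def ln_div)
    then have "\<bar>ln (6 * K / \<epsilon>\<^sup>2)\<bar> \<le> \<bar>ln (6 * K)\<bar> + l" using l by simp
    also have "\<dots> \<le> \<bar>ln (6 * K)\<bar> * l + l" using l mult_left_mono[OF l, of "\<bar>ln (6 * K)\<bar>"] by simp
    finally have lnb: "\<bar>ln (6 * K / \<epsilon>\<^sup>2)\<bar> \<le> (\<bar>ln (6 * K)\<bar> + 1) * l" by (simp add: algebra_simps)
    have "u * 1 \<le> u * l" using u l by (intro mult_left_mono) auto
    then have "u \<le> u * l" by simp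
    then have ul: "u \<le> u * l" "1 \<le> u * l" using u by linarith+
    have "?h = a * u + (6 * K * u * \<bar>ln (6 * K / \<epsilon>\<^sup>2)\<bar> + b * 1)"
      by (simp add: u_def)
    also have "\<dots> \<le> a * (u * l) + (6 * K * u * ((\<bar>ln (6 * K)\<bar> + 1) * l) + b * (u * l))"
      using assms u ul lnb by (intro add_mono mult_left_mono) auto
    also have "\<dots> = ?c * (u * l)" by (simp add: algebra_simps)
    finally have le: "?h
      \<le> ?c * (u * l)" .
    have right: "norm (1 / \<epsilon>\<^sup>2 * \<bar>ln (1 / \<epsilon>\<^sup>2)\<bar> ^ 1) = u * l"
      unfolding u_def[symmetric] l_def[symmetric] using u l by (simp add: abs_mult)
    have left: "norm (?h)
      = ?h" using assms by simp
    show ?case unfolding left right by (rule le)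
  qed
qed

text \<open>Orders of magnitude are read as thresholds: functions of \<epsilon> chosen before the
  instance, such that all larger values succeed too. A quantity of order 1 is one bounded by
  \<open>B\<close>.\<close>

theorem corollary5p2:
  fixes G_inf G\<^sub>0 \<sigma> L diam \<beta>\<^sub>1\<^sub>1 \<beta>\<^sub>2 \<beta>\<^sub>3 decay \<eta> :: real
    and B :: nat
  shows
     "(\<exists>N\<^sub>0 m\<^sub>0 C\<^sub>0 :: real \<Rightarrow> real.
         N\<^sub>0 \<in> soft_bigo (at_right 0) (\<lambda>\<epsilon>. 1 / \<epsilon> ^ 2) \<and>
         m\<^sub>0 \<in> O[at_right 0](\<lambda>\<epsilon>. 1 / \<epsilon> ^ 2) \<and>
         C\<^sub>0 \<in> O[at_right 0](\<lambda>\<epsilon>. 1 / \<epsilon> ^ 2) \<and>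
         (\<forall>\<epsilon>>0. \<forall>\<D> :: 's measure. \<forall>f :: real ^ ('p1::finite + 'p2::finite) \<Rightarrow> 's \<Rightarrow> real.
          \<forall>xs M E W v0 N t m. \<forall>P :: 'w measure. \<forall>\<xi> T C.
            dadam3 G_inf G\<^sub>0 \<sigma> L diam \<beta>\<^sub>1\<^sub>1 \<beta>\<^sub>2 \<beta>\<^sub>3 decay \<eta> \<D> f xs M E W v0 N t m P \<xi> T \<longrightarrow>
            N\<^sub>0 \<epsilon> \<le> real N \<longrightarrow>
            (\<forall>k\<in>{1..N}. m\<^sub>0 \<epsilon> \<le> real (m k)) \<longrightarrow>
            M \<le> B \<longrightarrow>
            C\<^sub>0 \<epsilon> \<le> C \<longrightarrow>
            log (1 / mixing_rate W) (1 + C) \<le> real t \<longrightarrow>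
            (\<exists>k\<in>{1..N}. SFNE P (global_objective \<D> f M) \<epsilon> (zbar M T k)))) \<and>
      (\<exists>N\<^sub>0 C\<^sub>0 :: real \<Rightarrow> real.
         N\<^sub>0 \<in> soft_bigo (at_right 0) (\<lambda>\<epsilon>. 1 / \<epsilon> ^ 2) \<and>
         C\<^sub>0 \<in> O[at_right 0](\<lambda>\<epsilon>. 1 / \<epsilon> ^ 2) \<and>
         (\<forall>\<epsilon>>0. \<forall>\<D> :: 's measure. \<forall>f :: real ^ ('p1::finite + 'p2::finite) \<Rightarrow> 's \<Rightarrow> real.
          \<forall>xs M E W v0 N t m. \<forall>P :: 'w measure. \<forall>\<xi> T C.
            dadam3 G_inf G\<^sub>0 \<sigma> L diam \<beta>\<^sub>1\<^sub>1 \<beta>\<^sub>2 \<beta>\<^sub>3 decay \<eta> \<D> f xs M E W v0 N t m P \<xi> T \<longrightarrow>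
            N\<^sub>0 \<epsilon> \<le> real N \<longrightarrow>
            (\<forall>k\<in>{1..N}. m k = k + 1) \<longrightarrow>
            M \<le> B \<longrightarrow>
            C\<^sub>0 \<epsilon> \<le> C \<longrightarrow>
            log (1 / mixing_rate W) (1 + C) \<le> real t \<longrightarrow>
            (\<exists>k\<in>{1..N}. SFNE P (global_objective \<D> f M) \<epsilon> (zbar M T k)))) \<and>
      (\<exists>N\<^sub>0 M\<^sub>0 C\<^sub>0 :: real \<Rightarrow> real.
         N\<^sub>0 \<in> soft_bigo (at_right 0) (\<lambda>\<epsilon>. 1 / \<epsilon> ^ 2) \<and>
         M\<^sub>0 \<in> O[at_right 0](\<lambda>\<epsilon>. 1 / \<epsilon> ^ 2) \<and>
         C\<^sub>0 \<in> O[at_right 0](\<lambda>\<epsilon>. 1 / \<epsilon> ^ 4) \<and>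
         (\<forall>\<epsilon>>0. \<forall>\<D> :: 's measure. \<forall>f :: real ^ ('p1::finite + 'p2::finite) \<Rightarrow> 's \<Rightarrow> real.
          \<forall>xs M E W v0 N t m. \<forall>P :: 'w measure. \<forall>\<xi> T C.
            dadam3 G_inf G\<^sub>0 \<sigma> L diam \<beta>\<^sub>1\<^sub>1 \<beta>\<^sub>2 \<beta>\<^sub>3 decay \<eta> \<D> f xs M E W v0 N t m P \<xi> T \<longrightarrow>
            N\<^sub>0 \<epsilon> \<le> real N \<longrightarrow>
            (\<forall>k\<in>{1..N}. m k \<le> B) \<longrightarrow>
            M\<^sub>0 \<epsilon> \<le> real M \<longrightarrow>
            C\<^sub>0 \<epsilon> \<le> C \<longrightarrow>
            log (1 / mixing_rate W) (1 + C) \<le> real t \<longrightarrow>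
            (\<exists>k\<in>{1..N}. SFNE P (global_objective \<D> f M) \<epsilon> (zbar M T k))))"
proof -
  obtain K1 K2' K3 :: real where K0: "0 \<le> K1" "0 \<le> K2'" "0 \<le> K3"
    and bound: "\<And>(\<D> :: 's measure) (f :: real ^ ('p1 + 'p2) \<Rightarrow> 's \<Rightarrow> real) xs M E W v0 N t m (P :: 'w measure) \<xi> T C.
      dadam3 G_inf G\<^sub>0 \<sigma> L diam \<beta>\<^sub>1\<^sub>1 \<beta>\<^sub>2 \<beta>\<^sub>3 decay \<eta> \<D> f xs M E W v0 N t m P \<xi> T \<Longrightarrow>
      1 \<le> N \<Longrightarrow> 1 \<le> C \<Longrightarrow> log (1 / mixing_rate W) (1 + C) \<le> real t \<Longrightarrow>
      (\<Sum>k\<in>{1..N}. LINT \<omega>|P. (norm (signed_grad (global_objective \<D> f M) (zbar M T k \<omega>)))\<^sup>2)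
        \<le> K1 + K2' * (\<Sum>k\<in>{1..N}. 1 / (real M * real (m k))) + K3 * (real N / C)"
    using uniform_gradient_bound[where 's = 's and 'w = 'w and ?'p1.0 = 'p1 and ?'p2.0 = 'p2,
        of G_inf G\<^sub>0 \<sigma> L diam \<beta>\<^sub>1\<^sub>1 \<beta>\<^sub>2 \<beta>\<^sub>3 decay \<eta>] by blast
  \<comment> \<open>Raised to at least 1, as the logarithmic estimate requires; it also makes the
    batch threshold positive.\<close>
  define K2 where "K2 = K2' + 1"
  have K2: "1 \<le> K2" "K2' \<le> K2" using K0 by (auto simp: K2_def)
  \<comment> \<open>The factors 3 stem from the equal shares N \<epsilon>^2 / 3 of the constant, the
    variance and the consensus term. The summands 1 ensure N \<ge> 1 and C \<ge> 1.\<close>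
  define N\<^sub>0 N\<^sub>2 C\<^sub>0 m\<^sub>0 :: "real \<Rightarrow> real" where
    "N\<^sub>0 \<epsilon> = 3 * K1 / \<epsilon>\<^sup>2 + 1" and
    "N\<^sub>2 \<epsilon> = 3 * K1 / \<epsilon>\<^sup>2 + (6 * K2 / \<epsilon>\<^sup>2 * \<bar>ln (6 * K2 / \<epsilon>\<^sup>2)\<bar> + 1)" and
    "C\<^sub>0 \<epsilon> = 3 * K3 / \<epsilon>\<^sup>2 + 1" and "m\<^sub>0 \<epsilon> = 3 * K2 / \<epsilon>\<^sup>2 + 0" for \<epsilon>
  have orders: "N\<^sub>0 \<in> soft_bigo (at_right 0) (\<lambda>\<epsilon>. 1 / \<epsilon> ^ 2)" "N\<^sub>2 \<in> soft_bigo (at_right 0) (\<lambda>\<epsilon>. 1 / \<epsilon> ^ 2)"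
    "C\<^sub>0 \<in> O[at_right 0](\<lambda>\<epsilon>. 1 / \<epsilon> ^ 2)" "m\<^sub>0 \<in> O[at_right 0](\<lambda>\<epsilon>. 1 / \<epsilon> ^ 2)"
    "C\<^sub>0 \<in> O[at_right 0](\<lambda>\<epsilon>. 1 / \<epsilon> ^ 4)"
  proof -
    show C: "C\<^sub>0 \<in> O[at_right 0](\<lambda>\<epsilon>. 1 / \<epsilon> ^ 2)" and "m\<^sub>0 \<in> O[at_right 0](\<lambda>\<epsilon>. 1 / \<epsilon> ^ 2)"
      unfolding C\<^sub>0_def[abs_def] m\<^sub>0_def[abs_def] using K0 K2 by (intro inverse_square_bigo; simp)+
    \<comment> \<open>The threshold of order -2 for C also suffices in the third setting, where
      order -4 is permitted.\<close>
    show "C\<^sub>0 \<in> O[at_right 0](\<lambda>\<epsilon>. 1 / \<epsilon> ^ 4)" by (rule landau_o.big_trans[OF C inverse_square_bigo4])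
    show "N\<^sub>0 \<in> soft_bigo (at_right 0) (\<lambda>\<epsilon>. 1 / \<epsilon> ^ 2)"
      unfolding N\<^sub>0_def[abs_def] using K0 by (intro bigo_imp_soft_bigo inverse_square_bigo) simp_all
    show "N\<^sub>2 \<in> soft_bigo (at_right 0) (\<lambda>\<epsilon>. 1 / \<epsilon> ^ 2)"
      unfolding N\<^sub>2_def[abs_def] using K0 K2 by (intro inverse_square_ln_soft_bigo) simp_all
  qed
  have SFNE: "\<exists>k\<in>{1..N}. SFNE P (global_objective \<D> f M) \<epsilon> (zbar M T k)"
    if \<epsilon>: "0 < \<epsilon>"
      and dadam: "dadam3 G_inf G\<^sub>0 \<sigma> L diam \<beta>\<^sub>1\<^sub>1 \<beta>\<^sub>2 \<beta>\<^sub>3 decay \<eta> \<D> f xs M E W v0 N t m P \<xi> T"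
      and N: "N\<^sub>0 \<epsilon> \<le> real N"
      and variance: "K2 * (\<Sum>k\<in>{1..N}. 1 / (real M * real (m k))) \<le> real N * \<epsilon>\<^sup>2 / 3"
      and C: "C\<^sub>0 \<epsilon> \<le> C" and t: "log (1 / mixing_rate W) (1 + C) \<le> real t"
    for \<epsilon> C :: real and \<D> :: "'s measure" and f :: "real ^ ('p1 + 'p2) \<Rightarrow> 's \<Rightarrow> real" and xs M E W v0 N t m
      and P :: "'w measure" and \<xi> T
  proof -
    have "0 \<le> 3 * K1 / \<epsilon>\<^sup>2" "0 \<le> 3 * K3 / \<epsilon>\<^sup>2" using K0 by auto
    then have N1: "1 \<le> N" and C1: "1 \<le> C" and "3 * K1 / \<epsilon>\<^sup>2 \<le> real N" "3 * K3 / \<epsilon>\<^sup>2 \<le> C"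
      using N C by (auto simp: N\<^sub>0_def C\<^sub>0_def)
    then have K1N: "K1 \<le> real N * \<epsilon>\<^sup>2 / 3" and K3C: "K3 \<le> C * \<epsilon>\<^sup>2 / 3"
      using \<epsilon> by (simp_all add: field_simps)
    have "K3 * (real N / C) \<le> C * \<epsilon>\<^sup>2 / 3 * (real N / C)" using K3C C1 by (intro mult_right_mono) auto
    also have "\<dots> = real N * \<epsilon>\<^sup>2 / 3" using C1 by simp
    finally have "K3 * (real N / C) \<le> real N * \<epsilon>\<^sup>2 / 3" .
    moreover have "K2' * (\<Sum>k\<in>{1..N}. 1 / (real M * real (m k))) \<le> K2 * (\<Sum>k\<in>{1..N}. 1 / (real M * real (m k)))"
      using K2 by (intro mult_right_mono sum_nonneg) auto
    ultimately have "(\<Sum>k\<in>{1..N}. LINT \<omega>|P. (norm (signed_grad (global_objective \<D> f M) (zbar M T k \<omega>)))\<^sup>2)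
        \<le> real N * \<epsilon>\<^sup>2"
      using bound[OF dadam N1 C1 t] K1N variance by linarith
    then show ?thesis by (rule dadam3.exists_SFNE[OF dadam N1])
  qed
  \<comment> \<open>Only the product of node number and batch size matters here, so this serves both
    the setting with large batches and the one with many nodes.\<close>
  have batch: "K2 * (\<Sum>k\<in>{1..N}. 1 / (real M * real (m k))) \<le> real N * \<epsilon>\<^sup>2 / 3"
    if "0 < \<epsilon>" and large: "\<And>k. k \<in> {1..N} \<Longrightarrow> m\<^sub>0 \<epsilon> \<le> real M * real (m k)" for \<epsilon> M N m
  proof -
    have "K2 * (1 / (real M * real (m k))) \<le> \<epsilon>\<^sup>2 / 3" if k: "k \<in> {1..N}" for k
    proof -
      have le: "3 * K2 / \<epsilon>\<^sup>2 \<le> real M * real (m k)" using large[OF k] by (simp add: m\<^sub>0_def)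
      moreover have "0 < 3 * K2 / \<epsilon>\<^sup>2" using \<open>0 < \<epsilon>\<close> K2 by simp
      ultimately have "0 < real M * real (m k)" by linarith
      then show ?thesis using le \<open>0 < \<epsilon>\<close> by (simp add: field_simps)
    qed
    then have "(\<Sum>k\<in>{1..N}. K2 * (1 / (real M * real (m k)))) \<le> (\<Sum>k\<in>{1..N}. \<epsilon>\<^sup>2 / 3)" by (rule sum_mono)
    then show ?thesis by (simp add: sum_distrib_left)
  qed
  have M1: "1 \<le> M" "\<And>k. k \<in> {1..N} \<Longrightarrow> 1 \<le> m k"
    if "dadam3 G_inf G\<^sub>0 \<sigma> L diam \<beta>\<^sub>1\<^sub>1 \<beta>\<^sub>2 \<beta>\<^sub>3 decay \<eta> \<D> f xs M E W v0 N t m P \<xi> T"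
    for \<D> :: "'s measure" and f :: "real ^ ('p1 + 'p2) \<Rightarrow> 's \<Rightarrow> real" and xs M E W v0 N t m
      and P :: "'w measure" and \<xi> T
    using dadam3.M_pos[OF that] dadam3.batch_pos[OF that] .
  show ?thesis
  proof (intro conjI, goal_cases)
    case 1
    show ?case
    proof (rule exI[of _ N\<^sub>0], rule exI[of _ m\<^sub>0], rule exI[of _ C\<^sub>0], intro conjI orders allI impI, goal_cases)
      case (1 \<epsilon> \<D> f xs M E W v0 N t m P \<xi> T C)
      have "m\<^sub>0 \<epsilon> \<le> real M * real (m k)" if "k \<in> {1..N}" for k
      proof -
        have "1 * real (m k) \<le> real M * real (m k)" using M1(1)[OF 1(2)] by (intro mult_right_mono) auto
        then show ?thesis using 1(4) that by fastforce
      qed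
      then show ?case by (intro SFNE[OF 1(1,2,3) batch 1(6,7)] 1(1))
    qed
  next
    case 2
    show ?case
    proof (rule exI[of _ N\<^sub>2], rule exI[of _ C\<^sub>0], intro conjI orders allI impI, goal_cases)
      case (1 \<epsilon> \<D> f xs M E W v0 N t m P \<xi> T C)
      have M: "1 \<le> real M" using M1(1)[OF 1(2)] by simp
      \<comment> \<open>Both parts of \<open>N\<^sub>2\<close> are nonnegative, so it dominates
        \<open>N\<^sub>0\<close> as well as the threshold of the logarithmic estimate.\<close>
      have parts: "0 \<le> 3 * K1 / \<epsilon>\<^sup>2" "0 \<le> 6 * K2 / \<epsilon>\<^sup>2 * \<bar>ln (6 * K2 / \<epsilon>\<^sup>2)\<bar>" using K0 K2 by auto
      have N: "N\<^sub>0 \<epsilon> \<le> real N" "6 * K2 / \<epsilon>\<^sup>2 * \<bar>ln (6 * K2 / \<epsilon>\<^sup>2)\<bar> + 1 \<le> real N"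
        using 1(3) parts by (auto simp: N\<^sub>0_def N\<^sub>2_def)
      have "(\<Sum>k\<in>{1..N}. 1 / (real M * real (m k))) \<le> (\<Sum>k\<in>{1..N}. 1 / real (k + 1))"
      proof (rule sum_mono)
        fix k assume "k \<in> {1..N}"
        then have "m k = k + 1" using 1(4) by blast
        moreover have "1 * real (k + 1) \<le> real M * real (k + 1)" using M by (intro mult_right_mono) auto
        ultimately show "1 / (real M * real (m k)) \<le> 1 / real (k + 1)"
          using M by (intro divide_left_mono) auto
      qed
      also have "\<dots> \<le> ln (real N + 1)" by (rule sum_inverse_Suc_le_ln)
      finally have "K2 * (\<Sum>k\<in>{1..N}. 1 / (real M * real (m k))) \<le> K2 * ln (real N + 1)"
        using K2 by (intro mult_left_mono) auto
      also have "\<dots> \<le> real N * \<epsilon>\<^sup>2 / 3" by (rule ln_linear_bound[OF K2(1) 1(1) N(2)])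
      finally show ?case by (rule SFNE[OF 1(1,2) N(1) _ 1(6,7)])
    qed
  next
    \<comment> \<open>The threshold for the nodes is \<open>m\<^sub>0\<close> again: with at least
      one sample per node, M alone makes the product large.\<close>
    case 3
    show ?case
    proof (rule exI[of _ N\<^sub>0], rule exI[of _ m\<^sub>0], rule exI[of _ C\<^sub>0], intro conjI orders allI impI, goal_cases)
      case (1 \<epsilon> \<D> f xs M E W v0 N t m P \<xi> T C)
      have "m\<^sub>0 \<epsilon> \<le> real M * real (m k)" if "k \<in> {1..N}" for k
      proof -
        have "real M * 1 \<le> real M * real (m k)" using M1(2)[OF 1(2) that] by (intro mult_left_mono) auto
        then show ?thesis using 1(5) by linarith
      qed
      then show ?case by (intro SFNE[OF 1(1,2,3) batch 1(6,7)] 1(1))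
    qed
  qed
qed

end
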